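(* Let $\nu\ge\frac12$ be real, let $0<j_{\nu,1}<j_{\nu,2}<\cdots$ be the positive zeros of the Bessel function $J_\nu$ and put $j_{\nu,-k}=-j_{\nu,k}$ for $k\ge1$. Let $\varphi_1,\dots,\varphi_n$ be nonconstant monic polynomials with complex coefficients that do not vanish at $j_{\nu,k}/\pi$ for any integer $k\neq0$, and let $\Omega$ be the multiset of all roots of $\varphi_1,\dots,\varphi_n$, counted with multiplicity. Then $$ \begin{aligned} \mathrm{RP}_{k\neq0}\Big[\prod_{j=1}^{n}\varphi_j\Big(\frac{j_{\nu,k}}{\pi}\Big)\Big]&=\prod_{j=1}^{n}\mathrm{RP}_{k\ne0}\Big[\varphi_j\Big(\frac{j_{\nu,k}}{\pi}\Big)\Big]\\ &=\prod_{w\in\Omega}\frac{\sqrt2\,\pi}{w^{\nu}}J_\nu(\pi w)\exp\Big(-\frac{\pi i}{2}\Big(\nu+\frac12\Big)-w\,\mathrm{FP}\,\zeta^*_{J_\nu}(1)\Big), \end{aligned} $$ where $\mathrm{RP}_{k\ne0}$ denotes the zeta regularized product over all nonzero integers $k$.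
   Context: $J_\nu(z)=\sum_{n\ge0}\frac{(-1)^n}{n!\,\Gamma(n+\nu+1)}\left(\frac z2\right)^{2n+\nu}$; the expression $w^{-\nu}J_\nu(\pi w)$ is understood as the entire function $\sum_{n\ge0}\frac{(-1)^n}{n!\,\Gamma(n+\nu+1)}\left(\frac{\pi}{2}\right)^{2n+\nu}w^{2n}$. Bessel zeta function: $\zeta_{J_\nu}(s)=\sum_{k\ge1}(j_{\nu,k}/\pi)^{-s}$ for $\mathrm{Re}(s)>1$, continued meromorphically, and $\zeta^*_{J_\nu}(s)=(1+e^{-\pi is})\zeta_{J_\nu}(s)$ is the zeta function of the sequence $\{j_{\nu,k}/\pi\}_{k\neq0}$. $\mathrm{FP}\,\zeta^*_{J_\nu}(1)$ is the constant term of the Laurent expansion of $\zeta^*_{J_\nu}$ at $s=1$. Zeta regularized product: for a sequence $\{a_k\}$ of nonzero numbers whose zeta function $\sum_k a_k^{-s}$ converges absolutely in a right half-plane and continues meromorphically to a region containing $s=0$, holomorphically at $s=0$, its zeta regularized product is $\mathrm{RP}_k[a_k]=\exp\left(-\frac{d}{ds}\big|_{s=0}\sum_k a_k^{-s}\right)$. For $a_k=\varphi(\lambda_k)=\prod_w(\lambda_k-w)$, with $\lambda_k=j_{\nu,k}/\pi$ and $\varphi$ monic with roots $w$ (with multiplicity), the power is $a_k^{-s}=\prod_w(\lambda_k-w)^{-s}$. Branch convention: for $k\ge1$, $\log\lambda_k$ is real and $\log\lambda_{-k}=\log\lambda_k+\pi i$; and $(\lambda_k-w)^{-s}=e^{-s\log(\lambda_k-w)}$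 with $\log(\lambda_k-w)=\log\lambda_k+\mathrm{Log}(1-w/\lambda_k)$ (principal $\mathrm{Log}$) whenever $|\lambda_k|>|w|$, any branch being allowed for the finitely many other $k$. *)

theory Defs
  imports "HOL-Complex_Analysis.Complex_Analysis"
begin

text \<open>
  A sequence \<open>(a\<^sub>k)\<close>, \<open>k \<in> I\<close>, enters only through a choice of the powers \<open>P k s = a\<^sub>k\<^sup>-\<^sup>s\<close>.
  The regions of continuation are taken to be convex, so that any two of them meet in a convex
  set containing a half-plane: continuations to them agree there, and no monodromy can make the
  value at a point ambiguous. \<open>nicely_meromorphic_on\<close> only normalizes the values at poles (to 0)
  and at removable singularities.
\<close>

definition zeta_continuation ::
    "'a set \<Rightarrow> ('a \<Rightarrow> complex \<Rightarrow> complex) \<Rightarrow> complex set \<Rightarrow> (complex \<Rightarrow> complex) \<Rightarrow> bool" where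
  "zeta_continuation I P S g \<longleftrightarrow>
     open S \<and> convex S \<and> g nicely_meromorphic_on S \<and>
     (\<exists>c::real. \<forall>s. c < Re s \<longrightarrow>
        s \<in> S \<and> (\<lambda>k. norm (P k s)) summable_on I \<and> g s = (\<Sum>\<^sub>\<infinity>k\<in>I. P k s))"

lemma zeta_continuation_unique:
  assumes "zeta_continuation I P S g" "zeta_continuation I P T h" "s \<in> S" "s \<in> T"
  shows "g s = h s"
proof -
  define U where "U = S \<inter> T"
  have U: "open U" "connected U" "s \<in> U"
    using assms unfolding U_def zeta_continuation_def
    by (auto intro!: convex_connected convex_Int)
  have g: "g nicely_meromorphic_on U" and h: "h nicely_meromorphic_on U"
    using assms unfolding zeta_continuation_def U_def
    by (auto intro: nicely_meromorphic_on_subset)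
  obtain c1 c2 :: real
    where c1: "\<And>z. c1 < Re z \<Longrightarrow> z \<in> S \<and> g z = (\<Sum>\<^sub>\<infinity>k\<in>I. P k z)"
      and c2: "\<And>z. c2 < Re z \<Longrightarrow> z \<in> T \<and> h z = (\<Sum>\<^sub>\<infinity>k\<in>I. P k z)"
    using assms unfolding zeta_continuation_def by metis
  define c where "c = max c1 c2"
  have half: "z \<in> U \<and> g z = h z" if "c < Re z" for z
    using c1[of z] c2[of z] that by (auto simp: c_def U_def)
  define d where "d = (\<lambda>z. g z - h z)"
  have d: "d meromorphic_on U"
    unfolding d_def using g h
    by (auto simp: nicely_meromorphic_on_def intro!: meromorphic_intros)
  have ev_rd: "\<forall>\<^sub>F z in at w. remove_sings d z = d z" if "w \<in> U" for w
    using d that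
    by (intro eventually_remove_sings_eq_at meromorphic_on_isolated_singularity
              meromorphic_on_subset[OF d]) auto
  have rd: "remove_sings d nicely_meromorphic_on U"
    by (rule remove_sings_nicely_meromorphic[OF d])
  define z0 where "z0 = complex_of_real (c + 1)"
  have z0: "c < Re z0" by (simp add: z0_def)
  have "open {z. c < Re z}" by (rule open_halfspace_Re_gt)
  then have evd: "\<forall>\<^sub>F z in nhds z0. d z = 0"
    using half z0 by (auto simp: eventually_nhds d_def)
  then have "\<forall>\<^sub>F z in at z0. d z = 0"
    by (simp add: eventually_nhds_conv_at)
  moreover have "\<forall>\<^sub>F z in at z0. remove_sings d z = d z"
    using half[OF z0] by (intro ev_rd) auto
  ultimately have "\<forall>\<^sub>F z in at z0. remove_sings d z = 0"
    by eventually_elim simp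
  then have "\<exists>\<^sub>F z in at z0. remove_sings d z = 0"
    by (intro eventually_frequently) auto
  then have zero: "remove_sings d z = 0" if "z \<in> U" for z
    using frequently_eq_meromorphic_imp_constant[OF _ rd U(1,2)] half[OF z0] that by blast
  have "\<forall>\<^sub>F z in at s. remove_sings d z = d z"
    using U(3) by (rule ev_rd)
  moreover have "\<forall>\<^sub>F z in at s. z \<in> U"
    using U by (simp add: eventually_at_in_open')
  ultimately have ev: "\<forall>\<^sub>F z in at s. g z = h z"
    by eventually_elim (use zero in \<open>auto simp: d_def\<close>)
  then have pole: "is_pole g s \<longleftrightarrow> is_pole h s"
    by (intro is_pole_cong) auto
  show ?thesis
  proof (cases "is_pole g s")
    case True
    then show ?thesis
      using g h U(3) pole not_tendsto_and_filterlim_at_infinity[of "at s"]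
      unfolding nicely_meromorphic_on_def is_pole_def by (metis at_neq_bot)
  next
    case False
    then have "g \<midarrow>s\<rightarrow> g s" "h \<midarrow>s\<rightarrow> h s"
      using g h U(3) pole by (auto simp: nicely_meromorphic_on_def)
    moreover from this(1) have "h \<midarrow>s\<rightarrow> g s"
      using ev by (simp add: tendsto_cong)
    ultimately show ?thesis
      using LIM_unique by blast
  qed
qed

definition zeta_function :: "'a set \<Rightarrow> ('a \<Rightarrow> complex \<Rightarrow> complex) \<Rightarrow> complex \<Rightarrow> complex" where
  "zeta_function I P s = (THE v. \<exists>S g. zeta_continuation I P S g \<and> s \<in> S \<and> v = g s)"

lemma zeta_function_eq:
  assumes "zeta_continuation I P S g" "s \<in> S"
  shows "zeta_function I P s = g s"
  unfolding zeta_function_def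
  by (rule the_equality) (use assms zeta_continuation_unique in blast)+

definition zeta_regularizable :: "'a set \<Rightarrow> ('a \<Rightarrow> complex \<Rightarrow> complex) \<Rightarrow> bool" where
  "zeta_regularizable I P \<longleftrightarrow>
     (\<exists>S g. zeta_continuation I P S g \<and> 0 \<in> S \<and> g analytic_on {0})"

definition zeta_regularized_product :: "'a set \<Rightarrow> ('a \<Rightarrow> complex \<Rightarrow> complex) \<Rightarrow> complex" where
  "zeta_regularized_product I P = exp (- deriv (zeta_function I P) 0)"

definition finite_part :: "(complex \<Rightarrow> complex) \<Rightarrow> complex \<Rightarrow> complex" where
  "finite_part f z = fls_nth (laurent_expansion f z) 0"


definition bessel_J :: "real \<Rightarrow> complex \<Rightarrow> complex" where
  "bessel_J \<nu> z =
     (\<Sum>n. (-1) ^ n / (fact n * Gamma (of_real (real n + \<nu> + 1)))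
            * (z / 2) powr of_real (2 * real n + \<nu>))"

text \<open>The entire function denoted \<open>w\<^sup>-\<^sup>\<nu> J\<^sub>\<nu>(\<pi> w)\<close>:\<close>

definition bessel_J_entire :: "real \<Rightarrow> complex \<Rightarrow> complex" where
  "bessel_J_entire \<nu> w =
     (\<Sum>n. (-1) ^ n / (fact n * Gamma (of_real (real n + \<nu> + 1)))
            * of_real ((pi / 2) powr (2 * real n + \<nu>)) * w ^ (2 * n))"

definition bessel_zeros :: "real \<Rightarrow> real set" where
  "bessel_zeros \<nu> = {x. 0 < x \<and> bessel_J \<nu> (of_real x) = 0}"

text \<open>The \<open>k\<close>-th positive zero, for \<open>k \<ge> 1\<close>, is the zero with exactly \<open>k\<close> zeros in \<open>(0, x]\<close>.\<close>

definition bessel_pos_zero :: "real \<Rightarrow> nat \<Rightarrow> real" where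
  "bessel_pos_zero \<nu> k =
     (THE x. x \<in> bessel_zeros \<nu> \<and> card {y \<in> bessel_zeros \<nu>. y \<le> x} = k)"

definition bessel_zero :: "real \<Rightarrow> int \<Rightarrow> real" where
  "bessel_zero \<nu> k =
     (if 0 < k then bessel_pos_zero \<nu> (nat k) else - bessel_pos_zero \<nu> (nat (- k)))"

definition bessel_lambda :: "real \<Rightarrow> int \<Rightarrow> real" where
  "bessel_lambda \<nu> k = bessel_zero \<nu> k / pi"

definition log_bessel_lambda :: "real \<Rightarrow> int \<Rightarrow> complex" where
  "log_bessel_lambda \<nu> k =
     (if 0 < k then of_real (ln (bessel_lambda \<nu> k))
      else of_real (ln (bessel_lambda \<nu> (- k))) + of_real pi * \<i>)"

definition bessel_zeta :: "real \<Rightarrow> complex \<Rightarrow> complex" where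
  "bessel_zeta \<nu> = zeta_function {k. 0 < k} (\<lambda>k s. of_real (bessel_lambda \<nu> k) powr (- s))"

definition bessel_zeta_star :: "real \<Rightarrow> complex \<Rightarrow> complex" where
  "bessel_zeta_star \<nu> s = (1 + exp (- (of_real pi * \<i> * s))) * bessel_zeta \<nu> s"


text \<open>\<open>l\<close> is an admissible value of \<open>log (\<lambda>\<^sub>k - w)\<close>.\<close>

definition factor_log :: "real \<Rightarrow> int \<Rightarrow> complex \<Rightarrow> complex \<Rightarrow> bool" where
  "factor_log \<nu> k w l \<longleftrightarrow>
     exp l = of_real (bessel_lambda \<nu> k) - w \<and>
     (norm w < \<bar>bessel_lambda \<nu> k\<bar> \<longrightarrow>
        l = log_bessel_lambda \<nu> k + Ln (1 - w / of_real (bessel_lambda \<nu> k)))"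

text \<open>
  \<open>P k s\<close> is an admissible choice of \<open>\<phi>(\<lambda>\<^sub>k)\<^sup>-\<^sup>s = \<Prod>\<^sub>w (\<lambda>\<^sub>k - w)\<^sup>-\<^sup>s\<close> for all \<open>k \<noteq> 0\<close>. The multiset \<open>L\<close>
  holds one logarithm for each root counted with multiplicity, so where the branch is free even
  the factors of a repeated root may carry different branches.
\<close>

definition poly_powers ::
    "real \<Rightarrow> complex poly \<Rightarrow> (int \<Rightarrow> complex \<Rightarrow> complex) \<Rightarrow> bool" where
  "poly_powers \<nu> \<phi> P \<longleftrightarrow>
     (\<forall>k. k \<noteq> 0 \<longrightarrow>
        (\<exists>L. rel_mset (factor_log \<nu> k) (proots \<phi>) L \<and>
             (\<forall>s. P k s = (\<Prod>l\<in>#L. exp (- s * l)))))"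

end

(*
  Everything rests on the asymptotics lambda_k = k + c + O(1/k) of the scaled positive zeros.
  Sturm comparison for sqrt(x) J_nu(x) bounds the gap after lambda_k between 1 and 1 + O(1/k^2),
  which gives such an expansion with an unknown c.  Comparing lambda_k^(-s) with the integral of
  x^(-s) over an interval of length 1 around k + c then continues the zeta function to Re s > -1,
  with zeta(0) and zeta'(0) appearing as the constants in the expansion of
  sum_k ln (1 + y^2 / lambda_k^2) for large y.  By the product formula for J_nu this sum is also
  governed by the growth of I_nu, and equating the two expansions determines c, zeta(0) and
  zeta'(0) at once.

  For the regularized product, expanding (1 - w/lambda)^(-s) to first order expresses the zeta
  function of the values of a polynomial of degree d through zeta*(d s), s W zeta*(d s + 1), with
  W the sum of the roots, and a series that is holomorphic at 0.  Because zeta* has no pole at 1,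
  the derivative at 0 is a sum of contributions of the individual roots, so that no
  multiplicative anomaly arises.
*)

theory Submission
  imports Defs "HOL-Computational_Algebra.Fundamental_Theorem_Algebra"
    "HOL-Library.Infinite_Set" "HOL-Real_Asymp.Real_Asymp"
begin

section \<open>Zeta functions of shifted natural numbers\<close>

text \<open>The zeros are not known explicitly, so the constants must come from a place where the
  Bessel function is easy to estimate. That place is the imaginary axis, where all terms of its
  series have one sign; no asymptotics of \<open>J\<^sub>\<nu>\<close> on the real axis are used.
  The work is done with the entire function \<open>\<Phi>\<close>, where
  \<open>\<Phi> (w\<^sup>2)\<close> is \<open>w\<^sup>-\<^sup>\<nu> J\<^sub>\<nu>(\<pi> w)\<close>:
  in the variable w^2 the zeros are positive and simple and the canonical product has genus 0. With
  zeros counted from 0, the outcome is c = nu/2 + 3/4, zeta(0) = - (nu/2 + 1/4) and exp (-2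
  zeta'(0)) = sqrt 2 pi \<open>\<Phi> 0\<close>. These values explain the formula. A root w
  contributes exp (-2 zeta'(0)) \<open>\<Phi> (w\<^sup>2) / \<Phi> 0\<close>, in which
  \<open>\<Phi> 0\<close> cancels. The phase is exp (pi i zeta(0)) and comes from log (-1) = pi i on
  the negative side. The finite part of zeta* at 1 is pi i, because the pole of zeta with residue 1
  meets the zero of 1 + exp (- pi i s).\<close>

lemma
  fixes f :: "nat \<Rightarrow> complex \<Rightarrow> complex"
  assumes S: "open S" and hol: "\<And>n. f n holomorphic_on S"
    and bound: "\<And>z. z \<in> S \<Longrightarrow> \<exists>d M. 0 < d \<and> summable M \<and>
                  (\<forall>\<^sub>F n in sequentially. \<forall>w\<in>ball z d \<inter> S. norm (f n w) \<le> M n)"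
  shows holomorphic_on_suminf: "(\<lambda>z. \<Sum>n. f n z) holomorphic_on S"
    and deriv_sums_suminf: "z \<in> S \<Longrightarrow> (\<lambda>n. deriv (f n) z) sums deriv (\<lambda>z. \<Sum>n. f n z) z"
    and summable_of_locally_bounded: "z \<in> S \<Longrightarrow> summable (\<lambda>n. f n z)"
proof -
  have "\<exists>g g'. \<forall>x\<in>S. (\<lambda>n. f n x) sums g x \<and> (\<lambda>n. deriv (f n) x) sums g' x \<and>
          (g has_field_derivative g' x) (at x)"
  proof (rule series_and_derivative_comparison_local[OF S])
    show "(f n has_field_derivative deriv (f n) x) (at x)" if "x \<in> S" for n x
      using holomorphic_derivI[OF hol S that] .
  qed (use bound in blast)
  then obtain g g' where g: "\<And>x. x \<in> S \<Longrightarrow> (\<lambda>n. f n x) sums g x"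
      "\<And>x. x \<in> S \<Longrightarrow> (\<lambda>n. deriv (f n) x) sums g' x"
      "\<And>x. x \<in> S \<Longrightarrow> (g has_field_derivative g' x) (at x)"
    by blast
  have eq: "(\<Sum>n. f n x) = g x" if "x \<in> S" for x
    using g(1)[OF that] by (simp add: sums_iff)
  have der: "((\<lambda>z. \<Sum>n. f n z) has_field_derivative g' x) (at x)" if "x \<in> S" for x
    using has_field_derivative_transform_within_open[OF g(3)[OF that] S that] eq by metis
  show "(\<lambda>z. \<Sum>n. f n z) holomorphic_on S"
    using der S by (auto simp: holomorphic_on_open)
  show "(\<lambda>n. deriv (f n) z) sums deriv (\<lambda>z. \<Sum>n. f n z) z" if "z \<in> S"
    using DERIV_imp_deriv[OF der[OF that]] g(2)[OF that] by simp
  show "summable (\<lambda>n. f n z)" if "z \<in> S"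
    using g(1)[OF that] by (simp add: sums_iff)
qed

section \<open>Midpoint rule with an off-centre node\<close>

text \<open>Taylor expansion to second order about the midpoint \<open>a\<close>, at both ends: the
  even terms \<open>F0 a\<close> and \<open>F2 a / 8\<close> cancel in the difference, and
  \<open>F1 a\<close> is left up to \<open>B3 / 8\<close>. Moving the node from \<open>a\<close> to
  \<open>p\<close> costs \<open>B2\<close> times the distance. The field is generic because
  \<open>F0\<close> is a complex power in one use and a real antiderivative in the other.\<close>

lemma midpoint_rule_estimate:
  fixes F0 F1 F2 F3 :: "'a::{real_normed_field,banach} \<Rightarrow> 'a" and x p :: real
  assumes "\<And>t. t \<in> {x..x+1} \<Longrightarrow> (F0 has_field_derivative F1 (of_real t)) (at (of_real t))"
    and "\<And>t. t \<in> {x..x+1} \<Longrightarrow> (F1 has_field_derivative F2 (of_real t)) (at (of_real t))"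
    and "\<And>t. t \<in> {x..x+1} \<Longrightarrow> (F2 has_field_derivative F3 (of_real t)) (at (of_real t))"
    and "\<And>t. t \<in> {x..x+1} \<Longrightarrow> norm (F2 (of_real t)) \<le> B2"
    and "\<And>t. t \<in> {x..x+1} \<Longrightarrow> norm (F3 (of_real t)) \<le> B3"
    and p: "p \<in> {x..x+1}"
  shows "norm (F0 (of_real (x+1)) - F0 (of_real x) - F1 (of_real p)) \<le> B3 + B2 * \<bar>p - (x+1/2)\<bar>"
proof -
  define S :: "'a set" where "S = of_real ` {x..x+1}"
  define a :: 'a where "a = of_real (x + 1/2)"
  have S: "convex S" unfolding S_def
    by (intro convex_linear_image bounded_linear.linear[OF bounded_linear_of_real]) auto
  have a: "a \<in> S" unfolding S_def a_def by (rule image_eqI[OF refl]) simp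
  have B3: "B3 \<ge> 0" using assms(5)[of x] norm_ge_zero order_trans by (metis atLeastAtMost_iff le_add_same_cancel1 order_refl zero_le_one)
  have half: "norm (F0 (of_real t) - (F0 a + F1 a * of_real h + F2 a * of_real h ^ 2 / 2)) \<le> B3 / 16"
    if "t \<in> {x..x+1}" "h = t - (x+1/2)" "\<bar>h\<bar> = 1/2" for t h
  proof -
    define f where "f i = (if i = 0 then F0 else if i = 1 then F1 else if i = 2 then F2 else F3)" for i :: nat
    have th: "of_real t - a = of_real h" by (simp add: a_def that(2))
    have "norm (f 0 (of_real t) - (\<Sum>i\<le>2. f i a * (of_real t - a) ^ i / fact i))
            \<le> B3 * norm (of_real t - a) ^ Suc 2 / fact 2"
    proof (rule field_Taylor[OF S])
      fix i y assume "y \<in> S" "i \<le> (2::nat)"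
      then have "i = 0 \<or> i = 1 \<or> i = 2" by auto
      with \<open>y \<in> S\<close> show "(f i has_field_derivative f (Suc i) y) (at y within S)"
        using assms(1-3) by (auto simp: S_def f_def intro: has_field_derivative_at_within)
    qed (use that assms(5) a in \<open>auto simp: S_def f_def\<close>)
    also have "B3 * norm (of_real t - a) ^ Suc 2 / fact 2 = B3 / 16"
      unfolding th norm_of_real that(3) by (simp add: power_divide)
    also have "(\<Sum>i\<le>2. f i a * (of_real t - a) ^ i / fact i) = F0 a + F1 a * of_real h + F2 a * of_real h ^ 2 / 2"
      unfolding th by (simp add: f_def numeral_2_eq_2)
    finally show ?thesis by (simp add: f_def)
  qed
  have 1: "norm (F0 (of_real (x+1)) - (F0 a + F1 a / 2 + F2 a / 8)) \<le> B3 / 16"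
    using half[of "x+1" "1/2"] by (simp add: power2_eq_square)
  have 2: "norm (F0 (of_real x) - (F0 a - F1 a / 2 + F2 a / 8)) \<le> B3 / 16"
    using half[of x "-1/2"] by (simp add: power2_eq_square)
  have 3: "norm (F1 (of_real p) - F1 a) \<le> B2 * \<bar>p - (x+1/2)\<bar>"
  proof -
    define f where "f i = (if i = 0 then F1 else F2)" for i :: nat
    have "norm (f 0 (of_real p) - (\<Sum>i\<le>0. f i a * (of_real p - a) ^ i / fact i))
            \<le> B2 * norm (of_real p - a) ^ Suc 0 / fact 0"
      by (rule field_Taylor[OF S])
         (use a p assms in \<open>auto simp: S_def f_def intro: has_field_derivative_at_within\<close>)
    moreover have "norm (of_real p - a) = \<bar>p - (x+1/2)\<bar>"
      unfolding a_def by (metis norm_of_real of_real_diff)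
    ultimately show ?thesis by (simp add: f_def)
  qed
  have "F0 (of_real (x+1)) - F0 (of_real x) - F1 (of_real p) =
     (F0 (of_real (x+1)) - (F0 a + F1 a / 2 + F2 a / 8)) - (F0 (of_real x) - (F0 a - F1 a / 2 + F2 a / 8))
     - (F1 (of_real p) - F1 a)"
    by (simp add: field_simps)
  also have "norm \<dots> \<le> B3/16 + B3/16 + B2 * \<bar>p - (x+1/2)\<bar>"
    by (intro norm_triangle_le_diff add_mono 1 2 3)
  also have "\<dots> \<le> B3 + B2 * \<bar>p - (x+1/2)\<bar>" using B3 by simp
  finally show ?thesis .
qed

lemma powr_le_on_unit_interval:
  fixes x t e :: real
  assumes "1 \<le> x" "x \<le> t" "t \<le> x + 1"
  shows "t powr e \<le> 2 powr \<bar>e\<bar> * x powr e"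
proof (cases "e \<ge> 0")
  case True
  have "t powr e \<le> (2*x) powr e" using assms True by (intro powr_mono2) auto
  also have "\<dots> = 2 powr e * x powr e" using assms by (simp add: powr_mult)
  finally show ?thesis using True by simp
next
  case False
  have "t powr e \<le> x powr e" using assms False by (intro powr_mono2') auto
  also have "\<dots> \<le> 2 powr \<bar>e\<bar> * x powr e" using ge_one_powr_ge_zero[of 2 "\<bar>e\<bar>"]
    by (simp add: mult_le_cancel_right1)
  finally show ?thesis .
qed

lemma has_field_derivative_of_real_powr:
  assumes "a > 0" "(f has_field_derivative f') (at s)"
  shows "((\<lambda>s. complex_of_real a powr f s) has_field_derivative of_real a powr f s * of_real (ln a) * f') (at s)"
  using assms unfolding powr_def
  by (auto intro!: derivative_eq_intros simp: Ln_of_real)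

lemma norm_of_real_powr: "t > 0 \<Longrightarrow> norm (of_real t powr (z::complex)) = t powr Re z"
  by (simp add: norm_powr_real_powr)

section \<open>Sequences k + \<beta> + O(1/k) and the continuation of their zeta functions\<close>

locale shifted_naturals =
  fixes l :: "nat \<Rightarrow> real" and \<beta> C :: real
  assumes pos: "\<And>k. l k > 0"
    and approx: "\<And>k. \<bar>l k - (real k + \<beta>)\<bar> \<le> C / (real k + 1)"
begin

lemma C_nonneg: "C \<ge> 0" using approx[of 0] by simp

text \<open>The first \<open>K\<close> terms are split off, so that all cells \<open>{x j..x j + 1}\<close> lie to the right of \<open>1\<close>
  and the remaining terms \<open>p j\<close> lie in their cells, close to the midpoints.\<close>

definition K :: nat where "K = nat \<lceil>2 * C + \<bar>\<beta>\<bar> + 2\<rceil>"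
definition x :: "nat \<Rightarrow> real" where "x j = real j + real K + \<beta> - 1/2"
definition p :: "nat \<Rightarrow> real" where "p j = l (j + K)"

lemma K_ge: "real K \<ge> 2 * C + \<bar>\<beta>\<bar> + 2" unfolding K_def by linarith

lemma x_ge: "x j \<ge> real j + 1" using K_ge C_nonneg unfolding x_def by linarith

lemma x_Suc: "x (Suc j) = x j + 1" by (simp add: x_def)

lemma p_near: "\<bar>p j - (x j + 1/2)\<bar> \<le> 2 * C / x j"
proof -
  have "\<bar>p j - (x j + 1/2)\<bar> \<le> C / (real (j + K) + 1)"
    using approx[of "j + K"] by (simp add: p_def x_def)
  also have "\<dots> = 2 * C / (2 * (real (j + K) + 1))" by (rule mult_divide_mult_cancel_left[symmetric]) simp
  also have "\<dots> \<le> 2 * C / x j"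
  proof (rule divide_left_mono)
    show "x j \<le> 2 * (real (j + K) + 1)" using K_ge C_nonneg unfolding x_def by simp
  qed (use x_ge[of j] C_nonneg in auto)
  finally show ?thesis .
qed

lemma p_mem: "p j \<in> {x j..x j + 1}"
proof -
  have "\<bar>p j - (x j + 1/2)\<bar> \<le> C / (real (j + K) + 1)"
    using approx[of "j + K"] by (simp add: p_def x_def)
  also have "\<dots> \<le> 1/2"
    using K_ge C_nonneg by (simp add: field_simps)
  finally have "\<bar>p j - (x j + 1/2)\<bar> \<le> 1/2" .
  then show ?thesis unfolding atLeastAtMost_iff abs_le_iff by linarith
qed

lemma p_pos: "p j > 0" by (simp add: p_def pos)

text \<open>This is \<open>s - 1\<close> times the difference between \<open>p j\<close> to the
  power \<open>- s\<close> and the integral of \<open>t\<close> to the power \<open>- s\<close> over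
  the cell. The factor clears the denominator of the integral and makes \<open>cell j\<close>
  entire.\<close>

definition cell :: "nat \<Rightarrow> complex \<Rightarrow> complex" where
  "cell j s = (s - 1) * of_real (p j) powr (-s) + of_real (x j + 1) powr (1 - s) - of_real (x j) powr (1 - s)"

text \<open>The midpoint rule is applied to \<open>z powr (1 - s)\<close>. The third derivative is
  of order x^(- Re s - 2), and the second, of order x^(- Re s - 1), is multiplied by the offset
  O(1/x) of \<open>p j\<close> from the midpoint; both errors are summable for Re s > -1. The factor
  \<open>2 powr (R+2)\<close> pays for the variation of the powers within a cell,
  \<open>(1+R)^3\<close> for the factors brought down by differentiation.\<close>

lemma cell_bound:
  assumes "norm s \<le> R" "Re s \<ge> \<sigma>" "\<sigma> > -1"
  shows "norm (cell j s) \<le> (1+R)^3 * 2 powr (R+2) * (1+2*C) * (real j + 1) powr (-\<sigma>-2)"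
proof -
  have R: "R \<ge> 0" using assms(1) norm_ge_zero order_trans by blast
  have xj: "x j \<ge> 1" using x_ge[of j] by linarith
  have Re: "\<bar>Re s\<bar> \<le> R" using assms(1) abs_Re_le_cmod order_trans by blast
  have n1: "norm (1 - s) \<le> 1 + R" "norm s \<le> 1 + R" "norm (s+1) \<le> 1 + R"
    using assms(1) R norm_triangle_ineq4[of 1 s] norm_triangle_ineq[of s 1] by auto
  have n2: "norm (-s) \<le> 1 + R" "norm (-s-1) \<le> 1 + R"
    using n1 norm_minus_cancel[of "s+1"] by auto
  define D where "D = (1+R)^3 * 2 powr (R+2)"
  have D: "D \<ge> 0" using R by (simp add: D_def)
  define F0 where "F0 = (\<lambda>z::complex. z powr (1-s))"
  define F1 where "F1 = (\<lambda>z::complex. (1-s) * z powr (-s))"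
  define F2 where "F2 = (\<lambda>z::complex. (1-s) * (-s) * z powr (-s-1))"
  define F3 where "F3 = (\<lambda>z::complex. (1-s) * (-s) * (-s-1) * z powr (-s-2))"
  have slit: "complex_of_real t \<notin> \<real>\<^sub>\<le>\<^sub>0" if "t \<in> {x j..x j+1}" for t
    using that xj by (auto simp: complex_nonpos_Reals_iff)
  have pw: "norm (complex_of_real t powr e) \<le> 2 powr (R+2) * x j powr (Re e)"
    if "t \<in> {x j..x j+1}" "\<bar>Re e\<bar> \<le> R + 2" for t and e :: complex
  proof -
    have "norm (complex_of_real t powr e) = t powr Re e"
      using that xj by (intro norm_of_real_powr) auto
    also have "\<dots> \<le> 2 powr \<bar>Re e\<bar> * x j powr (Re e)"
      using that xj by (intro powr_le_on_unit_interval) auto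
    also have "\<dots> \<le> 2 powr (R+2) * x j powr (Re e)"
      using that by (intro mult_right_mono powr_mono) auto
    finally show ?thesis .
  qed
  have "norm (F0 (of_real (x j+1)) - F0 (of_real (x j)) - F1 (of_real (p j)))
      \<le> D * x j powr (- Re s - 2) + D * x j powr (- Re s - 1) * \<bar>p j - (x j+1/2)\<bar>"
  proof (rule midpoint_rule_estimate[where ?F2.0 = F2 and ?F3.0 = F3])
    fix t assume t: "t \<in> {x j..x j+1}"
    show "(F0 has_field_derivative F1 (of_real t)) (at (of_real t))"
      unfolding F0_def F1_def using slit[OF t] by (auto intro!: derivative_eq_intros)
    show "(F1 has_field_derivative F2 (of_real t)) (at (of_real t))"
      unfolding F1_def F2_def using slit[OF t] by (auto intro!: derivative_eq_intros)
    show "(F2 has_field_derivative F3 (of_real t)) (at (of_real t))"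
      unfolding F3_def F2_def using slit[OF t]
      by (auto intro!: derivative_eq_intros simp: diff_diff_eq add.commute)
    have "norm (F2 (of_real t)) \<le> ((1+R) * (1+R)) * (2 powr (R+2) * x j powr (Re (-s-1)))"
      unfolding F2_def norm_mult using n1 Re t
      by (intro mult_mono pw) auto
    also have "\<dots> \<le> ((1+R) * (1+R) * (1+R)) * (2 powr (R+2) * x j powr (Re (-s-1)))"
      using R by (intro mult_right_mono) (auto simp: mult_le_cancel_left1)
    finally show "norm (F2 (of_real t)) \<le> D * x j powr (- Re s - 1)"
      by (simp add: D_def power3_eq_cube mult_ac)
    have "norm (F3 (of_real t)) \<le> ((1+R) * (1+R) * (1+R)) * (2 powr (R+2) * x j powr (Re (-s-2)))"
      unfolding F3_def norm_mult using n1 n2 Re t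
      by (intro mult_mono pw) auto
    then show "norm (F3 (of_real t)) \<le> D * x j powr (- Re s - 2)"
      by (simp add: D_def power3_eq_cube mult_ac)
  qed (rule p_mem)
  also have "\<dots> \<le> D * x j powr (- Re s - 2) + D * x j powr (- Re s - 1) * (2 * C / x j)"
    using D by (intro add_left_mono mult_left_mono p_near) auto
  also have "\<dots> = D * (1 + 2 * C) * x j powr (- Re s - 2)"
  proof -
    have "x j powr (- Re s - 1) / x j = x j powr (- Re s - 2)"
      using xj powr_diff[of "x j" "- Re s - 1" 1] by (simp add: diff_diff_eq)
    then show ?thesis by (simp add: distrib_left distrib_right flip: times_divide_eq_left)
  qed
  also have "\<dots> \<le> D * (1 + 2 * C) * x j powr (- \<sigma> - 2)"
    using D C_nonneg xj assms by (intro mult_left_mono powr_mono) auto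
  also have "\<dots> \<le> D * (1 + 2 * C) * (real j + 1) powr (- \<sigma> - 2)"
    using D C_nonneg xj assms x_ge[of j] by (intro mult_left_mono powr_mono2') auto
  finally show ?thesis
    unfolding F0_def F1_def cell_def D_def by (simp add: algebra_simps)
qed

lemma summable_shifted_powr: "e < -1 \<Longrightarrow> summable (\<lambda>j. (real j + 1) powr e)"
  using summable_Suc_iff[of "\<lambda>j. real j powr e"] by (simp add: summable_real_powr_iff add.commute)

text \<open>\<open>Z s = (s - 1) \<zeta>(s)\<close>, which unlike \<open>\<zeta>\<close> is holomorphic at \<open>1\<close>. The integral of
  \<open>t\<^sup>-\<^sup>s\<close> over the union of all cells is \<open>(x 0)\<^sup>1\<^sup>-\<^sup>s / (s - 1)\<close>.\<close>

definition Z :: "complex \<Rightarrow> complex" where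
  "Z s = (\<Sum>k<K. (s - 1) * of_real (l k) powr (-s)) + of_real (x 0) powr (1 - s) + (\<Sum>j. cell j s)"

abbreviation half_plane :: "complex set" where "half_plane \<equiv> {s. Re s > -1}"

lemma open_half_plane: "open half_plane" by (rule open_halfspace_Re_gt)

lemma cell_holomorphic: "cell j holomorphic_on S"
  unfolding cell_def by (intro holomorphic_intros) (use p_pos[of j] x_ge[of j] in auto)

lemma cell_locally_bounded:
  assumes "z \<in> half_plane"
  shows "\<exists>d M. 0 < d \<and> summable M \<and>
           (\<forall>\<^sub>F n in sequentially. \<forall>w\<in>ball z d \<inter> half_plane. norm (cell n w) \<le> M n)"
proof (intro exI conjI always_eventually allI ballI)
  define \<sigma> where "\<sigma> = (Re z - 1) / 2"
  define R where "R = norm z + (Re z + 1) / 2"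
  show "(Re z + 1) / 2 > 0" using assms by simp
  have \<sigma>: "\<sigma> > -1" using assms by (simp add: \<sigma>_def)
  then show "summable (\<lambda>j. (1+R)^3 * 2 powr (R+2) * (1+2*C) * (real j + 1) powr (-\<sigma>-2))"
    by (intro summable_mult summable_shifted_powr) auto
  fix n w assume w: "w \<in> ball z ((Re z + 1) / 2) \<inter> half_plane"
  then have d: "norm (z - w) < (Re z + 1)/2" by (simp add: dist_norm)
  have "norm w \<le> norm z + norm (z - w)" using norm_triangle_ineq4[of z "z - w"] by simp
  then have "norm w \<le> R" using d unfolding R_def by linarith
  moreover have "Re w \<ge> \<sigma>" using d abs_Re_le_cmod[of "z - w"] by (simp add: \<sigma>_def field_simps)
  ultimately show "norm (cell n w) \<le> (1+R)^3 * 2 powr (R+2) * (1+2*C) * (real n + 1) powr (-\<sigma>-2)"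
    using \<sigma> by (rule cell_bound)
qed

lemmas cell_sum = holomorphic_on_suminf[OF open_half_plane cell_holomorphic cell_locally_bounded]
lemmas cell_deriv_sums = deriv_sums_suminf[OF open_half_plane cell_holomorphic cell_locally_bounded]
lemmas cell_summable = summable_of_locally_bounded[OF open_half_plane cell_holomorphic cell_locally_bounded]

lemma Z_holomorphic: "Z holomorphic_on half_plane"
  unfolding Z_def using pos x_ge[of 0]
  by (intro holomorphic_intros cell_sum) (auto simp: less_imp_neq[symmetric])

text \<open>All cells vanish at 1, and only a zeroth power of \<open>x 0\<close> is left. The value
  is the residue of the zeta function.\<close>

lemma Z_1: "Z 1 = 1"
proof -
  have [simp]: "cell j 1 = 0" for j
  proof -
    have "complex_of_real (x j + 1) \<noteq> 0" "x j \<noteq> 0"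
      using x_ge[of j] by (auto simp only: of_real_eq_0_iff)
    then show ?thesis by (simp add: cell_def del: of_real_add)
  qed
  show ?thesis using x_ge[of 0] by (auto simp: Z_def)
qed

lemma cell_at_0: "cell j 0 = 0"
  using x_ge[of j] p_pos[of j] by (simp add: cell_def)

text \<open>As \<open>Z\<close> is \<open>s - 1\<close> times the zeta function, this says that the
  latter is 1/2 - \<beta> at 0, as for the Hurwitz zeta function: at 0 the deviations of the
  \<open>l k\<close> from k + \<beta> are invisible.\<close>

lemma Z_0: "Z 0 = of_real (\<beta> - 1/2)"
proof -
  have "Z 0 = of_real (- real K + x 0)"
    using pos x_ge[of 0] by (simp add: Z_def cell_at_0 less_imp_neq[symmetric])
  then show ?thesis by (simp add: x_def)
qed

text \<open>The derivative of \<open>cell j\<close> at 0: \<open>ln (p j)\<close> minus the integral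
  of \<open>ln\<close> over the cell.\<close>

definition cell_slope :: "nat \<Rightarrow> real" where
  "cell_slope j = 1 + ln (p j) - (x j + 1) * ln (x j + 1) + x j * ln (x j)"

lemma deriv_cell_0: "(cell j has_field_derivative of_real (cell_slope j)) (at 0)"
proof -
  have "((\<lambda>s::complex. (s - 1) * of_real (p j) powr (-s) + of_real (x j + 1) powr (1 - s) - of_real (x j) powr (1 - s))
      has_field_derivative of_real (cell_slope j)) (at 0)"
  proof -
    have x0: "x j > 0" "x j + 1 > 0" using x_ge[of j] by auto
    have d: "((\<lambda>s. - s) has_field_derivative - 1) (at (0::complex))"
      "((\<lambda>s. 1 - s) has_field_derivative - 1) (at (0::complex))"
      by (auto intro!: derivative_eq_intros)
    have 1: "((\<lambda>s. complex_of_real (p j) powr (-s)) has_field_derivative - of_real (ln (p j))) (at 0)"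
      using has_field_derivative_of_real_powr[OF p_pos[of j] d(1)] p_pos[of j] by simp
    have 2: "((\<lambda>s. complex_of_real c powr (1-s)) has_field_derivative - of_real (c * ln c)) (at 0)" if "c > 0" for c
      using has_field_derivative_of_real_powr[OF that d(2)] that by simp
    show ?thesis
      by (rule derivative_eq_intros refl 1 2 x0)+ (use p_pos[of j] in \<open>simp add: cell_slope_def\<close>)
  qed
  then show ?thesis by (simp add: cell_def[abs_def])
qed

lemma cell_slope_sums: "cell_slope sums (\<Sum>j. cell_slope j)" and cell_slope_deriv: "deriv (\<lambda>s. \<Sum>j. cell j s) 0 = of_real (\<Sum>j. cell_slope j)"
proof -
  have *: "(\<lambda>j. complex_of_real (cell_slope j)) sums deriv (\<lambda>s. \<Sum>j. cell j s) 0"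
    using cell_deriv_sums[of 0] DERIV_imp_deriv[OF deriv_cell_0] by simp
  have "summable cell_slope" using summable_Re[OF sums_summable[OF *]] by simp
  then show "cell_slope sums (\<Sum>j. cell_slope j)" by (rule summable_sums)
  then show "deriv (\<lambda>s. \<Sum>j. cell j s) 0 = of_real (\<Sum>j. cell_slope j)"
    using * sums_of_real sums_unique2 by blast
qed

text \<open>This is the derivative of the zeta function at 0, formally minus the sum of all
  \<open>ln (l k)\<close>. Beyond the first \<open>K\<close> terms each logarithm is its cell
  integral plus \<open>cell_slope\<close>, and the integral of \<open>ln\<close> from
  \<open>x 0\<close> to infinity receives the finite value
  \<open>x 0 - x 0 * ln (x 0)\<close>.\<close>

definition zeta_deriv_0 :: real where
  "zeta_deriv_0 = - (\<Sum>k<K. ln (l k)) + x 0 * ln (x 0) - x 0 - (\<Sum>j. cell_slope j)"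

text \<open>Differentiating \<open>Z s = (s - 1) \<zeta>(s)\<close> at 0 gives
  \<open>\<zeta>(0) - \<zeta>'(0)\<close>, with \<open>\<zeta>(0) = 1/2 - \<beta>\<close>.\<close>

lemma deriv_Z_0: "(Z has_field_derivative of_real (- zeta_deriv_0 - (\<beta> - 1/2))) (at 0)"
proof -
  have "((\<lambda>s. \<Sum>j. cell j s) has_field_derivative of_real (\<Sum>j. cell_slope j)) (at 0)"
    using holomorphic_derivI[OF cell_sum open_half_plane, of 0] cell_slope_deriv by simp
  then have "(Z has_field_derivative (\<Sum>k<K. 1 + of_real (ln (l k))) - of_real (x 0 * ln (x 0)) + of_real (\<Sum>j. cell_slope j)) (at 0)"
    unfolding Z_def using x_ge[of 0] pos
    by (auto intro!: derivative_eq_intros has_field_derivative_of_real_powr sum.cong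
             simp: less_imp_neq[symmetric])
  moreover have "(\<Sum>k<K. 1 + of_real (ln (l k))) - of_real (x 0 * ln (x 0)) + of_real (\<Sum>j. cell_slope j) = complex_of_real (- zeta_deriv_0 - (\<beta> - 1/2))"
    by (simp add: zeta_deriv_0_def sum.distrib x_def)
  ultimately show ?thesis by simp
qed

lemma l_powr_summable: "e < -1 \<Longrightarrow> summable (\<lambda>k. l k powr e)"
proof -
  assume e: "e < -1"
  have "summable (\<lambda>j. p j powr e)"
  proof (rule summable_comparison_test_ev[OF always_eventually summable_shifted_powr[OF e]], intro allI)
    fix j
    have "p j powr e \<le> (real j + 1) powr e"
      using p_mem[of j] x_ge[of j] e by (intro powr_mono2') auto
    then show "norm (p j powr e) \<le> (real j + 1) powr e" by simp
  qed
  then show "summable (\<lambda>k. l k powr e)"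
    unfolding p_def by (subst (asm) summable_iff_shift)
qed

text \<open>After multiplication by \<open>s - 1\<close>, the terms from index \<open>K\<close> on
  are the cells minus the increments of \<open>g\<close>. Since \<open>g\<close> tends to 0 for Re s
  > 1, the increments sum to \<open>- g 0\<close>.\<close>

lemma zeta_sums:
  assumes "Re s > 1"
  shows "(\<lambda>k. of_real (l k) powr (-s)) sums (Z s / (s - 1))"
proof -
  define g where "g j = complex_of_real (x j) powr (1 - s)" for j
  have g0: "g \<longlonglongrightarrow> 0"
  proof (rule tendsto_norm_zero_cancel)
    have "filterlim x at_top sequentially"
      by (rule filterlim_at_top_mono[OF filterlim_real_sequentially])
         (use x_ge in \<open>auto intro!: always_eventually order.trans[OF _ x_ge]\<close>)
    then have "(\<lambda>j. x j powr Re (1 - s)) \<longlonglongrightarrow> 0"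
      using assms by (intro tendsto_neg_powr) auto
    moreover have "norm (g j) = x j powr Re (1 - s)" for j
      unfolding g_def using x_ge[of j] by (intro norm_of_real_powr) auto
    ultimately show "(\<lambda>j. norm (g j)) \<longlonglongrightarrow> 0" by simp
  qed
  have "(\<lambda>j. cell j s - (g (Suc j) - g j)) sums ((\<Sum>j. cell j s) - (0 - g 0))"
    using assms by (intro sums_diff summable_sums cell_summable telescope_sums g0) auto
  moreover have "cell j s - (g (Suc j) - g j) = (s - 1) * of_real (p j) powr (-s)" for j
    by (simp add: g_def cell_def x_Suc)
  ultimately have "(\<lambda>j. (s - 1) * of_real (l (j + K)) powr (-s)) sums ((\<Sum>j. cell j s) + g 0)"
    by (simp add: p_def)
  then have "(\<lambda>k. (s - 1) * of_real (l k) powr (-s)) sums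
      ((\<Sum>j. cell j s) + g 0 + (\<Sum>k<K. (s - 1) * of_real (l k) powr (-s)))"
    by (rule iffD1[OF sums_iff_shift])
  also have "(\<Sum>j. cell j s) + g 0 + (\<Sum>k<K. (s - 1) * of_real (l k) powr (-s)) = Z s"
    by (simp add: Z_def g_def)
  finally have "(\<lambda>k. (s - 1) * of_real (l k) powr (-s) / (s - 1)) sums (Z s / (s - 1))"
    by (rule sums_divide)
  moreover have "s \<noteq> 1" using assms by auto
  ultimately show ?thesis by simp
qed

text \<open>An antiderivative of \<open>ln (t\<^sup>2 + y\<^sup>2)\<close> with respect to \<open>t\<close>.\<close>

definition A :: "real \<Rightarrow> real \<Rightarrow> real" where
  "A y t = t * ln (t\<^sup>2 + y\<^sup>2) - 2 * t + 2 * y * arctan (t / y)"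

section \<open>The sum of ln (1 + y^2 / l_k^2) for large y\<close>

definition logcell :: "nat \<Rightarrow> real \<Rightarrow> real" where
  "logcell j y = ln ((p j)\<^sup>2 + y\<^sup>2) - (A y (x j + 1) - A y (x j))"

text \<open>With \<open>N\<close> the least value of \<open>t\<^sup>2 + y\<^sup>2\<close> on the
  cell, the second derivative of \<open>A y\<close> is of order \<open>x j / N\<close> and the third
  of order \<open>1 / N\<close>; the offset \<open>2 * C / x j\<close> of \<open>p j\<close> removes
  the factor \<open>x j\<close>. The bound decays in both variables, so the cells are summable over
  \<open>j\<close> and their sum vanishes as \<open>y\<close> grows.\<close>

lemma logcell_bound:
  assumes "y > 0"
  shows "\<bar>logcell j y\<bar> \<le> (2 + 8 * C) / ((x j)\<^sup>2 + y\<^sup>2)"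
proof -
  have xj: "x j \<ge> 1" using x_ge[of j] by linarith
  have q: "t\<^sup>2 + y\<^sup>2 > 0" for t using assms by (simp add: add_nonneg_pos)
  define N where "N = (x j)\<^sup>2 + y\<^sup>2"
  have N: "N > 0" "N \<le> t\<^sup>2 + y\<^sup>2" if "t \<ge> x j" for t
    using q that xj by (auto simp: N_def intro: power_mono)
  have "norm (A y (of_real (x j + 1)) - A y (of_real (x j)) - ln ((of_real (p j))\<^sup>2 + y\<^sup>2))
     \<le> 2 / N + 4 * x j / N * \<bar>p j - (x j + 1/2)\<bar>"
  proof (rule midpoint_rule_estimate[where ?F2.0 = "\<lambda>t. 2 * t / (t\<^sup>2 + y\<^sup>2)"
        and ?F3.0 = "\<lambda>t. 2 * (y\<^sup>2 - t\<^sup>2) / (t\<^sup>2 + y\<^sup>2)\<^sup>2" and ?F1.0 = "\<lambda>t. ln (t\<^sup>2 + y\<^sup>2)"])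
    fix t assume t: "t \<in> {x j..x j+1}"
    have e: "1 + (t / y)\<^sup>2 = (t\<^sup>2 + y\<^sup>2) / y\<^sup>2" using assms by (simp add: field_simps)
    have "(A y has_field_derivative (ln (t\<^sup>2 + y\<^sup>2) + t * (2 * t / (t\<^sup>2 + y\<^sup>2)) - 2 + 2 * y * ((1 / y) / (1 + (t / y)\<^sup>2)))) (at t)"
      unfolding A_def[abs_def] using q[of t] assms
      by (auto intro!: derivative_eq_intros simp: divide_simps)
    also have "ln (t\<^sup>2 + y\<^sup>2) + t * (2 * t / (t\<^sup>2 + y\<^sup>2)) - 2 + 2 * y * ((1 / y) / (1 + (t / y)\<^sup>2)) = ln (t\<^sup>2 + y\<^sup>2)"
      unfolding e using q[of t] assms by (simp add: divide_simps) (simp add: algebra_simps power2_eq_square)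
    finally show "(A y has_field_derivative ln ((of_real t)\<^sup>2 + y\<^sup>2)) (at (of_real t))" by simp
    show "((\<lambda>t. ln (t\<^sup>2 + y\<^sup>2)) has_field_derivative 2 * of_real t / ((of_real t)\<^sup>2 + y\<^sup>2)) (at (of_real t))"
      using q[of t] by (auto intro!: derivative_eq_intros)
    show "((\<lambda>t. 2 * t / (t\<^sup>2 + y\<^sup>2)) has_field_derivative
           2 * (y\<^sup>2 - (of_real t)\<^sup>2) / ((of_real t)\<^sup>2 + y\<^sup>2)\<^sup>2) (at (of_real t))"
    proof -
      have "((\<lambda>t. 2 * t / (t\<^sup>2 + y\<^sup>2)) has_field_derivative
           (2 * (t\<^sup>2 + y\<^sup>2) - 2 * t * (2 * t)) / ((t\<^sup>2 + y\<^sup>2) * (t\<^sup>2 + y\<^sup>2))) (at t)"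
        using q[of t] by (auto intro!: derivative_eq_intros)
      moreover have "2 * (t\<^sup>2 + y\<^sup>2) - 2 * t * (2 * t) = 2 * (y\<^sup>2 - t\<^sup>2)" by (simp add: power2_eq_square)
      ultimately show ?thesis by (simp add: power2_eq_square)
    qed
    have "norm (2 * t / (t\<^sup>2 + y\<^sup>2)) = 2 * t / (t\<^sup>2 + y\<^sup>2)" using t xj q[of t] by simp
    also have "\<dots> \<le> 4 * x j / N"
      using t xj N[of t] by (intro frac_le) auto
    finally show "norm (2 * of_real t / ((of_real t)\<^sup>2 + y\<^sup>2)) \<le> 4 * x j / N" by simp
    have "norm (2 * (y\<^sup>2 - t\<^sup>2) / (t\<^sup>2 + y\<^sup>2)\<^sup>2) = 2 * \<bar>y\<^sup>2 - t\<^sup>2\<bar> / (t\<^sup>2 + y\<^sup>2)\<^sup>2"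
      by (simp add: abs_mult del: right_diff_distrib_numeral)
    also have "\<dots> \<le> 2 * (t\<^sup>2 + y\<^sup>2) / (t\<^sup>2 + y\<^sup>2)\<^sup>2"
      by (intro divide_right_mono mult_left_mono) (auto simp: abs_le_iff)
    also have "\<dots> = 2 / (t\<^sup>2 + y\<^sup>2)"
    proof -
      have "2 * q / q\<^sup>2 = 2 / q" for q :: real by (simp add: power2_eq_square)
      then show ?thesis .
    qed
    also have "\<dots> \<le> 2 / N" using N[of t] t by (intro divide_left_mono mult_pos_pos q) auto
    finally show "norm (2 * (y\<^sup>2 - (of_real t)\<^sup>2) / ((of_real t)\<^sup>2 + y\<^sup>2)\<^sup>2) \<le> 2 / N" by simp
  qed (rule p_mem)
  also have "\<dots> \<le> 2 / N + 4 * x j / N * (2 * C / x j)"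
    using xj N[of "x j"] by (intro add_left_mono mult_left_mono p_near) auto
  also have "\<dots> = (2 + 8 * C) / N" using xj by (simp add: field_simps add_divide_distrib)
  finally show ?thesis
    by (simp add: logcell_def N_def abs_minus_commute)
qed

lemma logcell_suminf:
  shows logcell_suminf_tendsto: "((\<lambda>y. \<Sum>j. logcell j y) \<longlongrightarrow> 0) at_top"
    and logcell_summable: "y > 0 \<Longrightarrow> summable (\<lambda>j. logcell j y)"
proof -
  have M: "summable (\<lambda>j. (2 + 8 * C) * (real j + 1) powr (-2))"
    by (intro summable_mult summable_shifted_powr) auto
  have b: "norm (logcell j y) \<le> (2 + 8 * C) * (real j + 1) powr (-2)" if "y > 0" for j y
  proof -
    have "norm (logcell j y) \<le> (2 + 8 * C) / ((x j)\<^sup>2 + y\<^sup>2)" using logcell_bound[OF that] by simp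
    also have "\<dots> \<le> (2 + 8 * C) / (real j + 1)\<^sup>2"
      using x_ge[of j] C_nonneg power_mono[OF x_ge[of j], of 2] that
      by (intro divide_left_mono mult_pos_pos add_nonneg_pos) (auto simp: add_increasing2)
    also have "\<dots> = (2 + 8 * C) * (real j + 1) powr (-2)"
      by (simp add: powr_minus powr_numeral divide_inverse)
    finally show ?thesis .
  qed
  show "summable (\<lambda>j. logcell j y)" if "y > 0"
    by (rule summable_comparison_test_ev[OF always_eventually M]) (use b[OF that] in auto)
  have "((\<lambda>y. \<Sum>j. logcell j y) \<longlongrightarrow> (\<Sum>j. 0)) at_top"
  proof (intro conjunct2[OF conjunct2[OF tannerys_theorem[OF _ _ M]]])
    show "(logcell j \<longlongrightarrow> 0) at_top" for j
    proof (rule Lim_null_comparison)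
      show "\<forall>\<^sub>F y in at_top. norm (logcell j y) \<le> (2 + 8 * C) / ((x j)\<^sup>2 + y\<^sup>2)"
        using eventually_gt_at_top[of 0] by eventually_elim (use logcell_bound in auto)
      show "((\<lambda>y. (2 + 8 * C) / ((x j)\<^sup>2 + y\<^sup>2)) \<longlongrightarrow> 0) at_top" by real_asymp
    qed
    show "\<forall>\<^sub>F (j, y) in sequentially \<times>\<^sub>F at_top. norm (logcell j y) \<le> (2 + 8 * C) * (real j + 1) powr - 2"
      unfolding eventually_prod_filter
      by (rule exI[of _ "\<lambda>_. True"], rule exI[of _ "\<lambda>y. y > 0"]) (use b in \<open>auto simp: eventually_gt_at_top\<close>)
  qed auto
  then show "((\<lambda>y. \<Sum>j. logcell j y) \<longlongrightarrow> 0) at_top" by simp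
qed

text \<open>From index \<open>K\<close> on, a term is \<open>logcell j y - 2 * cell_slope j\<close>
  plus an increment of the antiderivative \<open>D\<close> of
  \<open>ln (1 + y\<^sup>2 / t\<^sup>2)\<close>. The increments telescope, and the limit
  \<open>pi * y\<close> of \<open>D\<close> at infinity is the leading growth of the whole
  sum.\<close>

lemma log_sums:
  assumes "y > 0"
  shows "(\<lambda>k. ln (1 + y\<^sup>2 / (l k)\<^sup>2)) sums
     ((\<Sum>k<K. ln (1 + y\<^sup>2 / (l k)\<^sup>2)) + (\<Sum>j. logcell j y) - 2 * (\<Sum>j. cell_slope j)
       + (pi * y - (A y (x 0) - (2 * x 0 * ln (x 0) - 2 * x 0))))"
proof -
  define D where "D t = A y t - (2 * t * ln t - 2 * t)" for t
  have "((\<lambda>t. t * ln (1 + y\<^sup>2 / t\<^sup>2) + 2 * y * arctan (t / y)) \<longlongrightarrow> pi * y) at_top"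
    using assms by real_asymp
  moreover have "\<forall>\<^sub>F t in at_top. t * ln (1 + y\<^sup>2 / t\<^sup>2) + 2 * y * arctan (t / y) = D t"
    using eventually_gt_at_top[of 0]
  proof eventually_elim
    case (elim t)
    have "1 + y\<^sup>2 / t\<^sup>2 = (t\<^sup>2 + y\<^sup>2) / t\<^sup>2" using elim by (simp add: field_simps)
    then have "ln (1 + y\<^sup>2 / t\<^sup>2) = ln (t\<^sup>2 + y\<^sup>2) - 2 * ln t"
      using elim assms by (simp add: ln_div ln_realpow add_pos_pos)
    show ?case unfolding D_def A_def \<open>ln (1 + y\<^sup>2 / t\<^sup>2) = _\<close> by (simp add: algebra_simps)
  qed
  ultimately have "(D \<longlongrightarrow> pi * y) at_top" using tendsto_cong by force
  moreover have "filterlim x at_top sequentially"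
    by (rule filterlim_at_top_mono[OF filterlim_real_sequentially])
       (use x_ge in \<open>auto intro!: always_eventually order.trans[OF _ x_ge]\<close>)
  ultimately have "(\<lambda>j. D (x j)) \<longlonglongrightarrow> pi * y" by (rule filterlim_compose)
  then have "(\<lambda>j. logcell j y - 2 * cell_slope j + (D (x (Suc j)) - D (x j))) sums
      ((\<Sum>j. logcell j y) - 2 * (\<Sum>j. cell_slope j) + (pi * y - D (x 0)))"
    by (intro sums_add sums_diff sums_mult telescope_sums summable_sums logcell_summable assms cell_slope_sums)
  moreover have "logcell j y - 2 * cell_slope j + (D (x (Suc j)) - D (x j)) = ln (1 + y\<^sup>2 / (l (j + K))\<^sup>2)" for j
  proof -
    have "1 + y\<^sup>2 / (p j)\<^sup>2 = ((p j)\<^sup>2 + y\<^sup>2) / (p j)\<^sup>2" using p_pos[of j] by (simp add: field_simps)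
    then have "ln (1 + y\<^sup>2 / (p j)\<^sup>2) = ln ((p j)\<^sup>2 + y\<^sup>2) - 2 * ln (p j)"
      using p_pos[of j] assms by (simp add: ln_div ln_realpow add_pos_pos)
    then show ?thesis
      by (simp add: x_Suc logcell_def cell_slope_def D_def p_def algebra_simps)
  qed
  ultimately have "(\<lambda>j. ln (1 + y\<^sup>2 / (l (j + K))\<^sup>2)) sums
      ((\<Sum>j. logcell j y) - 2 * (\<Sum>j. cell_slope j) + (pi * y - D (x 0)))" by simp
  from iffD1[OF sums_iff_shift this] show ?thesis by (simp add: D_def algebra_simps)
qed

text \<open>Besides \<open>pi * y\<close>, growth comes from the first \<open>K\<close> terms,
  \<open>2 * ln y\<close> each, and from \<open>D (x 0)\<close>, which is subtracted and grows like
  \<open>2 * x 0 * ln y\<close>. Since \<open>2 * K - 2 * x 0 = 1 - 2 * \<beta>\<close>, the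
  coefficient of \<open>ln y\<close> is \<open>2 * \<zeta>(0)\<close>; the constant is
  \<open>2 * \<zeta>'(0)\<close>.\<close>

lemma log_sum_asymptotics:
  "((\<lambda>y. (\<Sum>k. ln (1 + y\<^sup>2 / (l k)\<^sup>2)) - pi * y - (1 - 2 * \<beta>) * ln y) \<longlongrightarrow> 2 * zeta_deriv_0) at_top"
proof -
  have x0: "x 0 > 0" using x_ge[of 0] by simp
  have 1: "((\<lambda>y. ln (1 + y\<^sup>2 / c\<^sup>2) - 2 * ln y) \<longlongrightarrow> - (2 * ln c)) at_top" if "c > 0" for c :: real
    using that by real_asymp (simp add: ln_inverse ln_realpow)
  have 2: "((\<lambda>y. (c * ln (c\<^sup>2 + y\<^sup>2) - 2 * c + 2 * y * arctan (c / y)) - (2 * c * ln c - 2 * c) - 2 * c * ln y)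
     \<longlongrightarrow> 2 * c - 2 * c * ln c) at_top" if "c > 0" for c :: real
  proof -
    have "((\<lambda>y. ln (c\<^sup>2 + y\<^sup>2) - 2 * ln y) \<longlongrightarrow> 0) at_top" by real_asymp
    moreover have "((\<lambda>y. 2 * y * arctan (c / y)) \<longlongrightarrow> 2 * c) at_top" using that by real_asymp
    ultimately have "((\<lambda>y. c * (ln (c\<^sup>2 + y\<^sup>2) - 2 * ln y) + 2 * y * arctan (c / y) - 2 * c * ln c)
        \<longlongrightarrow> c * 0 + 2 * c - 2 * c * ln c) at_top"
      by (intro tendsto_add[OF tendsto_mult_left] tendsto_diff[OF _ tendsto_const])
    then show ?thesis by (simp add: algebra_simps)
  qed
  have "((\<lambda>y. (\<Sum>k<K. ln (1 + y\<^sup>2 / (l k)\<^sup>2) - 2 * ln y) + (\<Sum>j. logcell j y) - 2 * (\<Sum>j. cell_slope j)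
       - ((A y (x 0) - (2 * x 0 * ln (x 0) - 2 * x 0)) - 2 * x 0 * ln y)) \<longlongrightarrow>
       (\<Sum>k<K. - (2 * ln (l k))) + 0 - 2 * (\<Sum>j. cell_slope j) - (2 * x 0 - 2 * x 0 * ln (x 0))) at_top"
    unfolding A_def
    by (rule tendsto_diff[OF tendsto_diff[OF tendsto_add[OF tendsto_sum[OF 1[OF pos]] logcell_suminf_tendsto]
          tendsto_const] 2[OF x0]])
  also have "(\<Sum>k<K. - (2 * ln (l k))) + 0 - 2 * (\<Sum>j. cell_slope j) - (2 * x 0 - 2 * x 0 * ln (x 0)) = 2 * zeta_deriv_0"
    by (simp add: zeta_deriv_0_def sum_negf sum_distrib_left algebra_simps)
  finally show ?thesis
  proof (rule Lim_transform_eventually)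
    show "\<forall>\<^sub>F y in at_top. (\<Sum>k<K. ln (1 + y\<^sup>2 / (l k)\<^sup>2) - 2 * ln y) + (\<Sum>j. logcell j y) - 2 * (\<Sum>j. cell_slope j)
       - ((A y (x 0) - (2 * x 0 * ln (x 0) - 2 * x 0)) - 2 * x 0 * ln y) =
       (\<Sum>k. ln (1 + y\<^sup>2 / (l k)\<^sup>2)) - pi * y - (1 - 2 * \<beta>) * ln y"
      using eventually_gt_at_top[of 0]
    proof eventually_elim
      case (elim y)
      have "1 - 2 * \<beta> = 2 * real K - 2 * x 0" by (simp add: x_def)
      then have e: "(1 - 2 * \<beta>) * ln y = 2 * real K * ln y - 2 * x 0 * ln y"
        by (simp add: left_diff_distrib)
      show ?case unfolding sums_unique[OF log_sums[OF elim], symmetric] e sum_subtractf by simp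
    qed
  qed
qed

end

section \<open>The Bessel function as an entire function of the square of its argument\<close>

text \<open>The coefficients are real but the argument lies in any suitable field: the same series
  is a real function in the Sturm comparison and a complex one in the product formula.\<close>

definition powser :: "(nat \<Rightarrow> real) \<Rightarrow> 'a::{real_normed_field,banach} \<Rightarrow> 'a" where
  "powser c z = (\<Sum>n. of_real (c n) * z ^ n)"

definition entire_coeffs :: "(nat \<Rightarrow> real) \<Rightarrow> bool" where
  "entire_coeffs c \<longleftrightarrow> (\<forall>r::real. summable (\<lambda>n. c n * r ^ n))"

lemma entire_coeffs_summable_norm:
  fixes z :: "'a::{real_normed_field,banach}"
  assumes "entire_coeffs c"
  shows "summable (\<lambda>n. norm (of_real (c n) * z ^ n))"
proof -
  have "summable (\<lambda>n. norm (c n * norm z ^ n))"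
    using assms unfolding entire_coeffs_def
    by (intro powser_insidea[where x = "norm z + 1"]) auto
  then show ?thesis by (simp add: norm_mult norm_power abs_mult)
qed

lemma powser_sums:
  fixes z :: "'a::{real_normed_field,banach}"
  assumes "entire_coeffs c"
  shows "(\<lambda>n. of_real (c n) * z ^ n) sums powser c z"
  using summable_norm_cancel[OF entire_coeffs_summable_norm[OF assms]] unfolding powser_def
  by (rule summable_sums)

lemma entire_coeffs_diffs: "entire_coeffs c \<Longrightarrow> entire_coeffs (diffs c)"
  unfolding entire_coeffs_def using termdiff_converges_all[of c] by blast

lemma powser_has_derivative:
  fixes z :: "'a::{real_normed_field,banach}"
  assumes "entire_coeffs c"
  shows "(powser c has_field_derivative powser (diffs c) z) (at z)"
proof -
  have "((\<lambda>z::'a. \<Sum>n. of_real (c n) * z ^ n) has_field_derivative (\<Sum>n. diffs (\<lambda>n. of_real (c n)) n * z ^ n)) (at z)"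
    using powser_sums[OF assms] by (intro termdiffs_strong_converges_everywhere) (auto simp: sums_iff)
  then show ?thesis by (simp add: powser_def[abs_def] diffs_of_real)
qed

lemma powser_of_real:
  assumes "entire_coeffs c"
  shows "powser c (of_real x :: 'a::{real_normed_field,banach}) = of_real (powser c x)"
  using powser_sums[OF assms, of x] powser_sums[OF assms, of "of_real x :: 'a"]
    sums_of_real[of "\<lambda>n. c n * x ^ n" "powser c x", where ?'a = 'a] sums_unique2
  by (fastforce simp: sums_iff)

lemma powser_0: "entire_coeffs c \<Longrightarrow> powser c 0 = of_real (c 0)"
  using powser_sums[of c 0] powser_sums_zero[of "\<lambda>n. of_real (c n)"] sums_unique2 by blast

section \<open>The Bessel series in the variable w^2: differential equation, sign and zeros\<close>

locale bessel =
  fixes \<nu> :: real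
  assumes nu: "\<nu> \<ge> 1/2"
begin

text \<open>The coefficients of \<open>w\<^sup>-\<^sup>\<nu> J\<^sub>\<nu>(\<pi> w)\<close> in
  powers of \<open>w\<^sup>2\<close>.\<close>

definition b :: "nat \<Rightarrow> real" where
  "b n = (-1) ^ n * (pi / 2) powr (2 * real n + \<nu>) / (fact n * Gamma (real n + \<nu> + 1))"

lemma Gamma_pos: "Gamma (real n + \<nu> + 1) > 0"
  using nu by (intro Gamma_real_pos) auto

lemma abs_b: "\<bar>b n\<bar> = (-1) ^ n * b n"
  using Gamma_pos[of n] by (simp add: b_def abs_mult flip: power_mult_distrib mult.assoc)

lemma b_0_pos: "b 0 > 0"
  using Gamma_pos[of 0] by (simp add: b_def)

lemma b_Suc: "4 * (real n + 1) * (real n + 1 + \<nu>) * b (Suc n) = - (pi\<^sup>2) * b n"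
proof -
  have "Gamma (real (Suc n) + \<nu> + 1) = (real n + \<nu> + 1) * Gamma (real n + \<nu> + 1)"
    using Gamma_plus1[of "real n + \<nu> + 1"] nu by (simp add: nonpos_Ints_def add_ac)
  moreover have "(pi / 2) powr (2 * real (Suc n) + \<nu>) = (pi/2)\<^sup>2 * (pi / 2) powr (2 * real n + \<nu>)"
    using powr_add[of "pi/2" 2 "2 * real n + \<nu>"] by (simp add: algebra_simps powr_numeral)
  ultimately show ?thesis
    using nu Gamma_pos[of n] by (simp add: b_def divide_simps power2_eq_square) (simp add: algebra_simps)
qed

lemma entire_b: "entire_coeffs b"
  unfolding entire_coeffs_def
proof
  fix r :: real
  define N where "N = nat \<lceil>pi\<^sup>2 * \<bar>r\<bar>\<rceil>"
  show "summable (\<lambda>n. b n * r ^ n)"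
  proof (rule summable_ratio_test[where c = "1/2" and N = N])
    fix n assume "n \<ge> N"
    then have n: "pi\<^sup>2 * \<bar>r\<bar> \<le> real n" unfolding N_def by linarith
    have d: "(real n + 1) * (real n + 1 + \<nu>) > 0" using nu by simp
    have "4 * (real n + 1) * (real n + 1 + \<nu>) * \<bar>b (Suc n)\<bar> = pi\<^sup>2 * \<bar>b n\<bar>"
    proof -
      have "\<bar>(4 * (real n + 1) * (real n + 1 + \<nu>)) * b (Suc n)\<bar> = pi\<^sup>2 * \<bar>b n\<bar>"
        unfolding b_Suc by (simp add: abs_mult)
      moreover have "4 * (real n + 1) * (real n + 1 + \<nu>) \<ge> 0" using nu by simp
      ultimately show ?thesis by (subst (asm) abs_mult) simp
    qed
    then have "(4 * (real n + 1) * (real n + 1 + \<nu>) * \<bar>b (Suc n)\<bar>) * \<bar>r\<bar> ^ Suc n = (pi\<^sup>2 * \<bar>b n\<bar>) * \<bar>r\<bar> ^ Suc n"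
      by (rule arg_cong)
    then have "4 * (real n + 1) * (real n + 1 + \<nu>) * (\<bar>b (Suc n)\<bar> * \<bar>r\<bar> ^ Suc n) = (pi\<^sup>2 * \<bar>r\<bar>) * (\<bar>b n\<bar> * \<bar>r\<bar> ^ n)"
      by (simp only: power_Suc mult_ac)
    also have "\<dots> \<le> real n * (\<bar>b n\<bar> * \<bar>r\<bar> ^ n)"
      using n by (intro mult_right_mono) auto
    also have "\<dots> \<le> 2 * ((real n + 1) * (real n + 1 + \<nu>)) * (\<bar>b n\<bar> * \<bar>r\<bar> ^ n)"
    proof (rule mult_right_mono)
      have "real n * 1 \<le> (real n + 1) * (real n + 1 + \<nu>)" using nu by (intro mult_mono) auto
      then show "real n \<le> 2 * ((real n + 1) * (real n + 1 + \<nu>))" by linarith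
    qed simp
    finally have "((real n + 1) * (real n + 1 + \<nu>)) * (2 * (\<bar>b (Suc n)\<bar> * \<bar>r\<bar> ^ Suc n))
        \<le> ((real n + 1) * (real n + 1 + \<nu>)) * (\<bar>b n\<bar> * \<bar>r\<bar> ^ n)" by (simp add: algebra_simps)
    then have "2 * (\<bar>b (Suc n)\<bar> * \<bar>r\<bar> ^ Suc n) \<le> \<bar>b n\<bar> * \<bar>r\<bar> ^ n"
      using d by (simp only: mult_le_cancel_left_pos)
    then show "norm (b (Suc n) * r ^ Suc n) \<le> 1/2 * norm (b n * r ^ n)"
      by (simp add: abs_mult power_abs)
  qed simp
qed

definition \<Phi> :: "'a::{real_normed_field,banach} \<Rightarrow> 'a" where "\<Phi> = powser b"
definition \<Phi>' :: "'a::{real_normed_field,banach} \<Rightarrow> 'a" where "\<Phi>' = powser (diffs b)"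
definition \<Phi>'' :: "'a::{real_normed_field,banach} \<Rightarrow> 'a" where "\<Phi>'' = powser (diffs (diffs b))"

lemma \<Phi>_deriv: "(\<Phi> has_field_derivative \<Phi>' z) (at z)"
  unfolding \<Phi>_def \<Phi>'_def by (intro powser_has_derivative entire_b)

lemma \<Phi>'_deriv: "(\<Phi>' has_field_derivative \<Phi>'' z) (at z)"
  unfolding \<Phi>''_def \<Phi>'_def by (intro powser_has_derivative entire_coeffs_diffs entire_b)

lemma \<Phi>_of_real: "\<Phi> (of_real x) = of_real (\<Phi> x)" and \<Phi>'_of_real: "\<Phi>' (of_real x) = of_real (\<Phi>' x)"
  unfolding \<Phi>_def \<Phi>'_def by (intro powser_of_real entire_coeffs_diffs entire_b)+

text \<open>Bessel's equation in the variable \<open>z = w\<^sup>2\<close>. On coefficients it is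
  the two-term recurrence \<open>b_Suc\<close>.\<close>

lemma \<Phi>_ode: "4 * z * \<Phi>'' z + 4 * of_real (\<nu> + 1) * \<Phi>' z + of_real (pi\<^sup>2) * \<Phi> z = 0"
proof -
  define f where "f n = of_real (real n * diffs b n) * z ^ n" for n
  have "(\<lambda>n. z * (of_real (diffs (diffs b) n) * z ^ n)) sums (z * \<Phi>'' z)"
    unfolding \<Phi>''_def by (intro sums_mult powser_sums entire_coeffs_diffs entire_b)
  moreover have "z * (of_real (diffs (diffs b) n) * z ^ n) = f (Suc n)" for n
    by (simp add: f_def diffs_def)
  ultimately have "(\<lambda>n. f (Suc n)) sums (z * \<Phi>'' z)" by simp
  then have "f sums (z * \<Phi>'' z)" using sums_Suc[of f "z * \<Phi>'' z"] by (simp add: f_def)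
  then have "(\<lambda>n. 4 * f n + 4 * of_real (\<nu> + 1) * (of_real (diffs b n) * z ^ n) + of_real (pi\<^sup>2) * (of_real (b n) * z ^ n))
    sums (4 * (z * \<Phi>'' z) + 4 * of_real (\<nu> + 1) * \<Phi>' z + of_real (pi\<^sup>2) * \<Phi> z)"
    unfolding \<Phi>_def \<Phi>'_def by (intro sums_add sums_mult powser_sums entire_coeffs_diffs entire_b)
  moreover have "4 * f n + 4 * of_real (\<nu> + 1) * (of_real (diffs b n) * z ^ n) + of_real (pi\<^sup>2) * (of_real (b n) * z ^ n) = 0" for n
  proof -
    have "4 * real n * diffs b n + 4 * (\<nu> + 1) * diffs b n + pi\<^sup>2 * b n = 0"
      using b_Suc[of n] by (simp add: diffs_def algebra_simps)
    then have "of_real (4 * real n * diffs b n + 4 * (\<nu> + 1) * diffs b n + pi\<^sup>2 * b n) * z ^ n = 0" by simp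
    then show ?thesis by (simp add: f_def algebra_simps)
  qed
  ultimately show ?thesis using sums_unique2[OF _ sums_zero] by (simp add: mult.assoc)
qed

text \<open>At \<open>- r\<close> the alternating signs cancel, and the series becomes that of the
  modified Bessel function \<open>I\<^sub>\<nu>\<close>, with nonnegative terms and a positive
  constant term.\<close>

lemma \<Phi>_neg_pos:
  fixes r :: real
  assumes "r \<ge> 0"
  shows "\<Phi> (- r) > 0"
proof -
  have e: "b n * (- r) ^ n = \<bar>b n\<bar> * r ^ n" for n
    by (subst power_minus) (simp add: abs_b)
  have s: "(\<lambda>n. b n * (-r) ^ n) sums \<Phi> (-r)"
    using powser_sums[OF entire_b, of "-r"] by (simp add: \<Phi>_def)
  show ?thesis
    unfolding sums_unique[OF s]
    by (rule suminf_pos2[where i = 0]) (use s b_0_pos assms in \<open>auto simp: e sums_iff\<close>)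
qed

lemma \<Phi>_0: "\<Phi> 0 = of_real (b 0)"
  unfolding \<Phi>_def by (intro powser_0 entire_b)

text \<open>Lommel's argument: with \<open>y t = \<Phi> (z t)\<close>, the derivative of \<open>t\<^sup>\<nu>\<^sup>+\<^sup>1 Im (y' cnj y)\<close> is a multiple of
  \<open>Im z\<close> of constant sign, while the function vanishes at \<open>0\<close> and \<open>1\<close>.\<close>

lemma \<Phi>_zero_real:
  assumes "\<Phi> z = 0"
  shows "Im z = 0" "Re z > 0"
proof -
  show im: "Im z = 0"
  proof (rule ccontr)
    assume I: "Im z \<noteq> 0"
    define y where "y t = \<Phi> (z * of_real t)" for t :: real
    define V where "V t = t powr (\<nu> + 1) * Im (z * \<Phi>' (z * of_real t) * cnj (\<Phi> (z * of_real t)))" for t :: real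
    define W where "W t = - V t / Im z" for t
    have V: "(V has_real_derivative - (pi\<^sup>2 / 4) * Im z * t powr \<nu> * (norm (y t))\<^sup>2) (at t)" if t: "t > 0" for t
    proof -
      have 1: "((\<lambda>t. z * \<Phi>' (z * of_real t)) has_vector_derivative z * (\<Phi>'' (z * of_real t) * z)) (at t)"
        by (rule has_vector_derivative_real_field[where f = "\<lambda>u. z * \<Phi>' (z * u)"])
           (auto intro!: derivative_eq_intros DERIV_chain2[OF \<Phi>'_deriv])
      have 2: "((\<lambda>t. cnj (\<Phi> (z * of_real t))) has_vector_derivative cnj (\<Phi>' (z * of_real t) * z)) (at t)"
        by (rule bounded_linear.has_vector_derivative[OF bounded_linear_cnj],
            rule has_vector_derivative_real_field[where f = "\<lambda>u. \<Phi> (z * u)"])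
           (auto intro!: derivative_eq_intros DERIV_chain2[OF \<Phi>_deriv])
      have 3: "((\<lambda>t. Im (z * \<Phi>' (z * of_real t) * cnj (\<Phi> (z * of_real t)))) has_real_derivative
          Im (z * \<Phi>' (z * of_real t) * cnj (\<Phi>' (z * of_real t) * z) + z * (\<Phi>'' (z * of_real t) * z) * cnj (\<Phi> (z * of_real t)))) (at t)"
        unfolding has_real_derivative_iff_has_vector_derivative
        by (rule bounded_linear.has_vector_derivative[OF bounded_linear_Im has_vector_derivative_mult[OF 1 2]])
      have e: "of_real t * (z * (\<Phi>'' (z * of_real t) * z)) + of_real (\<nu> + 1) * (z * \<Phi>' (z * of_real t)) = - of_real (pi\<^sup>2 / 4) * z * y t"
        using \<Phi>_ode[of "z * of_real t"] unfolding y_def by simp algebra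
      have "Im (z * \<Phi>' (z * of_real t) * cnj (\<Phi>' (z * of_real t) * z)) = 0"
        by (simp add: algebra_simps)
      then have "((\<lambda>t. Im (z * \<Phi>' (z * of_real t) * cnj (\<Phi> (z * of_real t)))) has_real_derivative
          Im (z * (\<Phi>'' (z * of_real t) * z) * cnj (y t))) (at t)"
        using 3 by (simp only: plus_complex.simps add_0_left y_def)
      moreover have "((\<lambda>t. t powr (\<nu> + 1)) has_real_derivative (\<nu> + 1) * t powr \<nu>) (at t)"
        using has_real_derivative_powr[OF t, of "\<nu> + 1"] by simp
      ultimately have "(V has_real_derivative (\<nu> + 1) * t powr \<nu> * Im (z * \<Phi>' (z * of_real t) * cnj (\<Phi> (z * of_real t))) +
          Im (z * (\<Phi>'' (z * of_real t) * z) * cnj (y t)) * t powr (\<nu> + 1)) (at t)"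
        unfolding V_def[abs_def] by (intro DERIV_mult)
      also have "(\<nu> + 1) * t powr \<nu> * Im (z * \<Phi>' (z * of_real t) * cnj (\<Phi> (z * of_real t))) +
          Im (z * (\<Phi>'' (z * of_real t) * z) * cnj (y t)) * t powr (\<nu> + 1) =
          t powr \<nu> * Im ((of_real t * (z * (\<Phi>'' (z * of_real t) * z)) + of_real (\<nu> + 1) * (z * \<Phi>' (z * of_real t))) * cnj (y t))"
        unfolding y_def[symmetric]
        using t by (simp add: powr_add algebra_simps)
      also have "\<dots> = - (pi\<^sup>2 / 4) * Im z * t powr \<nu> * (norm (y t))\<^sup>2"
        unfolding e cmod_power2 by (simp add: power2_eq_square algebra_simps)
      finally show ?thesis .
    qed
    have W: "(W has_real_derivative (pi\<^sup>2 / 4) * t powr \<nu> * (norm (y t))\<^sup>2) (at t)" if t: "t > 0" for t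
      unfolding W_def[abs_def] using V[OF t] I by (auto intro!: derivative_eq_intros)
    \<comment> \<open>The derivative of \<open>W\<close> is only nonnegative in general. It is
      strictly positive near 0, where \<open>y\<close> is close to \<open>\<Phi> 0\<close>, and this
      suffices for \<open>W 0 < W 1\<close>.\<close>
    have y0: "y 0 \<noteq> 0" using b_0_pos by (simp add: y_def \<Phi>_0)
    have conty: "isCont y t" for t
      unfolding y_def by (intro isCont_o2[OF _ DERIV_isCont[OF \<Phi>_deriv]] continuous_intros)
    have "\<forall>\<^sub>F t in at 0. y t \<noteq> 0"
      using tendsto_imp_eventually_ne[OF conty[unfolded isCont_def]] y0 by blast
    then obtain d where d: "d > 0" "\<And>t. 0 < t \<Longrightarrow> t < d \<Longrightarrow> y t \<noteq> 0"
      by (auto simp: eventually_at dist_real_def)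
    define e where "e = min (d/2) (1/2)"
    have e: "e > 0" "e < d" "e < 1" using d by (auto simp: e_def)
    have contW: "continuous_on {0..e} W"
      unfolding W_def V_def using I nu
      by (intro continuous_intros continuous_on_compose2[OF DERIV_continuous_on[OF has_field_derivative_at_within[OF \<Phi>_deriv]]]
            continuous_on_compose2[OF DERIV_continuous_on[OF has_field_derivative_at_within[OF \<Phi>'_deriv]]] continuous_on_powr') auto
    have "W 0 < W e"
    proof (rule DERIV_pos_imp_increasing_open[OF e(1) _ contW])
      fix t assume "0 < t" "t < e"
      then show "\<exists>D. DERIV W t :> D \<and> D > 0"
        using W[of t] d(2)[of t] e by (intro exI[of _ "(pi\<^sup>2 / 4) * t powr \<nu> * (norm (y t))\<^sup>2"]) auto
    qed
    moreover have "W e \<le> W 1"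
    proof (rule DERIV_nonneg_imp_nondecreasing[where f = W])
      fix t assume "e \<le> t" "t \<le> 1"
      then show "\<exists>D. DERIV W t :> D \<and> D \<ge> 0"
        using W[of t] e by (intro exI[of _ "(pi\<^sup>2 / 4) * t powr \<nu> * (norm (y t))\<^sup>2"]) auto
    qed (use e in auto)
    moreover have "W 0 = 0" "W 1 = 0" using assms by (simp_all add: W_def V_def)
    ultimately show False by simp
  qed
  then have z: "z = of_real (Re z)" by (simp add: complex_eq_iff)
  have "\<Phi> (Re z) = 0" using assms \<Phi>_of_real[of "Re z", where ?'a = complex] z by simp
  then show "Re z > 0" using \<Phi>_neg_pos[of "- Re z"] by (cases "Re z > 0") auto
qed

text \<open>At a double zero \<open>z\<close>, the differential equation differentiated
  \<open>m\<close> times determines the derivative of order \<open>m + 2\<close> from the two before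
  it, because its leading coefficient \<open>4 * z\<close> is nonzero. All derivatives would vanish
  at \<open>z\<close>, hence \<open>\<Phi>\<close> everywhere, although \<open>\<Phi> 0\<close> is
  positive.\<close>

lemma \<Phi>_zero_simple:
  fixes z :: complex
  assumes "\<Phi> z = 0"
  shows "\<Phi>' z \<noteq> 0"
proof
  assume 1: "\<Phi>' z = 0"
  define c where "c m = (diffs ^^ m) b" for m
  have ent: "entire_coeffs (c m)" for m
    unfolding c_def by (induction m) (auto intro: entire_b entire_coeffs_diffs)
  have der: "(powser (c m) has_field_derivative powser (c (Suc m)) w) (at w)" for m and w :: complex
    using powser_has_derivative[OF ent] by (simp add: c_def)
  have ode: "4 * w * powser (c (m + 2)) w + of_real (4 * (\<nu> + 1 + real m)) * powser (c (Suc m)) w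
      + of_real (pi\<^sup>2) * powser (c m) w = 0" for m and w :: complex
  proof (induction m arbitrary: w)
    case 0
    then show ?case using \<Phi>_ode[of w] by (simp add: \<Phi>_def \<Phi>'_def \<Phi>''_def c_def numeral_2_eq_2)
  next
    case (Suc m)
    define R where "R = (\<lambda>w::complex. 4 * w * powser (c (m + 2)) w + of_real (4 * (\<nu> + 1 + real m)) * powser (c (Suc m)) w
      + of_real (pi\<^sup>2) * powser (c m) w)"
    have "R = (\<lambda>w. 0)" using Suc.IH by (simp add: R_def)
    then have "(R has_field_derivative 0) (at w)" by simp
    moreover have "(R has_field_derivative (4 * powser (c (m + 2)) w + 4 * w * powser (c (Suc (m + 2))) w)
       + of_real (4 * (\<nu> + 1 + real m)) * powser (c (Suc (Suc m))) w + of_real (pi\<^sup>2) * powser (c (Suc m)) w) (at w)"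
      unfolding R_def by (auto intro!: derivative_eq_intros der)
    ultimately have "(4 * powser (c (m + 2)) w + 4 * w * powser (c (Suc (m + 2))) w)
       + of_real (4 * (\<nu> + 1 + real m)) * powser (c (Suc (Suc m))) w + of_real (pi\<^sup>2) * powser (c (Suc m)) w = 0"
      by (rule DERIV_unique[symmetric])
    then show ?case by (simp add: algebra_simps)
  qed
  have z0: "z \<noteq> 0" using \<Phi>_zero_real[OF assms] by auto
  have "powser (c m) z = 0 \<and> powser (c (Suc m)) z = 0" for m
  proof (induction m)
    case 0
    then show ?case using assms 1 by (simp add: c_def \<Phi>_def \<Phi>'_def)
  next
    case (Suc m)
    then show ?case using ode[of z m] z0 by simp
  qed
  moreover have "(deriv ^^ m) (\<Phi> :: complex \<Rightarrow> complex) = powser (c m)" for m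
  proof (induction m)
    case (Suc m)
    have "deriv (powser (c m) :: complex \<Rightarrow> complex) = powser (c (Suc m))"
      by (intro ext DERIV_imp_deriv der)
    then show ?case by (simp add: Suc)
  qed (simp add: c_def \<Phi>_def)
  moreover have "\<Phi> holomorphic_on UNIV"
    using \<Phi>_deriv holomorphic_on_open open_UNIV by blast
  ultimately have "\<Phi> (0::complex) = 0"
    by (intro holomorphic_fun_eq_0_on_connected[of \<Phi> UNIV z]) auto
  then show False using b_0_pos by (simp add: \<Phi>_0)
qed

end

section \<open>Location of the zeros\<close>

lemma nonvanishing_constant_sign:
  fixes f :: "real \<Rightarrow> real"
  assumes "connected S" "continuous_on S f" "\<And>t. t \<in> S \<Longrightarrow> f t \<noteq> 0"
  obtains \<sigma> where "\<bar>\<sigma>\<bar> = 1" "\<And>t. t \<in> S \<Longrightarrow> \<sigma> * f t > 0"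
proof (cases "\<exists>t\<in>S. f t < 0")
  case False
  then show ?thesis using that[of 1] assms(3) by (metis abs_one linorder_neqE_linordered_idom mult_1)
next
  case True
  then obtain s where s: "s \<in> S" "f s < 0" by blast
  have c: "connected (f ` S)" using assms by (intro connected_continuous_image)
  have "f t < 0" if "t \<in> S" for t
  proof (rule ccontr)
    assume "\<not> f t < 0"
    then have "0 \<in> {f s..f t}" using s by auto
    also have "{f s..f t} \<subseteq> f ` S" using c s that by (intro connected_contains_Icc) auto
    finally show False using assms(3) by auto
  qed
  then show ?thesis using that[of "-1"] by auto
qed

context
  fixes u u' q :: "real \<Rightarrow> real" and a b \<kappa> :: real
  assumes ab: "a < b" and \<kappa>: "\<kappa> > 0" and len: "\<kappa> * (b - a) \<le> pi"
    and u: "\<And>t. t \<in> {a..b} \<Longrightarrow> (u has_real_derivative u' t) (at t)"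
    and u': "\<And>t. t \<in> {a..b} \<Longrightarrow> (u' has_real_derivative - q t * u t) (at t)"
    and nonneg: "\<And>t. t \<in> {a..b} \<Longrightarrow> u t \<ge> 0"
begin

text \<open>The Wronskian of \<open>u\<close> and \<open>sin (\<kappa> * (t - a))\<close>, which
  solves the comparison equation with constant coefficient \<open>\<kappa>\<^sup>2\<close>. Up to
  length \<open>pi / \<kappa>\<close> this sine is nonnegative, so the sign of
  \<open>q - \<kappa>\<^sup>2\<close> decides the monotonicity.\<close>

definition sturm_wronskian :: "real \<Rightarrow> real" where
  "sturm_wronskian t = u t * (\<kappa> * cos (\<kappa> * (t - a))) - u' t * sin (\<kappa> * (t - a))"

lemma sturm_wronskian_deriv:
  assumes t: "t \<in> {a..b}"
  shows "(sturm_wronskian has_real_derivative (q t - \<kappa>\<^sup>2) * (u t * sin (\<kappa> * (t - a)))) (at t)"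
  unfolding sturm_wronskian_def[abs_def]
  by (rule derivative_eq_intros u[OF t] u'[OF t] refl)+ (simp add: algebra_simps power2_eq_square)

lemma sturm_weight_nonneg:
  assumes "t \<in> {a..b}"
  shows "u t * sin (\<kappa> * (t - a)) \<ge> 0"
proof (intro mult_nonneg_nonneg nonneg assms sin_ge_zero)
  have "\<kappa> * (t - a) \<le> \<kappa> * (b - a)" using assms \<kappa> by (intro mult_left_mono) auto
  then show "\<kappa> * (t - a) \<le> pi" using len by simp
qed (use assms \<kappa> in auto)

text \<open>The Wronskian starts at 0 and does not increase, yet at \<open>b\<close> it equals
  \<open>- u' b * sin (\<kappa> * (b - a))\<close>, which is positive if the interval is shorter
  than \<open>pi / \<kappa>\<close>.\<close>

lemma sturm_gap_lower:
  assumes "\<And>t. t \<in> {a..b} \<Longrightarrow> q t \<le> \<kappa>\<^sup>2" "u a = 0" "u b = 0" "u' b < 0"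
  shows "\<kappa> * (b - a) = pi"
proof (rule ccontr)
  assume "\<kappa> * (b - a) \<noteq> pi"
  then have "sin (\<kappa> * (b - a)) > 0" using len ab \<kappa> by (intro sin_gt_zero) auto
  then have "sturm_wronskian b > 0" using assms by (simp add: sturm_wronskian_def mult_neg_pos)
  moreover have "sturm_wronskian b \<le> sturm_wronskian a"
  proof (rule DERIV_nonpos_imp_nonincreasing[where f = sturm_wronskian])
    fix t assume "a \<le> t" "t \<le> b"
    then have t: "t \<in> {a..b}" by simp
    show "\<exists>D. DERIV sturm_wronskian t :> D \<and> D \<le> 0"
      using sturm_wronskian_deriv[OF t] assms(1)[OF t] sturm_weight_nonneg[OF t]
      by (intro exI[of _ "(q t - \<kappa>\<^sup>2) * (u t * sin (\<kappa> * (t - a)))"]) (auto intro: mult_nonpos_nonneg)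
  qed (use ab in simp)
  moreover have "sturm_wronskian a = 0" using assms by (simp add: sturm_wronskian_def)
  ultimately show False by simp
qed

text \<open>On an interval of length exactly \<open>pi / \<kappa>\<close> the Wronskian does not
  decrease, but runs from \<open>\<kappa> * u a \<ge> 0\<close> to
  \<open>- \<kappa> * u b \<le> 0\<close>. Hence \<open>u\<close> cannot stay positive up to and
  including \<open>b\<close>.\<close>

lemma sturm_end_nonpos:
  assumes "\<And>t. t \<in> {a..b} \<Longrightarrow> q t \<ge> \<kappa>\<^sup>2" "\<kappa> * (b - a) = pi"
  shows "u b = 0"
proof -
  have "sturm_wronskian a \<le> sturm_wronskian b"
  proof (rule DERIV_nonneg_imp_nondecreasing[where f = sturm_wronskian])
    fix t assume "a \<le> t" "t \<le> b"
    then have t: "t \<in> {a..b}" by simp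
    show "\<exists>D. DERIV sturm_wronskian t :> D \<and> D \<ge> 0"
      using sturm_wronskian_deriv[OF t] assms(1)[OF t] sturm_weight_nonneg[OF t]
      by (intro exI[of _ "(q t - \<kappa>\<^sup>2) * (u t * sin (\<kappa> * (t - a)))"]) auto
  qed (use ab in simp)
  moreover have "sturm_wronskian a = \<kappa> * u a" "sturm_wronskian b = - \<kappa> * u b"
    using assms by (simp_all add: sturm_wronskian_def)
  moreover have "\<kappa> * u a \<ge> 0" "\<kappa> * u b \<ge> 0" using \<kappa> ab nonneg[of a] nonneg[of b] by auto
  ultimately have "\<kappa> * u b = 0" by linarith
  then show ?thesis using \<kappa> by simp
qed

end

section \<open>Gaps between the scaled zeros and their enumeration\<close>

context bessel
begin

text \<open>This is \<open>sqrt x * J\<^sub>\<nu>(\<pi> x)\<close>, the normalization that removes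
  the first-order term of Bessel's equation and leaves \<open>u'' = - q u\<close>. As
  \<open>q\<close> tends to \<open>pi\<^sup>2\<close>, consecutive zeros are about 1 apart.\<close>

definition u :: "real \<Rightarrow> real" where "u x = x powr (\<nu> + 1/2) * \<Phi> (x\<^sup>2)"
definition u' :: "real \<Rightarrow> real" where
  "u' x = (\<nu> + 1/2) * x powr (\<nu> - 1/2) * \<Phi> (x\<^sup>2) + x powr (\<nu> + 1/2) * (\<Phi>' (x\<^sup>2) * (2 * x))"
definition q :: "real \<Rightarrow> real" where "q x = pi\<^sup>2 - (\<nu>\<^sup>2 - 1/4) / x\<^sup>2"

lemma sq_deriv: "((\<lambda>x. x\<^sup>2) has_real_derivative 2 * x) (at x)"
  by (auto intro!: derivative_eq_intros)

lemma u_deriv: "x > 0 \<Longrightarrow> (u has_real_derivative u' x) (at x)"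
  unfolding u_def[abs_def] u'_def
  using DERIV_mult[OF has_real_derivative_powr[of x "\<nu> + 1/2"] DERIV_chain2[OF \<Phi>_deriv sq_deriv]]
  by (simp add: algebra_simps)

lemma u'_deriv:
  assumes x: "x > 0"
  shows "(u' has_real_derivative - q x * u x) (at x)"
proof -
  define P where "P = x powr (\<nu> - 3/2)"
  have P1: "x powr (\<nu> - 1/2) = P * x" using x powr_add[of x "\<nu> - 3/2" 1] by (simp add: P_def add.commute)
  have P2: "x powr (\<nu> + 1/2) = P * x\<^sup>2" using x powr_add[of x "\<nu> - 3/2" 2] by (simp add: P_def powr_numeral add.commute)
  have d1: "((\<lambda>x. x powr (\<nu> - 1/2)) has_real_derivative (\<nu> - 1/2) * P) (at x)"
    using has_real_derivative_powr[OF x, of "\<nu> - 1/2"] by (simp add: P_def)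
  have d2: "((\<lambda>x. x powr (\<nu> + 1/2)) has_real_derivative (\<nu> + 1/2) * (P * x)) (at x)"
    using has_real_derivative_powr[OF x, of "\<nu> + 1/2"] by (simp add: P1[symmetric])
  have "(u' has_real_derivative (\<nu> + 1/2) * ((\<nu> - 1/2) * P * \<Phi> (x\<^sup>2) + P * x * (\<Phi>' (x\<^sup>2) * (2 * x)))
      + ((\<nu> + 1/2) * (P * x) * (\<Phi>' (x\<^sup>2) * (2 * x)) + P * x\<^sup>2 * (\<Phi>'' (x\<^sup>2) * (2 * x) * (2 * x) + \<Phi>' (x\<^sup>2) * 2))) (at x)"
    unfolding u'_def[abs_def]
    by (rule derivative_eq_intros d1 d2 DERIV_chain2[OF \<Phi>_deriv sq_deriv] DERIV_chain2[OF \<Phi>'_deriv sq_deriv] refl)+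
       (simp add: P1 P2 algebra_simps)
  also have "(\<nu> + 1/2) * ((\<nu> - 1/2) * P * \<Phi> (x\<^sup>2) + P * x * (\<Phi>' (x\<^sup>2) * (2 * x)))
      + ((\<nu> + 1/2) * (P * x) * (\<Phi>' (x\<^sup>2) * (2 * x)) + P * x\<^sup>2 * (\<Phi>'' (x\<^sup>2) * (2 * x) * (2 * x) + \<Phi>' (x\<^sup>2) * 2))
      = P * ((\<nu>\<^sup>2 - 1/4) * \<Phi> (x\<^sup>2) + x\<^sup>2 * (4 * x\<^sup>2 * \<Phi>'' (x\<^sup>2) + 4 * (\<nu> + 1) * \<Phi>' (x\<^sup>2)))"
    by (simp add: algebra_simps power2_eq_square)
  also have "4 * x\<^sup>2 * \<Phi>'' (x\<^sup>2) + 4 * (\<nu> + 1) * \<Phi>' (x\<^sup>2) = - (pi\<^sup>2) * \<Phi> (x\<^sup>2)"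
    using \<Phi>_ode[of "x\<^sup>2"] by simp
  also have "P * ((\<nu>\<^sup>2 - 1/4) * \<Phi> (x\<^sup>2) + x\<^sup>2 * (- (pi\<^sup>2) * \<Phi> (x\<^sup>2))) = - q x * u x"
    using x unfolding u_def q_def P2 by (simp add: field_simps)
  finally show ?thesis .
qed

lemma u_zero_iff: "x > 0 \<Longrightarrow> u x = 0 \<longleftrightarrow> \<Phi> (x\<^sup>2) = 0" by (simp add: u_def)

lemma u_zero_simple:
  assumes "x > 0" "u x = 0"
  shows "u' x \<noteq> 0"
proof -
  have z: "\<Phi> (x\<^sup>2) = 0" using assms by (simp add: u_zero_iff)
  then have "\<Phi> (complex_of_real (x\<^sup>2)) = 0" by (simp only: \<Phi>_of_real of_real_0)
  then have "\<Phi>' (complex_of_real (x\<^sup>2)) \<noteq> 0" by (rule \<Phi>_zero_simple)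
  then have "\<Phi>' (x\<^sup>2) \<noteq> 0" by (metis \<Phi>'_of_real of_real_0)
  then show ?thesis using assms z by (simp add: u'_def)
qed

text \<open>Here \<open>\<nu> \<ge> 1/2\<close> makes \<open>q\<close> increasing and bounded by
  \<open>pi\<^sup>2\<close>, the two facts on which the gap estimates rest.\<close>

lemma nu_sq: "\<nu>\<^sup>2 - 1/4 \<ge> 0"
  using power_mono[OF nu, of 2] by (simp add: power2_eq_square)

lemma q_le: "q x \<le> pi\<^sup>2" unfolding q_def using nu_sq by simp

lemma q_mono: "0 < x \<Longrightarrow> x \<le> y \<Longrightarrow> q x \<le> q y"
  unfolding q_def using nu_sq by (intro diff_left_mono divide_left_mono power_mono mult_pos_pos) simp_all

lemma u_continuous_on: "S \<subseteq> {0<..} \<Longrightarrow> continuous_on S u"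
  by (rule DERIV_continuous_on[where D = u'], rule has_field_derivative_at_within, rule u_deriv) auto

definition zeros :: "real set" where "zeros = {x. x > 0 \<and> u x = 0}"

text \<open>Comparison with \<open>\<kappa>\<^sup>2 = q x\<close>, the least value of
  \<open>q\<close> to the right of \<open>x\<close>: a solution of constant sign on
  \<open>{x<..y}\<close> would have to vanish at \<open>y\<close>.\<close>

lemma zero_in_gap:
  assumes "x > 0" "q x > 0"
  shows "\<exists>y\<in>zeros. x < y \<and> y \<le> x + pi / sqrt (q x)"
proof (rule ccontr)
  define \<kappa> where "\<kappa> = sqrt (q x)"
  define y where "y = x + pi / \<kappa>"
  have \<kappa>: "\<kappa> > 0" using assms by (simp add: \<kappa>_def)
  have xy: "x < y" using \<kappa> by (simp add: y_def)
  assume no: "\<not> (\<exists>y\<in>zeros. x < y \<and> y \<le> x + pi / sqrt (q x))"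
  then have nz: "u t \<noteq> 0" if "t \<in> {x<..y}" for t
    using no that assms by (force simp: zeros_def y_def \<kappa>_def)
  obtain \<sigma> where \<sigma>: "\<bar>\<sigma>\<bar> = 1" "\<And>t. t \<in> {x<..y} \<Longrightarrow> \<sigma> * u t > 0"
    using nonvanishing_constant_sign[OF _ u_continuous_on nz, of "{x<..y}"] assms by (auto simp: subset_eq)
  have "\<sigma> * u y = 0"
  proof (rule sturm_end_nonpos[where u = "\<lambda>t. \<sigma> * u t" and u' = "\<lambda>t. \<sigma> * u' t" and q = q and a = x and \<kappa> = \<kappa>])
    show "\<kappa> * (y - x) = pi" "\<kappa> * (y - x) \<le> pi" using \<kappa> by (auto simp: y_def)
    fix t assume t: "t \<in> {x..y}"
    show "((\<lambda>t. \<sigma> * u t) has_real_derivative \<sigma> * u' t) (at t)"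
      using u_deriv[of t] t assms by (intro DERIV_cmult) auto
    show "((\<lambda>t. \<sigma> * u' t) has_real_derivative - q t * (\<sigma> * u t)) (at t)"
      using DERIV_cmult[OF u'_deriv[of t], of \<sigma>] t assms by (simp add: algebra_simps)
    show "\<kappa>\<^sup>2 \<le> q t" using q_mono[of x t] t assms by (simp add: \<kappa>_def)
    have "0 \<le> \<sigma> * u t" if "t \<in> closure {x<..y}" for t
    proof (rule continuous_ge_on_closure[OF _ that])
      show "continuous_on (closure {x<..y}) (\<lambda>t. \<sigma> * u t)"
        using xy assms by (intro continuous_intros u_continuous_on) auto
    qed (use \<sigma> in \<open>auto intro: less_imp_le\<close>)
    then show "0 \<le> \<sigma> * u t" using t xy by simp
  qed (use xy \<kappa> in simp_all)
  moreover have "\<sigma> * u y > 0" using \<sigma>(2)[of y] xy by simp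
  ultimately show False by linarith
qed

text \<open>Comparison with \<open>\<kappa> = pi\<close>, the upper bound for the frequency, between
  \<open>x\<close> and the next zero \<open>b\<close>. Simplicity of the zeros isolates
  \<open>x\<close> and makes the slope at \<open>b\<close> strictly negative, once the sign of
  \<open>u\<close> is normalized.\<close>

lemma zeros_gap:
  assumes x: "x \<in> zeros" and y: "y \<in> zeros" and xy: "x < y"
  shows "x + 1 \<le> y"
proof (rule ccontr)
  assume "\<not> x + 1 \<le> y"
  have x0: "x > 0" "u x = 0" and y0: "u y = 0" using x y by (auto simp: zeros_def)
  have "\<exists>d>0. \<forall>h. 0 < h \<longrightarrow> h < d \<longrightarrow> u (x + h) \<noteq> 0"
  proof (cases "u' x > 0")
    case True
    then show ?thesis using DERIV_pos_inc_right[OF u_deriv[OF x0(1)]] x0(2) by fastforce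
  next
    case False
    then have "u' x < 0" using u_zero_simple[OF x0] by simp
    then show ?thesis using DERIV_neg_dec_right[OF u_deriv[OF x0(1)]] x0(2) by fastforce
  qed
  then obtain d where d: "d > 0" "\<And>h. 0 < h \<Longrightarrow> h < d \<Longrightarrow> u (x + h) \<noteq> 0" by blast
  \<comment> \<open>Further zeros start at distance at least \<open>d\<close> from \<open>x\<close>,
    so the relevant zero set is closed and its infimum \<open>b\<close> is the zero that follows
    \<open>x\<close>.\<close>
  define T where "T = {t \<in> {x + d..y}. u t = 0}"
  have yT: "y \<in> T" using d(2)[of "y - x"] xy y0 by (force simp: T_def)
  have clT: "closed T"
    unfolding T_def using x0 d by (intro continuous_closed_preimage_constant u_continuous_on) auto
  define b where "b = Inf T"
  have bdd: "bdd_below T" by (rule bdd_belowI[of _ "x + d"]) (auto simp: T_def)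
  have bT: "b \<in> T" unfolding b_def using yT bdd clT by (intro closed_contains_Inf) auto
  have b: "x < b" "b \<le> y" "u b = 0" using bT d by (auto simp: T_def)
  have nz: "u t \<noteq> 0" if "t \<in> {x<..<b}" for t
  proof
    assume 0: "u t = 0"
    then have "t \<ge> x + d" using d(2)[of "t - x"] that by (cases "t \<ge> x + d") auto
    then have "t \<in> T" using 0 that b by (auto simp: T_def)
    then have "b \<le> t" unfolding b_def using bdd by (intro cInf_lower)
    then show False using that by simp
  qed
  obtain \<sigma> where \<sigma>: "\<bar>\<sigma>\<bar> = 1" "\<And>t. t \<in> {x<..<b} \<Longrightarrow> \<sigma> * u t > 0"
    using nonvanishing_constant_sign[OF _ u_continuous_on nz, of "{x<..<b}"] x0 by (auto simp: subset_eq)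
  have der: "((\<lambda>t. \<sigma> * u t) has_real_derivative \<sigma> * u' t) (at t)" if "t \<ge> x" for t
    using u_deriv[of t] that x0 by (intro DERIV_cmult) auto
  have "\<sigma> * u' b \<le> 0"
  proof (rule ccontr)
    assume "\<not> \<sigma> * u' b \<le> 0"
    then obtain e where e: "e > 0" "\<And>h. 0 < h \<Longrightarrow> h < e \<Longrightarrow> \<sigma> * u (b - h) < \<sigma> * u b"
      using DERIV_pos_inc_left[OF der[of b]] b by (auto simp: not_le)
    define h where "h = min (e / 2) ((b - x) / 2)"
    have "0 < h" "h < e" "b - h \<in> {x<..<b}" using e b unfolding h_def by (auto simp: min_def field_simps)
    then show False using e(2)[of h] \<sigma>(2)[of "b - h"] b by simp
  qed
  moreover have "\<sigma> * u' b \<noteq> 0" using u_zero_simple[of b] \<sigma>(1) b x0 by auto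
  ultimately have neg: "\<sigma> * u' b < 0" by (rule le_neq_trans)
  have "pi * (b - x) = pi"
  proof (rule sturm_gap_lower[where u = "\<lambda>t. \<sigma> * u t" and u' = "\<lambda>t. \<sigma> * u' t" and q = q and a = x and \<kappa> = pi])
    show "pi * (b - x) \<le> pi" using b \<open>\<not> x + 1 \<le> y\<close> by simp
    fix t assume t: "t \<in> {x..b}"
    show "((\<lambda>t. \<sigma> * u t) has_real_derivative \<sigma> * u' t) (at t)" using der t by simp
    show "((\<lambda>t. \<sigma> * u' t) has_real_derivative - q t * (\<sigma> * u t)) (at t)"
      using DERIV_cmult[OF u'_deriv[of t], of \<sigma>] t x0 by (simp add: algebra_simps)
    show "q t \<le> pi\<^sup>2" by (rule q_le)
    show "0 \<le> \<sigma> * u t" using \<sigma>(2)[of t] t b x0 by (cases "t = x \<or> t = b") (auto intro: less_imp_le)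
  qed (use b x0 neg pi_gt_zero in simp_all)
  then show False using b \<open>\<not> x + 1 \<le> y\<close> by simp
qed

lemma zeros_exist_beyond: "\<exists>y\<in>zeros. y > r"
proof -
  define x where "x = max r 1 + \<nu>"
  have x: "x > 0" "x > \<nu>" "x > r" using nu by (auto simp: x_def)
  have "\<nu>\<^sup>2 - 1/4 < x\<^sup>2" using power_strict_mono[OF x(2), of 2] nu by simp
  then have "(\<nu>\<^sup>2 - 1/4) / x\<^sup>2 < 1" using x by simp
  also have "1 < pi\<^sup>2" using pi_gt3 by (intro one_less_power) auto
  finally have "q x > 0" by (simp add: q_def)
  from zero_in_gap[OF x(1) this] x(3) show ?thesis by (meson less_trans)
qed

text \<open>Distinct zeros are at least \<open>1\<close> apart, so they are enumerated by their integer parts.\<close>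

definition zero_floors :: "nat set" where "zero_floors = (\<lambda>x. nat \<lfloor>x\<rfloor>) ` zeros"

lemma floor_strict_mono_zeros: "strict_mono_on zeros (\<lambda>x. nat \<lfloor>x\<rfloor>)"
proof (rule strict_mono_onI)
  fix x y assume xy: "x \<in> zeros" "y \<in> zeros" "x < y"
  then have "x + 1 \<le> y" "x > 0" using zeros_gap by (auto simp: zeros_def)
  then show "nat \<lfloor>x\<rfloor> < nat \<lfloor>y\<rfloor>" by linarith
qed

lemma infinite_zero_floors: "infinite zero_floors"
  unfolding infinite_nat_iff_unbounded
proof
  fix m
  obtain y where y: "y \<in> zeros" "y > real m + 1" using zeros_exist_beyond by blast
  then have "nat \<lfloor>y\<rfloor> > m" by linarith
  then show "\<exists>n>m. n \<in> zero_floors" using y by (auto simp: zero_floors_def)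
qed

definition lam :: "nat \<Rightarrow> real" where
  "lam k = inv_into zeros (\<lambda>x. nat \<lfloor>x\<rfloor>) (enumerate zero_floors k)"

lemma lam_mem: "lam k \<in> zeros" and lam_floor: "nat \<lfloor>lam k\<rfloor> = enumerate zero_floors k"
proof -
  have e: "enumerate zero_floors k \<in> (\<lambda>x. nat \<lfloor>x\<rfloor>) ` zeros"
    by (fold zero_floors_def) (rule enumerate_in_set[OF infinite_zero_floors])
  show "lam k \<in> zeros" unfolding lam_def by (rule inv_into_into[OF e])
  show "nat \<lfloor>lam k\<rfloor> = enumerate zero_floors k"
    unfolding lam_def by (rule f_inv_into_f[OF e])
qed

lemma lam_strict_mono: "strict_mono lam"
proof (rule strict_monoI)
  fix j k :: nat assume "j < k"
  then have "nat \<lfloor>lam j\<rfloor> < nat \<lfloor>lam k\<rfloor>"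
    unfolding lam_floor using enumerate_mono[OF _ infinite_zero_floors] by blast
  then show "lam j < lam k" by linarith
qed

lemma lam_range: "range lam = zeros"
proof
  show "range lam \<subseteq> zeros" using lam_mem by auto
  show "zeros \<subseteq> range lam"
  proof
    fix x assume x: "x \<in> zeros"
    then have "nat \<lfloor>x\<rfloor> \<in> zero_floors" unfolding zero_floors_def by (rule imageI)
    also have "zero_floors = range (enumerate zero_floors)"
      by (rule range_enumerate[OF infinite_zero_floors, symmetric])
    finally obtain k where "nat \<lfloor>x\<rfloor> = enumerate zero_floors k" by (rule rangeE)
    then have "nat \<lfloor>x\<rfloor> = nat \<lfloor>lam k\<rfloor>" by (simp only: lam_floor)
    then have "x = lam k"
      by (rule inj_onD[OF strict_mono_on_imp_inj_on[OF floor_strict_mono_zeros] _ x lam_mem])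
    then show "x \<in> range lam" by simp
  qed
qed

lemma lam_pos: "lam k > 0" using lam_mem[of k] by (simp add: zeros_def)

lemma lam_Suc_ge: "lam (Suc k) \<ge> lam k + 1"
  using zeros_gap[OF lam_mem lam_mem, of k "Suc k"] lam_strict_mono by (auto simp: strict_mono_Suc_iff)

lemma lam_ge: "lam k \<ge> real k"
proof (induction k)
  case 0 then show ?case using lam_pos[of 0] by simp
next
  case (Suc k) then show ?case using lam_Suc_ge[of k] by simp
qed

lemma no_zero_between: "y \<in> zeros \<Longrightarrow> y > lam k \<Longrightarrow> y \<ge> lam (Suc k)"
proof -
  assume "y \<in> zeros" "y > lam k"
  moreover from this(1) obtain j where "y = lam j" unfolding lam_range[symmetric] by (rule rangeE)
  ultimately have "k < j" using strict_mono_less[OF lam_strict_mono] by simp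
  then show "y \<ge> lam (Suc k)"
    using \<open>y = lam j\<close> strict_mono_less_eq[OF lam_strict_mono, of "Suc k" j] by simp
qed

section \<open>Asymptotics of the enumerated zeros\<close>

text \<open>Chosen so that \<open>q x = pi\<^sup>2 * (1 - D / x\<^sup>2)\<close>.\<close>

definition D :: real where "D = (\<nu>\<^sup>2 - 1/4) / pi\<^sup>2"

lemma D_nonneg: "D \<ge> 0" using nu_sq by (simp add: D_def)

text \<open>The next zero lies within \<open>pi / sqrt (q (lam k))\<close>, which is
  \<open>1 / sqrt (1 - t)\<close> for \<open>t = D / (lam k)\<^sup>2\<close>. The second hypothesis
  gives \<open>t \<le> 1/2\<close>, and then \<open>1 + t\<close> is an upper bound.\<close>

lemma lam_Suc_le:
  assumes "real k \<ge> 1" "(real k)\<^sup>2 \<ge> 2 * D"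
  shows "lam (Suc k) \<le> lam k + 1 + D / (real k)\<^sup>2"
proof -
  define t where "t = D / (lam k)\<^sup>2"
  have l: "lam k \<ge> real k" "(lam k)\<^sup>2 \<ge> (real k)\<^sup>2" using lam_ge[of k] by (auto intro: power_mono)
  have pk: "(lam k)\<^sup>2 > 0" using lam_pos[of k] by simp
  have "2 * D \<le> (lam k)\<^sup>2" using l(2) assms(2) by linarith
  then have t: "0 \<le> t" "t \<le> 1/2" using D_nonneg pk by (simp_all add: t_def divide_le_eq)
  have q: "q (lam k) = pi\<^sup>2 * (1 - t)" 
  proof -
    have gen: "p - c / m = p * (1 - c / p / m)" if "p \<noteq> 0" for p c m :: real
      using that by (simp add: right_diff_distrib)
    show ?thesis unfolding q_def t_def D_def by (rule gen) simp
  qed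
  have qpos: "q (lam k) > 0" using t by (simp add: q)
  obtain y where y: "y \<in> zeros" "lam k < y" "y \<le> lam k + pi / sqrt (q (lam k))"
    using zero_in_gap[OF lam_pos qpos] by blast
  \<comment> \<open>The right-hand side is \<open>1 + t * (1 - t - t * t)\<close>.\<close>
  have "1 \<le> (1 + t)\<^sup>2 * (1 - t)"
  proof -
    have "t * (1 - t - t * t) \<ge> 0" using t mult_mono[of t "1/2" t "1/2"] by (intro mult_nonneg_nonneg) auto
    then show ?thesis by (simp add: algebra_simps power2_eq_square)
  qed
  then have "1 \<le> sqrt ((1 + t)\<^sup>2 * (1 - t))" by simp
  also have "\<dots> = (1 + t) * sqrt (1 - t)" using t by (simp add: real_sqrt_mult)
  finally have "1 / sqrt (1 - t) \<le> 1 + t" using t by (simp add: divide_le_eq)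
  then have "pi / sqrt (q (lam k)) \<le> 1 + t" unfolding q by (simp add: real_sqrt_mult)
  moreover have "t \<le> D / (real k)\<^sup>2"
    unfolding t_def using assms(1) by (intro divide_left_mono l D_nonneg mult_pos_pos pk) simp
  ultimately show ?thesis using no_zero_between[OF y(1,2)] y(3) by linarith
qed

lemma lam_asymptotics: "\<exists>\<beta> C. \<forall>k. \<bar>lam k - (real k + \<beta>)\<bar> \<le> C / (real k + 1)"
proof -
  txt \<open>\<open>s k\<close> increases while \<open>s k + D / (k - 1)\<close> decreases, so both converge to the same limit.\<close>
  define s where "s k = lam k - real k" for k
  define k0 where "k0 = nat \<lceil>2 * D\<rceil> + 2"
  have k0: "real k0 \<ge> 2" "real k0 \<ge> 2 * D" unfolding k0_def by linarith+
  have up: "s k \<le> s (Suc k)" for k using lam_Suc_ge[of k] by (simp add: s_def)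
  have down: "s (Suc k) + D / real k \<le> s k + D / (real k - 1)" if k: "k \<ge> k0" for k
  proof -
    have r: "real k \<ge> 2" "real k \<ge> 2 * D" using k k0 by linarith+
    have "2 * D \<le> (real k)\<^sup>2" using r mult_mono[of 1 "real k" "2 * D" "real k"] D_nonneg by (simp add: power2_eq_square)
    then have "s (Suc k) \<le> s k + D / (real k)\<^sup>2" using lam_Suc_le[of k] r by (simp add: s_def)
    moreover have "D / (real k)\<^sup>2 \<le> D / (real k * (real k - 1))"
      using r D_nonneg by (intro divide_left_mono) (auto simp: power2_eq_square)
    moreover have "D / (real k * (real k - 1)) = D / (real k - 1) - D / real k"
      using r by (simp add: field_simps)
    ultimately show ?thesis by linarith
  qed
  have inc: "incseq s" using up by (rule incseq_SucI)
  have dec: "s (k0 + n) + D / (real (k0 + n) - 1) \<le> s (k0 + m) + D / (real (k0 + m) - 1)" if "m \<le> n" for m n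
    using that
  proof (induction rule: dec_induct)
    case (step n)
    then show ?case using down[of "k0 + n"] by simp
  qed simp
  have bound: "s n \<le> s k + D / (real k - 1)" if k: "k \<ge> k0" for n k
  proof (cases "n \<le> k")
    case True
    then have "s n \<le> s k" using inc by (simp add: incseq_def)
    also have "\<dots> \<le> s k + D / (real k - 1)" using k k0 D_nonneg by simp
    finally show ?thesis .
  next
    case False
    have "s n \<le> s n + D / (real n - 1)" using False k k0 D_nonneg by simp
    also have "\<dots> \<le> s k + D / (real k - 1)" using dec[of "k - k0" "n - k0"] False k by simp
    finally show ?thesis .
  qed
  obtain \<beta> where \<beta>: "s \<longlonglongrightarrow> \<beta>" "\<And>n. s n \<le> \<beta>"
    using incseq_convergent[OF inc, of "s k0 + D / (real k0 - 1)"] bound by blast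
  have \<beta>_le: "\<beta> \<le> s k + D / (real k - 1)" if "k \<ge> k0" for k
    using LIMSEQ_le_const2[OF \<beta>(1)] bound[OF that] by blast
  \<comment> \<open>\<open>E\<close> absorbs the finitely many indices below \<open>k0\<close>. For
    the others \<open>k + 1 \<le> 3 * (k - 1)\<close>, whence the constant
    \<open>3 * D\<close>.\<close>
  define E where "E = (\<Sum>k<k0. \<bar>lam k - (real k + \<beta>)\<bar> * (real k + 1))"
  have E: "E \<ge> 0" unfolding E_def by (intro sum_nonneg) auto
  have "\<bar>lam k - (real k + \<beta>)\<bar> \<le> (3 * D + E) / (real k + 1)" for k
  proof (cases "k < k0")
    case True
    then have "\<bar>lam k - (real k + \<beta>)\<bar> * (real k + 1) \<le> E"
      unfolding E_def by (intro member_le_sum) auto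
    then show ?thesis using D_nonneg by (simp add: le_divide_eq)
  next
    case False
    have r: "real k \<ge> 2" using False k0 by linarith
    have "\<bar>lam k - (real k + \<beta>)\<bar> \<le> D / (real k - 1)"
      using \<beta>(2)[of k] \<beta>_le[of k] False by (simp add: s_def abs_le_iff)
    also have "\<dots> = 3 * D / (3 * (real k - 1))"
      by (rule mult_divide_mult_cancel_left[symmetric]) simp
    also have "\<dots> \<le> (3 * D + E) / (real k + 1)"
      using r E D_nonneg by (intro frac_le) auto
    finally show ?thesis .
  qed
  then show ?thesis by blast
qed

end

section \<open>Growth on the imaginary axis\<close>

lemma Gamma_ratio_tendsto:
  fixes z :: real
  assumes "z > 0"
  shows "(\<lambda>n. Gamma (z + real n) / (fact (n - 1) * exp (z * ln (real n)))) \<longlonglongrightarrow> 1"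
proof -
  have z: "z \<notin> \<int>\<^sub>\<le>\<^sub>0" using assms by (auto simp: nonpos_Ints_def)
  have G: "Gamma z > 0" using assms by (rule Gamma_real_pos)
  have "(\<lambda>n. Gamma z / Gamma_series' z n) \<longlonglongrightarrow> Gamma z / Gamma z"
    using G by (intro tendsto_divide tendsto_const Gamma_series'_LIMSEQ) auto
  moreover have "Gamma z / Gamma_series' z n = Gamma (z + real n) / (fact (n - 1) * exp (z * ln (real n)))" for n
    using G by (simp add: Gamma_series'_def pochhammer_Gamma[OF z])
  ultimately show ?thesis using G by simp
qed

lemma Gamma_legendre_duplication_real:
  fixes z :: real
  assumes "z > 0"
  shows "Gamma z * Gamma (z + 1/2) = 2 powr (1 - 2 * z) * sqrt pi * Gamma (2 * z)"
proof -
  have "complex_of_real (Gamma z * Gamma (z + 1/2)) =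
      Gamma (complex_of_real z) * Gamma (complex_of_real z + 1/2)"
    by (simp flip: Gamma_complex_of_real)
  also have "\<dots> = exp ((1 - 2 * complex_of_real z) * of_real (ln 2)) * of_real (sqrt pi) * Gamma (2 * complex_of_real z)"
  proof (rule Gamma_legendre_duplication)
    have "complex_of_real z + 1/2 = of_real (z + 1/2)" by simp
    then show "complex_of_real z \<notin> \<int>\<^sub>\<le>\<^sub>0" "complex_of_real z + 1/2 \<notin> \<int>\<^sub>\<le>\<^sub>0"
      using assms by (auto simp only: of_real_in_nonpos_Ints_iff)
  qed
  also have "\<dots> = complex_of_real (exp ((1 - 2 * z) * ln 2) * sqrt pi * Gamma (2 * z))"
    by (simp flip: Gamma_complex_of_real exp_of_real)
  finally show ?thesis by (simp only: of_real_eq_iff powr_def) simp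
qed

text \<open>Each single term dies out as \<open>x\<close> grows, so the mass of the series moves to
  large \<open>n\<close>, where the weight is close to 1. Nonnegativity of the terms lets the tail
  error be bounded by \<delta> times the full sum.\<close>

lemma weighted_series_tendsto:
  fixes a :: "nat \<Rightarrow> real \<Rightarrow> real" and r :: "nat \<Rightarrow> real"
  assumes nonneg: "\<And>n x. x > 0 \<Longrightarrow> a n x \<ge> 0" and sm: "\<And>x. x > 0 \<Longrightarrow> summable (\<lambda>n. a n x)"
    and r: "r \<longlonglongrightarrow> 1" and lim: "((\<lambda>x. \<Sum>n. a n x) \<longlongrightarrow> L) at_top"
    and null: "\<And>n. (a n \<longlongrightarrow> 0) at_top"
  shows "((\<lambda>x. \<Sum>n. r n * a n x) \<longlongrightarrow> L) at_top"
proof -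
  obtain R where R: "\<And>n. \<bar>r n\<bar> \<le> R"
    using convergent_imp_Bseq[OF convergentI[OF r]] by (auto simp: Bseq_def)
  have sr: "summable (\<lambda>n. r n * a n x)" if "x > 0" for x
  proof (rule summable_comparison_test_ev[OF always_eventually summable_mult[OF sm[OF that], of R]], intro allI)
    show "norm (r n * a n x) \<le> R * a n x" for n
      using mult_right_mono[OF R nonneg[OF that], of n n] nonneg[OF that, of n] by (simp add: abs_mult)
  qed
  have "((\<lambda>x. (\<Sum>n. r n * a n x) - (\<Sum>n. a n x)) \<longlongrightarrow> 0) at_top"
  proof (rule tendstoI)
    fix e :: real assume e: "e > 0"
    define \<delta> where "\<delta> = e / (2 * (\<bar>L\<bar> + 1))"
    have \<delta>: "\<delta> > 0" using e by (simp add: \<delta>_def)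
    have "\<forall>\<^sub>F n in sequentially. dist (r n) 1 < \<delta>" using r \<delta> by (rule tendstoD)
    then obtain N where N: "\<And>n. n \<ge> N \<Longrightarrow> \<bar>r n - 1\<bar> \<le> \<delta>"
      by (force simp: eventually_sequentially dist_real_def)
    have "((\<lambda>x. \<Sum>n<N. \<bar>r n - 1\<bar> * a n x) \<longlongrightarrow> (\<Sum>n<N. \<bar>r n - 1\<bar> * 0)) at_top"
      by (intro tendsto_intros null)
    then have "((\<lambda>x. \<Sum>n<N. \<bar>r n - 1\<bar> * a n x) \<longlongrightarrow> 0) at_top" by simp
    then have "\<forall>\<^sub>F x in at_top. (\<Sum>n<N. \<bar>r n - 1\<bar> * a n x) < e / 2"
      using e by (intro order_tendstoD) auto
    moreover have "\<forall>\<^sub>F x in at_top. (\<Sum>n. a n x) < \<bar>L\<bar> + 1"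
      using lim by (rule order_tendstoD) simp
    ultimately show "\<forall>\<^sub>F x in at_top. dist ((\<Sum>n. r n * a n x) - (\<Sum>n. a n x)) 0 < e"
      using eventually_gt_at_top[of 0]
    proof eventually_elim
      case (elim x)
      define c where "c n = (if n < N then \<bar>r n - 1\<bar> * a n x else 0) + \<delta> * a n x" for n
      have c: "c sums ((\<Sum>n<N. \<bar>r n - 1\<bar> * a n x) + \<delta> * (\<Sum>n. a n x))"
        unfolding c_def
        using sums_If_finite_set[of "{..<N}" "\<lambda>n. \<bar>r n - 1\<bar> * a n x"]
        by (intro sums_add sums_mult summable_sums sm elim) auto
      have d: "(\<lambda>n. r n * a n x - a n x) sums ((\<Sum>n. r n * a n x) - (\<Sum>n. a n x))"
        using sr sm elim by (intro sums_diff summable_sums) auto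
      have le: "\<bar>r n * a n x - a n x\<bar> \<le> c n" for n
      proof -
        have "r n * a n x - a n x = (r n - 1) * a n x" by (simp add: left_diff_distrib)
        then have "\<bar>r n * a n x - a n x\<bar> = \<bar>r n - 1\<bar> * a n x"
          using nonneg[of x n] elim by (simp add: abs_mult)
        also have "\<dots> \<le> c n"
          using N[of n] nonneg[of x n] elim \<delta> by (auto simp: c_def intro: mult_right_mono)
        finally show ?thesis .
      qed
      have "\<bar>(\<Sum>n. r n * a n x) - (\<Sum>n. a n x)\<bar> = norm (\<Sum>n. r n * a n x - a n x)"
        using sums_unique[OF d] by simp
      also have "\<dots> \<le> suminf c"
        using sums_summable[OF c] le by (intro norm_suminf_le) auto
      also have "\<dots> = (\<Sum>n<N. \<bar>r n - 1\<bar> * a n x) + \<delta> * (\<Sum>n. a n x)"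
        using c by (simp add: sums_iff)
      also have "\<dots> < e / 2 + \<delta> * (\<bar>L\<bar> + 1)"
        using elim \<delta> by (intro add_strict_mono mult_strict_left_mono) auto
      also have "\<dots> = e"
      proof -
        have "e / (2 * m) * m = e / 2" if "m \<noteq> 0" for m :: real using that by simp
        from this[of "\<bar>L\<bar> + 1"] show ?thesis unfolding \<delta>_def by linarith
      qed
      finally show ?case by simp
    qed
  qed
  from tendsto_add[OF this lim] show ?thesis by simp
qed

section \<open>A Mittag-Leffler series as a model for the growth of
  \<open>I\<^sub>\<nu>\<close>\<close>

locale mittag_leffler =
  fixes \<mu> :: real
  assumes mu: "\<mu> \<ge> 1"
begin

definition g :: "nat \<Rightarrow> real" where "g n = 1 / Gamma (real n + \<mu> + 1)"

lemma Gamma_Suc: "Gamma (real n + \<mu> + 1) = (real n + \<mu>) * Gamma (real n + \<mu>)"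
  using mu by (intro Gamma_plus1) (auto simp: nonpos_Ints_def)

lemma Gamma_mu_pos: "Gamma \<mu> > 0" and g_pos: "g n > 0"
  using mu by (auto simp: g_def intro!: Gamma_real_pos)

lemma g_Suc: "(real (Suc n) + \<mu>) * g (Suc n) = g n"
  using Gamma_Suc[of "Suc n"] mu by (simp add: g_def add_ac)

lemma entire_g: "entire_coeffs g"
  unfolding entire_coeffs_def
proof
  fix r :: real
  show "summable (\<lambda>n. g n * r ^ n)"
  proof (rule summable_ratio_test[where c = "1/2" and N = "nat \<lceil>2 * \<bar>r\<bar>\<rceil>"])
    fix n assume "n \<ge> nat \<lceil>2 * \<bar>r\<bar>\<rceil>"
    then have n: "2 * \<bar>r\<bar> \<le> real (Suc n) + \<mu>" using mu by linarith
    have "2 * \<bar>r\<bar> * (g (Suc n) * \<bar>r\<bar> ^ n) \<le> (real (Suc n) + \<mu>) * (g (Suc n) * \<bar>r\<bar> ^ n)"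
      using g_pos[of "Suc n"] by (intro mult_right_mono n) simp
    also have "\<dots> = g n * \<bar>r\<bar> ^ n" by (simp only: mult.assoc[symmetric] g_Suc)
    finally show "norm (g (Suc n) * r ^ Suc n) \<le> 1 / 2 * norm (g n * r ^ n)"
      using g_pos[of n] g_pos[of "Suc n"] by (simp add: abs_mult power_abs mult_ac)
  qed simp
qed

text \<open>The Mittag-Leffler function with parameters 1 and \<open>\<mu> + 1\<close>. Unlike the
  Bessel series it satisfies a first-order equation, so its growth can be found by
  integration.\<close>

definition G :: "real \<Rightarrow> real" where "G = powser g"
definition G' :: "real \<Rightarrow> real" where "G' = powser (diffs g)"

lemma G_deriv: "(G has_real_derivative G' x) (at x)"
  unfolding G_def G'_def by (intro powser_has_derivative entire_g)

lemma G_ode: "x * G' x + \<mu> * G x = 1 / Gamma \<mu> + x * G x"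
proof -
  define f where "f n = (real n + \<mu>) * g n * x ^ n" for n
  have "(\<lambda>n. x * (diffs g n * x ^ n)) sums (x * G' x)"
    using sums_mult[OF powser_sums[OF entire_coeffs_diffs[OF entire_g], of x]] by (simp add: G'_def)
  moreover have "x * (diffs g n * x ^ n) = real (Suc n) * g (Suc n) * x ^ Suc n" for n
    by (simp add: diffs_def)
  ultimately have "(\<lambda>n. real (Suc n) * g (Suc n) * x ^ Suc n) sums (x * G' x)" by simp
  then have 1: "(\<lambda>n. real n * g n * x ^ n) sums (x * G' x)"
    using sums_Suc[of "\<lambda>n. real n * g n * x ^ n" "x * G' x"] by simp
  have Gs: "(\<lambda>n. g n * x ^ n) sums G x"
    using powser_sums[OF entire_g, of x] by (simp add: G_def)
  have "f sums (x * G' x + \<mu> * G x)"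
    using sums_add[OF 1 sums_mult[OF Gs, of \<mu>]] by (simp add: f_def[abs_def] algebra_simps)
  moreover have "f sums (x * G x + f 0)"
  proof (rule sums_Suc)
    have "f (Suc n) = x * (g n * x ^ n)" for n
      unfolding f_def g_Suc by simp
    then show "(\<lambda>n. f (Suc n)) sums (x * G x)" using sums_mult[OF Gs, of x] by simp
  qed
  moreover have "f 0 = 1 / Gamma \<mu>" using Gamma_Suc[of 0] mu by (simp add: f_def g_def)
  ultimately show ?thesis using sums_unique2 by fastforce
qed

text \<open>By \<open>G_ode\<close> the derivative of this expression is
  \<open>x powr (\<mu> - 1) * exp (- x) / Gamma \<mu>\<close>. The expression is thus the normalized
  lower incomplete Gamma function, and the limit is Euler's integral.\<close>

lemma G_pos_limit: "((\<lambda>x. exp (- x) * x powr \<mu> * G x) \<longlongrightarrow> 1) at_top"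
proof -
  define h where "h x = exp (- x) * x powr \<mu> * G x" for x
  define k where "k t = t powr (\<mu> - 1) / exp t" for t :: real
  have der: "(h has_real_derivative k x / Gamma \<mu>) (at x)" if x: "x > 0" for x
  proof -
    have P: "((\<lambda>x. x powr \<mu>) has_real_derivative \<mu> * x powr (\<mu> - 1)) (at x)"
      by (rule has_real_derivative_powr[OF x])
    have "(h has_real_derivative (- exp (- x)) * x powr \<mu> * G x + exp (- x) * (\<mu> * x powr (\<mu> - 1)) * G x
        + exp (- x) * x powr \<mu> * G' x) (at x)"
      unfolding h_def[abs_def] by (rule derivative_eq_intros G_deriv P refl | simp add: algebra_simps)+
    also have "x powr \<mu> = x powr (\<mu> - 1) * x"
      using x powr_add[of x "\<mu> - 1" 1] by simp
    also have "(- exp (- x)) * (x powr (\<mu> - 1) * x) * G x + exp (- x) * (\<mu> * x powr (\<mu> - 1)) * G x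
        + exp (- x) * (x powr (\<mu> - 1) * x) * G' x = exp (- x) * x powr (\<mu> - 1) * (x * G' x + \<mu> * G x - x * G x)"
      by (simp add: algebra_simps)
    also have "x * G' x + \<mu> * G x - x * G x = 1 / Gamma \<mu>" unfolding G_ode by simp
    finally show ?thesis by (simp add: k_def exp_minus field_simps)
  qed
  have cont: "continuous_on {0..b} h" for b
    unfolding h_def using mu DERIV_continuous_on[OF has_field_derivative_at_within[OF G_deriv]]
    by (intro continuous_intros continuous_on_powr') auto
  have int: "(k has_integral Gamma \<mu> * h b) {0..b}" if "b \<ge> 0" for b
  proof -
    have "((\<lambda>x. k x / Gamma \<mu>) has_integral (h b - h 0)) {0..b}"
      using der by (intro fundamental_theorem_of_calculus_interior that cont)
        (auto simp: has_real_derivative_iff_has_vector_derivative)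
    from has_integral_mult_right[OF this, of "Gamma \<mu>"] show ?thesis
      using Gamma_mu_pos mu by (simp add: h_def)
  qed
  have tot: "(k has_integral Gamma \<mu>) {0..}"
    unfolding k_def using mu by (intro Gamma_integral_real) simp
  have ai: "set_integrable lebesgue {0..} k"
    by (rule nonnegative_absolutely_integrable_1) (use tot in \<open>auto simp: k_def\<close>)
  have ai': "set_integrable lebesgue {0..b} k" for b
    by (rule set_integrable_subset[OF ai]) auto
  have "((\<lambda>b. set_lebesgue_integral lebesgue {0..b} k) \<longlongrightarrow> set_lebesgue_integral lebesgue {0..} k) at_top"
    by (rule tendsto_set_lebesgue_integral_at_top[OF _ ai]) simp
  then have "((\<lambda>b. integral {0..b} k) \<longlongrightarrow> Gamma \<mu>) at_top"
    using set_lebesgue_integral_eq_integral(2)[OF ai] set_lebesgue_integral_eq_integral(2)[OF ai'] tot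
    by (simp add: integral_unique)
  moreover have "\<forall>\<^sub>F b in at_top. integral {0..b} k = Gamma \<mu> * h b"
    using eventually_ge_at_top[of 0] by eventually_elim (use int in \<open>auto intro: integral_unique\<close>)
  ultimately have "((\<lambda>b. Gamma \<mu> * h b) \<longlongrightarrow> Gamma \<mu>) at_top" using tendsto_cong by force
  from tendsto_divide[OF this tendsto_const[of "Gamma \<mu>"]] show ?thesis
    using Gamma_mu_pos by (simp add: h_def)
qed

text \<open>After multiplication by \<open>exp x\<close>, the quantity in the middle has derivative
  \<open>exp x * x powr (\<mu> - 1) / Gamma \<mu>\<close>; this is nonnegative and, thanks to
  \<open>\<mu> \<ge> 1\<close>, at most the derivative of the right-hand side times
  \<open>exp x\<close>. The polynomial bound makes \<open>G (- x)\<close> negligible beside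
  \<open>G x\<close>.\<close>

lemma G_neg_bounds:
  assumes x: "x > 0"
  shows "0 \<le> x powr \<mu> * G (- x)" "x powr \<mu> * G (- x) \<le> x powr \<mu> / Gamma \<mu>"
proof -
  define h where "h x = exp x * x powr \<mu> * G (- x)" for x
  define e where "e x = exp x * x powr \<mu> / Gamma \<mu>" for x
  have P: "((\<lambda>x. x powr \<mu>) has_real_derivative \<mu> * x powr (\<mu> - 1)) (at x)" if "x > 0" for x
    by (rule has_real_derivative_powr[OF that])
  have pw: "x powr \<mu> = x powr (\<mu> - 1) * x" if "x > 0" for x
    using that powr_add[of x "\<mu> - 1" 1] by simp
  have der: "(h has_real_derivative exp x * x powr (\<mu> - 1) / Gamma \<mu>) (at x)" if x: "x > 0" for x
  proof -
    have "(h has_real_derivative exp x * x powr \<mu> * G (-x) + exp x * (\<mu> * x powr (\<mu> - 1)) * G (-x)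
        + exp x * x powr \<mu> * (G' (-x) * (-1))) (at x)"
      unfolding h_def[abs_def]
      by (rule derivative_eq_intros DERIV_chain2[OF G_deriv] P[OF x] refl | simp add: algebra_simps)+
    also have "exp x * x powr \<mu> * G (-x) + exp x * (\<mu> * x powr (\<mu> - 1)) * G (-x) + exp x * x powr \<mu> * (G' (-x) * (-1))
       = exp x * x powr (\<mu> - 1) * ((- x) * G' (-x) + \<mu> * G (-x) - (-x) * G (-x))"
      unfolding pw[OF x] by (simp add: algebra_simps)
    also have "(- x) * G' (-x) + \<mu> * G (-x) - (-x) * G (-x) = 1 / Gamma \<mu>" unfolding G_ode by simp
    finally show ?thesis by simp
  qed
  have dere: "(e has_real_derivative exp x * x powr (\<mu> - 1) / Gamma \<mu> * (x + \<mu>)) (at x)" if x: "x > 0" for x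
  proof -
    have "(e has_real_derivative (exp x * x powr \<mu> + exp x * (\<mu> * x powr (\<mu> - 1))) / Gamma \<mu>) (at x)"
      unfolding e_def[abs_def]
      using DERIV_cdivide[OF DERIV_mult[OF DERIV_exp P[OF x]], of "Gamma \<mu>"] by (simp add: mult_ac)
    then show ?thesis unfolding pw[OF x] by (simp add: algebra_simps)
  qed
  have conth: "continuous_on {0..x} h" and conte: "continuous_on {0..x} e"
    unfolding h_def e_def using mu less_imp_neq[OF Gamma_mu_pos, symmetric]
    by (auto intro!: continuous_intros continuous_on_powr' continuous_on_compose2[OF DERIV_continuous_on[OF has_field_derivative_at_within[OF G_deriv]]])
  have "h 0 \<le> h x"
  proof (rule DERIV_nonneg_imp_increasing_open[where f = h, OF _ _ conth])
    fix t assume "0 < t" "t < x"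
    then show "\<exists>y. DERIV h t :> y \<and> y \<ge> 0"
      using der[of t] Gamma_mu_pos by (intro exI[of _ "exp t * t powr (\<mu> - 1) / Gamma \<mu>"]) auto
  qed (use x in simp)
  then have "exp x * 0 \<le> exp x * (x powr \<mu> * G (- x))" using mu by (simp add: h_def mult.assoc)
  then show "0 \<le> x powr \<mu> * G (- x)" by (rule mult_le_cancel_left_pos[OF exp_gt_zero, THEN iffD1])
  have "e 0 - h 0 \<le> e x - h x"
  proof (rule DERIV_nonneg_imp_increasing_open[where f = "\<lambda>x. e x - h x"])
    fix t assume t: "0 < t" "t < x"
    have "exp t * t powr (\<mu> - 1) / Gamma \<mu> * (t + \<mu>) - exp t * t powr (\<mu> - 1) / Gamma \<mu> =
        exp t * t powr (\<mu> - 1) / Gamma \<mu> * (t + \<mu> - 1)" by (simp only: right_diff_distrib mult_1_right)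
    also have "\<dots> \<ge> 0" using t mu Gamma_mu_pos by (intro mult_nonneg_nonneg divide_nonneg_pos) auto
    finally show "\<exists>y. DERIV (\<lambda>x. e x - h x) t :> y \<and> y \<ge> 0"
      using DERIV_diff[OF dere[OF t(1)] der[OF t(1)]] by blast
  qed (use x in \<open>auto intro: continuous_intros conte conth\<close>)
  then have "exp x * (x powr \<mu> * G (- x)) \<le> exp x * (x powr \<mu> / Gamma \<mu>)"
    using mu by (simp add: e_def h_def mult.assoc)
  then show "x powr \<mu> * G (- x) \<le> x powr \<mu> / Gamma \<mu>"
    by (rule mult_le_cancel_left_pos[OF exp_gt_zero, THEN iffD1])
qed

text \<open>The even terms of \<open>G\<close>, normalized by
  \<open>exp (- x) * x powr \<mu>\<close>. Being half of \<open>G x + G (- x)\<close>, they sum to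
  1/2 in the limit.\<close>

definition summand :: "nat \<Rightarrow> real \<Rightarrow> real" where
  "summand n x = exp (- x) * (x powr \<mu> * x ^ (2 * n) / Gamma (2 * real n + \<mu> + 1))"

lemma summand_sums: "(\<lambda>n. summand n x) sums (exp (- x) * (x powr \<mu> * (G x + G (- x)) / 2))"
proof -
  have "(\<lambda>m. g m * x ^ m + g m * (- x) ^ m) sums (G x + G (- x))"
    using sums_add[OF powser_sums[OF entire_g, of x] powser_sums[OF entire_g, of "- x"]] by (simp add: G_def)
  then have "(\<lambda>n. g (2 * n) * x ^ (2 * n) + g (2 * n) * (- x) ^ (2 * n)) sums (G x + G (- x))"
  proof (subst sums_mono_reindex[where g = "\<lambda>n. 2 * n" and f = "\<lambda>m. g m * x ^ m + g m * (- x) ^ m"])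
    fix n :: nat assume "n \<notin> range (\<lambda>n. 2 * n)"
    then have "odd n" by (auto elim!: evenE)
    then show "g n * x ^ n + g n * (- x) ^ n = 0" by simp
  qed (auto simp: strict_mono_def)
  from sums_mult[OF this, of "exp (- x) * (x powr \<mu> / 2)"]
  show ?thesis by (simp add: summand_def g_def algebra_simps)
qed

lemma summand_suminf_tendsto: "((\<lambda>x. \<Sum>n. summand n x) \<longlongrightarrow> 1 / 2) at_top"
proof -
  have "((\<lambda>x. exp (- x) * (x powr \<mu> * G (- x))) \<longlongrightarrow> 0) at_top"
  proof (rule tendsto_sandwich)
    show "\<forall>\<^sub>F x in at_top. 0 \<le> exp (- x) * (x powr \<mu> * G (- x))"
      using eventually_gt_at_top[of 0] by eventually_elim (use G_neg_bounds in auto)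
    show "\<forall>\<^sub>F x in at_top. exp (- x) * (x powr \<mu> * G (- x)) \<le> exp (- x) * (x powr \<mu> / Gamma \<mu>)"
      using eventually_gt_at_top[of 0]
      by eventually_elim (intro mult_left_mono G_neg_bounds, auto)
    have "((\<lambda>x. exp (- x) * (x powr \<mu> / c)) \<longlongrightarrow> 0) at_top" if "c > 0" for c :: real
      using that mu by real_asymp
    from this[OF Gamma_mu_pos] show "((\<lambda>x. exp (- x) * (x powr \<mu> / Gamma \<mu>)) \<longlongrightarrow> 0) at_top" .
  qed simp
  from tendsto_divide[OF tendsto_add[OF G_pos_limit this] tendsto_const[of 2]]
  have "((\<lambda>x. (exp (- x) * x powr \<mu> * G x + exp (- x) * (x powr \<mu> * G (- x))) / 2) \<longlongrightarrow> 1 / 2) at_top" by simp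
  moreover have "(exp (- x) * x powr \<mu> * G x + exp (- x) * (x powr \<mu> * G (- x))) / 2 = (\<Sum>n. summand n x)" for x
    unfolding sums_unique[OF summand_sums, symmetric] by (simp add: distrib_left mult.assoc)
  ultimately show ?thesis by simp
qed

end

section \<open>Growth of the Bessel series on the imaginary axis\<close>

context bessel
begin

text \<open>The leading asymptotics \<open>exp x / sqrt (2 * pi * x)\<close> of
  \<open>I\<^sub>\<nu>\<close> at \<open>x = pi * y\<close>. By Legendre duplication each term of
  the series is a constant times the even Mittag-Leffler term with
  \<open>\<mu> = \<nu> + 1/2\<close> times a weight \<open>r n\<close>. The weight tends to 1
  because the shifts in its numerator and denominator have the same sum
  \<open>\<nu> + 2\<close>.\<close>

lemma \<Phi>_neg_asymptotics:
  "((\<lambda>y. y powr (\<nu> + 1/2) * exp (- (pi * y)) * \<Phi> (- (y\<^sup>2))) \<longlongrightarrow> 1 / (pi * sqrt 2)) at_top"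
proof -
  interpret ml: mittag_leffler "\<nu> + 1/2" by unfold_locales (use nu in simp)
  define r where "r n = Gamma (\<nu>/2 + 3/4 + real n) * Gamma (\<nu>/2 + 5/4 + real n) / (Gamma (1 + real n) * Gamma (\<nu> + 1 + real n))" for n
  have r: "r \<longlonglongrightarrow> 1"
  proof -
    define q where "q z n = Gamma (z + real n) / (fact (n - 1) * exp (z * ln (real n)))" for z n
    have "(\<lambda>n. q (\<nu>/2 + 3/4) n * q (\<nu>/2 + 5/4) n / (q 1 n * q (\<nu> + 1) n)) \<longlonglongrightarrow> 1 * 1 / (1 * 1)"
      unfolding q_def using nu by (intro tendsto_intros Gamma_ratio_tendsto) auto
    moreover have "q (\<nu>/2 + 3/4) n * q (\<nu>/2 + 5/4) n / (q 1 n * q (\<nu> + 1) n) = r n" for n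
    proof -
      have "exp ((\<nu>/2 + 3/4) * ln (real n)) * exp ((\<nu>/2 + 5/4) * ln (real n)) = exp (1 * ln (real n)) * exp ((\<nu> + 1) * ln (real n))"
        unfolding exp_add[symmetric] by (simp add: algebra_simps)
      moreover have "(a / (f * e1)) * (b / (f * e2)) / ((c / (f * e3)) * (d / (f * e4))) = a * b / (c * d)"
        if "e1 * e2 = e3 * e4" "e1 \<noteq> 0" "e2 \<noteq> 0" "e3 \<noteq> 0" "e4 \<noteq> 0" "f \<noteq> 0" for a b c d e1 e2 e3 e4 f :: real
      proof -
        have "(a / (f * e1)) * (b / (f * e2)) / ((c / (f * e3)) * (d / (f * e4))) = (a * b / (c * d)) * ((e3 * e4) / (e1 * e2))"
          using that(2-) by (simp add: ac_simps)
        then show ?thesis using that by simp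
      qed
      ultimately show ?thesis unfolding q_def r_def by simp
    qed
    ultimately show ?thesis by simp
  qed
  have "((\<lambda>x. \<Sum>n. r n * ml.summand n x) \<longlongrightarrow> 1 / 2) at_top"
  proof (rule weighted_series_tendsto[OF _ _ r ml.summand_suminf_tendsto])
    show "0 \<le> ml.summand n x" if "x > 0" for n x
      unfolding ml.summand_def using that nu by (intro mult_nonneg_nonneg divide_nonneg_pos Gamma_real_pos) auto
    show "summable (\<lambda>n. ml.summand n x)" for x using ml.summand_sums by (rule sums_summable)
    show "(ml.summand n \<longlongrightarrow> 0) at_top" for n
    proof -
      have "((\<lambda>x. exp (- x) * (x powr (\<nu> + 1/2) * x ^ (2 * n) / c)) \<longlongrightarrow> 0) at_top" if "c > 0" for c :: real
        using that nu by real_asymp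
      then show ?thesis unfolding ml.summand_def using nu by (simp add: Gamma_real_pos)
    qed
  qed
  then have lim: "((\<lambda>y. \<Sum>n. r n * ml.summand n (pi * y)) \<longlongrightarrow> 1 / 2) at_top"
    by (rule filterlim_compose) real_asymp
  have e: "sqrt 2 / pi * (1 / 2) = 1 / (pi * sqrt 2)" by (simp add: field_simps)
  from tendsto_mult[OF tendsto_const[of "sqrt 2 / pi"] lim, unfolded e]
  have "((\<lambda>y. sqrt 2 / pi * (\<Sum>n. r n * ml.summand n (pi * y))) \<longlongrightarrow> 1 / (pi * sqrt 2)) at_top" .
  moreover have "\<forall>\<^sub>F y in at_top. sqrt 2 / pi * (\<Sum>n. r n * ml.summand n (pi * y)) = y powr (\<nu> + 1/2) * exp (- (pi * y)) * \<Phi> (- (y\<^sup>2))"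
    using eventually_gt_at_top[of 0]
  proof eventually_elim
    case (elim y)
    have "(\<lambda>n. y powr (\<nu> + 1/2) * exp (- (pi * y)) * (b n * (- (y\<^sup>2)) ^ n)) sums (y powr (\<nu> + 1/2) * exp (- (pi * y)) * \<Phi> (- (y\<^sup>2)))"
      using powser_sums[OF entire_b, of "- (y\<^sup>2)"] by (intro sums_mult) (simp add: \<Phi>_def)
    moreover have "y powr (\<nu> + 1/2) * exp (- (pi * y)) * (b n * (- (y\<^sup>2)) ^ n) = sqrt 2 / pi * (r n * ml.summand n (pi * y))" for n
    proof -
      \<comment> \<open>Duplication at this \<open>z\<close> produces the Gamma value in the
        denominator of \<open>ml.summand n\<close>, since
        \<open>2 * z = 2 * n + \<mu> + 1\<close>.\<close>
      define z where "z = real n + \<nu>/2 + 3/4"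
      have "Gamma z * Gamma (z + 1/2) = 2 powr (1 - 2 * z) * sqrt pi * Gamma (2 * z)"
        using nu by (intro Gamma_legendre_duplication_real) (simp add: z_def)
      moreover have "z + 1/2 = \<nu>/2 + 5/4 + real n" "z = \<nu>/2 + 3/4 + real n" "2 * z = 2 * real n + (\<nu> + 1/2) + 1"
        "1 - 2 * z = - (2 * real n + \<nu> + 1/2)"
        by (simp_all add: z_def)
      ultimately have G: "Gamma (\<nu>/2 + 3/4 + real n) * Gamma (\<nu>/2 + 5/4 + real n) =
          2 powr (- (2 * real n + \<nu> + 1/2)) * sqrt pi * Gamma (2 * real n + (\<nu> + 1/2) + 1)" by metis
      have pos: "Gamma (2 * real n + (\<nu> + 1/2) + 1) > 0" using nu by (intro Gamma_real_pos) auto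
      have "(-1) ^ n * (- (y\<^sup>2)) ^ n = y ^ (2 * n)"
        by (simp flip: power_mult_distrib) (simp add: power_mult)
      then have "y powr (\<nu> + 1/2) * exp (- (pi * y)) * (b n * (- (y\<^sup>2)) ^ n) =
         exp (- (pi * y)) * (y powr (\<nu> + 1/2) * y ^ (2 * n) * (pi / 2) powr (2 * real n + \<nu>)) / (fact n * Gamma (real n + \<nu> + 1))"
        unfolding b_def by (simp add: mult_ac)
      also have "y powr (\<nu> + 1/2) * y ^ (2 * n) * (pi / 2) powr (2 * real n + \<nu>) =
          sqrt 2 / pi * ((pi * y) powr (\<nu> + 1/2) * (pi * y) ^ (2 * n) * (2 powr (- (2 * real n + \<nu> + 1/2)) * sqrt pi))"
      proof -
        have e1: "y ^ (2 * n) = y powr (2 * real n)" "(pi * y) ^ (2 * n) = (pi * y) powr (2 * real n)"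
          using elim powr_realpow[of y "2 * n"] powr_realpow[of "pi * y" "2 * n"] by simp_all
        have e2: "sqrt 2 = 2 powr (1/2)" "sqrt pi = pi powr (1/2)" by (simp_all add: powr_half_sqrt)
        have e3: "1 / pi = pi powr (-1)" by (simp add: powr_minus_divide)
        have e4: "(pi / 2) powr (2 * real n + \<nu>) = pi powr (2 * real n + \<nu>) * 2 powr (- (2 * real n + \<nu>))"
          unfolding powr_minus_divide by (simp add: powr_divide)
        have "sqrt 2 / pi * ((pi * y) powr (\<nu> + 1/2) * (pi * y) ^ (2 * n) * (2 powr (- (2 * real n + \<nu> + 1/2)) * sqrt pi))
          = (y powr (\<nu> + 1/2) * y powr (2 * real n)) * (pi powr (-1) * pi powr (\<nu> + 1/2) * pi powr (2 * real n) * pi powr (1/2))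
             * (2 powr (1/2) * 2 powr (- (2 * real n + \<nu> + 1/2)))"
          unfolding e1 e2 e3[symmetric] using elim by (simp add: powr_mult mult_ac)
        also have "pi powr (-1) * pi powr (\<nu> + 1/2) * pi powr (2 * real n) * pi powr (1/2) = pi powr (2 * real n + \<nu>)"
          unfolding powr_add[symmetric] by (simp add: algebra_simps)
        also have "2 powr (1/2) * 2 powr (- (2 * real n + \<nu> + 1/2)) = (2::real) powr (- (2 * real n + \<nu>))"
          unfolding powr_add[symmetric] by simp
        finally show ?thesis unfolding e1 e4 by (simp add: mult_ac)
      qed
      also have "exp (- (pi * y)) * (sqrt 2 / pi * ((pi * y) powr (\<nu> + 1/2) * (pi * y) ^ (2 * n) * (2 powr (- (2 * real n + \<nu> + 1/2)) * sqrt pi))) / (fact n * Gamma (real n + \<nu> + 1))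
        = sqrt 2 / pi * (r n * ml.summand n (pi * y))"
        unfolding r_def G ml.summand_def Gamma_fact[symmetric] using pos by (simp add: add_ac mult_ac)
      finally show ?thesis .
    qed
    ultimately have "(\<lambda>n. sqrt 2 / pi * (r n * ml.summand n (pi * y))) sums (y powr (\<nu> + 1/2) * exp (- (pi * y)) * \<Phi> (- (y\<^sup>2)))" by simp
    then have "(\<lambda>n. r n * ml.summand n (pi * y)) sums (y powr (\<nu> + 1/2) * exp (- (pi * y)) * \<Phi> (- (y\<^sup>2)) / (sqrt 2 / pi))"
      using sums_divide[of "\<lambda>n. sqrt 2 / pi * (r n * ml.summand n (pi * y))" _ "sqrt 2 / pi"] by simp
    then show ?case by (simp add: sums_iff)
  qed
  ultimately show ?thesis using tendsto_cong by force
qed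

end

section \<open>The product formula\<close>

text \<open>A Borel--Caratheodory estimate, obtained by applying the Schwarz lemma to \<open>u / (2 A - u)\<close>.\<close>

lemma entire_constant_of_Re_le:
  assumes g: "g holomorphic_on UNIV"
    and bound: "\<And>\<epsilon> r0. \<epsilon> > 0 \<Longrightarrow> \<exists>r\<ge>r0. \<forall>z. norm z = r \<longrightarrow> Re (g z) \<le> \<epsilon> * r"
  shows "g z = g 0"
proof -
  have small: "norm (g z - g 0) \<le> \<epsilon> * (12 * norm z)" if \<epsilon>: "\<epsilon> > 0" for \<epsilon>
  proof -
    obtain r where r: "r \<ge> max (2 * norm z + 1) (\<bar>Re (g 0)\<bar> / \<epsilon>)"
      "\<And>z. norm z = r \<Longrightarrow> Re (g z) \<le> \<epsilon> * r"
      using bound[OF \<epsilon>] by blast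
    have r0: "r > 0" "2 * norm z < r" using r(1) norm_ge_zero[of z] by linarith+
    have "\<bar>Re (g 0)\<bar> \<le> \<epsilon> * r" using r(1) \<epsilon> by (simp add: divide_le_eq mult.commute)
    define u where "u w = g w - g 0" for w
    have hu: "u holomorphic_on S" for S
      unfolding u_def using g by (intro holomorphic_intros) (auto intro: holomorphic_on_subset)
    have u_le: "Re (u w) \<le> 2 * (\<epsilon> * r)" if "norm w \<le> r" for w
    proof (rule maximum_real_frontier[of u "cball 0 r"])
      fix w :: complex assume "w \<in> frontier (cball 0 r)"
      then have "norm w = r" using r0 by (simp add: frontier_cball)
      then show "Re (u w) \<le> 2 * (\<epsilon> * r)" using r(2)[of w] \<open>\<bar>Re (g 0)\<bar> \<le> \<epsilon> * r\<close> by (simp add: u_def)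
    qed (use hu that in \<open>auto intro!: holomorphic_on_imp_continuous_on\<close>)
    \<comment> \<open>Slightly more than the bound \<open>2 * (\<epsilon> * r)\<close>, so that
      \<open>u\<close> maps the disc strictly into the half-plane Re < A, which w / (2 A - w) sends
      into the unit disc.\<close>
    define A where "A = 3 * (\<epsilon> * r)"
    have lt: "Re (u w) < A" if "norm w \<le> r" for w
      using u_le[OF that] \<epsilon> r0 by (simp add: A_def) (smt (verit) mult_pos_pos)
    have nz: "2 * A - u w \<noteq> 0" if "norm w \<le> r" for w
    proof
      assume "2 * A - u w = 0"
      then have "u w = of_real (2 * A)" by simp
      then have "Re (u w) = 2 * A" by simp
      moreover have "A > 0" using \<epsilon> r0 by (simp add: A_def)
      ultimately show False using lt[OF that] by simp
    qed
    define \<phi> where "\<phi> \<zeta> = u (of_real r * \<zeta>) / (2 * A - u (of_real r * \<zeta>))" for \<zeta>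
    have in_ball: "norm (of_real r * \<zeta>) \<le> r" if "norm \<zeta> < 1" for \<zeta> :: complex
      using that r0 by (simp add: norm_mult)
    have "norm (\<phi> (z / of_real r)) \<le> norm (z / of_real r)"
    proof (rule Schwarz_Lemma(1))
      have "(\<lambda>\<zeta>. u (of_real r * \<zeta>)) holomorphic_on ball 0 1"
        by (rule holomorphic_on_compose_gen[OF _ hu[of UNIV], unfolded o_def]) (auto intro: holomorphic_intros)
      then show "\<phi> holomorphic_on ball 0 1"
        unfolding \<phi>_def using nz in_ball by (intro holomorphic_intros) auto
      show "\<phi> 0 = 0" by (simp add: \<phi>_def u_def)
      show "norm (z / of_real r) < 1" using r0 by (simp add: norm_divide)
      fix \<zeta> :: complex assume \<zeta>: "norm \<zeta> < 1"
      define w where "w = u (of_real r * \<zeta>)"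
      have "Re w < A" "A > 0" using lt[OF in_ball[OF \<zeta>]] \<epsilon> r0 by (simp_all add: w_def A_def)
      have "(norm w)\<^sup>2 < (norm (2 * A - w))\<^sup>2"
      proof -
        have "A * Re w < A * A" using \<open>Re w < A\<close> \<open>A > 0\<close> by (rule mult_strict_left_mono)
        then show ?thesis unfolding cmod_power2 by (simp add: power2_eq_square algebra_simps)
      qed
      then have "norm w < norm (2 * A - w)" using power2_less_imp_less norm_ge_zero by blast
      then show "norm (\<phi> \<zeta>) < 1" unfolding \<phi>_def w_def[symmetric] norm_divide by (simp add: divide_less_eq)
    qed
    then have "norm (u z / (2 * A - u z)) \<le> norm z / r" using r0 by (simp add: \<phi>_def norm_divide)
    moreover have "norm (2 * A - u z) > 0" using nz[of z] r0 norm_ge_zero[of z] by simp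
    ultimately have "norm (u z) \<le> norm z / r * norm (2 * A - u z)" by (simp add: norm_divide divide_le_eq)
    also have "\<dots> \<le> norm z / r * (2 * A + norm (u z))"
    proof (rule mult_left_mono)
      have "norm (2 * complex_of_real A) = 2 * A" using \<epsilon> r0 by (simp add: norm_mult A_def)
      then show "norm (2 * A - u z) \<le> 2 * A + norm (u z)"
        using norm_triangle_ineq4[of "2 * complex_of_real A" "u z"] by simp
    qed (use r0 in simp)
    also have "\<dots> = 6 * \<epsilon> * norm z + (norm z / r) * norm (u z)"
      using r0 by (simp add: A_def field_simps)
    also have "(norm z / r) * norm (u z) \<le> 1/2 * norm (u z)"
      using r0 by (intro mult_right_mono) (auto simp: divide_le_eq)
    finally show ?thesis by (simp add: u_def)
  qed
  have "norm (g z - g 0) \<le> 0"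
  proof (rule tendsto_lowerbound)
    show "((\<lambda>\<epsilon>. \<epsilon> * (12 * norm z)) \<longlongrightarrow> 0) (at_right 0)"
      by (rule tendsto_eq_intros refl tendsto_ident_at | simp)+
    show "\<forall>\<^sub>F \<epsilon> in at_right 0. norm (g z - g 0) \<le> \<epsilon> * (12 * norm z)"
      using small by (auto simp: eventually_at_filter)
  qed simp
  then show ?thesis by simp
qed

section \<open>The canonical product over the squared zeros\<close>

context bessel
begin

lemma zero_imp_lam:
  assumes "\<Phi> z = (0::complex)"
  shows "\<exists>n. z = of_real ((lam n)\<^sup>2)"
proof -
  have z: "z = of_real (Re z)" "Re z > 0" using \<Phi>_zero_real[OF assms] by (auto simp: complex_eq_iff)
  have "\<Phi> (complex_of_real (Re z)) = 0" using assms z(1) by simp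
  then have "\<Phi> (Re z) = 0" by (simp only: \<Phi>_of_real of_real_eq_0_iff)
  then have "sqrt (Re z) \<in> zeros" using z(2) by (simp add: zeros_def u_zero_iff)
  then obtain n where "sqrt (Re z) = lam n" unfolding lam_range[symmetric] by (rule rangeE)
  then have "Re z = (lam n)\<^sup>2" using z(2) by (metis less_imp_le real_sqrt_pow2)
  then show ?thesis using z(1) by (intro exI[of _ n]) simp
qed

lemma lam_zero: "\<Phi> (complex_of_real ((lam n)\<^sup>2)) = 0"
  using lam_mem[of n] lam_pos[of n] by (simp only: \<Phi>_of_real zeros_def mem_Collect_eq u_zero_iff of_real_0)

lemma lam_at_top: "filterlim lam at_top sequentially"
  by (rule filterlim_at_top_mono[OF filterlim_real_sequentially]) (simp add: lam_ge)

lemma summable_inverse_lam_sq: "summable (\<lambda>n. 1 / (lam n)\<^sup>2)"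
proof (rule summable_comparison_test_ev)
  show "summable (\<lambda>n. 1 / real n ^ 2)" using inverse_power_summable[of 2, where ?'a = real] by (simp add: divide_inverse)
  show "\<forall>\<^sub>F n in sequentially. norm (1 / (lam n)\<^sup>2) \<le> 1 / real n ^ 2"
    using eventually_gt_at_top[of 0]
  proof eventually_elim
    case (elim n)
    then have "1 / (lam n)\<^sup>2 \<le> 1 / real n ^ 2"
      using power_mono[OF lam_ge[of n], of 2] lam_pos[of n] by (intro divide_left_mono) auto
    then show ?case by simp
  qed
qed

text \<open>Since \<open>lam n \<ge> n\<close>, the reciprocals of the squared zeros are summable,
  and in the variable \<open>w\<^sup>2\<close> no exponential convergence factors are
  needed.\<close>

sublocale wp: weierstrass_product "\<lambda>n. of_real ((lam n)\<^sup>2)" "\<lambda>_. 0"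
proof
  show "complex_of_real ((lam n)\<^sup>2) \<noteq> 0" for n using lam_pos[of n] by simp
  have "filterlim (\<lambda>n. (lam n)\<^sup>2) at_top sequentially"
    by (rule filterlim_pow_at_top[OF _ lam_at_top]) simp
  then show "filterlim (\<lambda>n. complex_of_real ((lam n)\<^sup>2)) at_infinity sequentially"
    by (intro filterlim_norm_at_top_imp_at_infinity) (simp add: norm_power)
  show "summable (\<lambda>n. (r / norm (complex_of_real ((lam n)\<^sup>2))) ^ Suc 0)" for r
    using summable_mult[OF summable_inverse_lam_sq, of r] by (simp add: norm_power)
qed

lemma wp_has_prod: "(\<lambda>n. 1 - z / of_real ((lam n)\<^sup>2)) has_prod wp.f z"
  using wp.has_prod[of z] by (simp add: weierstrass_factor_def)

lemma \<Phi>_holomorphic: "(\<Phi> :: complex \<Rightarrow> complex) holomorphic_on S"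
  using \<Phi>_deriv by (meson field_differentiable_at_within field_differentiable_def holomorphic_on_def)

text \<open>Both functions have exactly the zeros \<open>(lam n)\<^sup>2\<close>, all simple: for
  \<open>\<Phi>\<close> by \<open>\<Phi>_zero_simple\<close>, for the product because the
  \<open>lam n\<close> are distinct.\<close>

lemma quotient_exists:
  obtains h where "h holomorphic_on UNIV" "\<And>z. h z \<noteq> 0" "\<And>z. \<Phi> z = h z * wp.f z"
proof (rule holomorphic_zorder_factorization[of \<Phi> UNIV wp.f])
  show "wp.f z = 0 \<longleftrightarrow> \<Phi> z = 0" for z
    unfolding wp.zero using zero_imp_lam[of z] lam_zero by auto
  show "zorder wp.f z = zorder \<Phi> z" for z
  proof (cases "\<Phi> z = 0")
    case False
    then have "zorder \<Phi> z = 0"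
      using \<Phi>_holomorphic by (intro zorder_eq_0I) (auto simp: analytic_at)
    moreover have "(\<lambda>n. complex_of_real ((lam n)\<^sup>2)) -` {z} = {}" using False lam_zero by auto
    ultimately show ?thesis unfolding wp.zorder by simp
  next
    case True
    then obtain m where m: "z = of_real ((lam m)\<^sup>2)" using zero_imp_lam by blast
    have "n = m" if "(lam n)\<^sup>2 = (lam m)\<^sup>2" for n
      using that lam_pos[of n] lam_pos[of m] lam_strict_mono by (simp add: strict_mono_eq)
    then have "(\<lambda>n. complex_of_real ((lam n)\<^sup>2)) -` {z} = {m}" unfolding m by (auto simp only: of_real_eq_iff vimage_def)
    moreover have "zorder \<Phi> z = 1"
    proof (rule zorder_zero_eqI[of \<Phi> UNIV])
      show "(deriv ^^ nat 1) \<Phi> z \<noteq> 0"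
        using DERIV_imp_deriv[OF \<Phi>_deriv, of z] \<Phi>_zero_simple[OF True] by simp
    qed (use True in \<open>auto intro: \<Phi>_holomorphic\<close>)
    ultimately show ?thesis unfolding wp.zorder by simp
  qed
  show "wp.f holomorphic_on UNIV" by (rule wp.holomorphic)
  show "connected (UNIV :: complex set)" by (rule connected_UNIV)
qed (use that in \<open>simp_all add: \<Phi>_holomorphic\<close>)

lemma norm_\<Phi>_le: "norm (\<Phi> (z::complex)) \<le> \<Phi> (- norm z)"
proof -
  have e: "b n * (- r) ^ n = \<bar>b n\<bar> * r ^ n" for n r
    by (subst power_minus) (simp add: abs_b)
  have s: "(\<lambda>n. \<bar>b n\<bar> * norm z ^ n) sums \<Phi> (- norm z)"
    using powser_sums[OF entire_b, of "- norm z"] by (simp add: \<Phi>_def e)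
  have "norm (\<Phi> z) \<le> (\<Sum>n. \<bar>b n\<bar> * norm z ^ n)"
    unfolding \<Phi>_def powser_def using s by (intro norm_suminf_le) (auto simp: norm_mult norm_power sums_iff)
  then show ?thesis using s by (simp add: sums_iff)
qed

lemma sum_inverse_squares_le:
  assumes "M \<ge> 1"
  shows "(\<Sum>n=M..<M+k. 1 / (real n)\<^sup>2) \<le> 2 / real M - 2 / real (M + k)"
proof (induction k)
  case (Suc k)
  have p: "real (M + k) \<ge> 1" using assms by simp
  have "1 / (real (M + k))\<^sup>2 \<le> 2 / (real (M + k) * (real (M + k) + 1))"
    using p by (simp add: divide_simps power2_eq_square)
  also have "\<dots> = 2 / real (M + k) - 2 / real (M + Suc k)"
    using p by (simp add: field_simps)
  finally show ?case using Suc.IH by simp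
qed simp

text \<open>The radius keeps distance 1/2 from every \<open>lam n\<close>. The first
  \<open>M\<close>, at most \<open>2 * R + 1\<close>, factors are each at least
  \<open>1 / (4 * R)\<close>; the others are at least
  \<open>exp (- 2 * R\<^sup>2 / n\<^sup>2)\<close> and together at least
  \<open>exp (- 2 * R)\<close>. The loss in the exponent is of order R ln R, which is small against
  \<open>norm z = R\<^sup>2\<close>.\<close>

lemma wp_lower_bound:
  fixes z :: complex
  assumes R: "R \<ge> 1" "norm z = R\<^sup>2" and sep: "\<And>n. \<bar>lam n - R\<bar> \<ge> 1/2"
  shows "norm (wp.f z) \<ge> exp (- ((2 * R + 1) * ln (4 * R) + 2 * R))"
proof -
  define M where "M = nat \<lceil>2 * R\<rceil>"
  have M: "real M \<ge> 2 * R" "real M \<le> 2 * R + 1" "M \<ge> 1" using R unfolding M_def by linarith+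
  define F where "F n = \<bar>1 - R\<^sup>2 / (lam n)\<^sup>2\<bar>" for n
  have F_le: "norm (1 - z / of_real ((lam n)\<^sup>2)) \<ge> F n" for n
    using norm_triangle_ineq3[of 1 "z / of_real ((lam n)\<^sup>2)"] R by (simp add: F_def norm_divide norm_power)
  have F_eq: "F n = \<bar>lam n - R\<bar> / lam n * ((lam n + R) / lam n)" for n
  proof -
    have "1 - R\<^sup>2 / (lam n)\<^sup>2 = (lam n - R) / lam n * ((lam n + R) / lam n)"
      using lam_pos[of n] by (simp add: field_simps power2_eq_square)
    then show ?thesis using lam_pos[of n] R by (simp add: F_def abs_mult)
  qed
  have F_small: "F n \<ge> 1 / (4 * R)" for n
  proof -
    have "\<bar>lam n - R\<bar> / lam n \<ge> 1 / (4 * R)"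
    proof (cases "lam n \<le> 2 * R")
      case True
      have "1 / (4 * R) = (1/2) / (2 * R)" by simp
      also have "\<dots> \<le> \<bar>lam n - R\<bar> / lam n" using True lam_pos[of n] sep[of n] R by (intro frac_le) auto
      finally show ?thesis .
    next
      case False
      then have "1/2 \<le> \<bar>lam n - R\<bar> / lam n" using lam_pos[of n] by (simp add: le_divide_eq)
      moreover have "1 / (4 * R) \<le> 1/2" using R by (simp add: divide_le_eq)
      ultimately show ?thesis by linarith
    qed
    moreover have "1 \<le> (lam n + R) / lam n" using lam_pos[of n] R by simp
    ultimately show ?thesis unfolding F_eq using lam_pos[of n] R
      using mult_mono[of "1 / (4 * R)" "\<bar>lam n - R\<bar> / lam n" 1 "(lam n + R) / lam n"] by simp
  qed
  have F_tail: "F n \<ge> exp (- 2 * R\<^sup>2 * (1 / (real n)\<^sup>2))" if n: "n \<ge> M" for n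
  proof -
    have n': "real n \<ge> 2 * R" using n M by linarith
    define t where "t = R\<^sup>2 / (lam n)\<^sup>2"
    have "(2 * R)\<^sup>2 \<le> (lam n)\<^sup>2" using n' lam_ge[of n] R by (intro power_mono) auto
    then have t: "0 \<le> t" "t \<le> 1/4" using lam_pos[of n] by (auto simp: t_def divide_le_eq)
    have "R\<^sup>2 / (lam n)\<^sup>2 \<le> R\<^sup>2 / (real n)\<^sup>2"
      using lam_ge[of n] lam_pos[of n] n' R by (intro divide_left_mono power_mono mult_pos_pos) auto
    then have "exp (- 2 * R\<^sup>2 * (1 / (real n)\<^sup>2)) \<le> exp (- (2 * t))" by (simp add: t_def)
    also have "\<dots> = 1 / exp (2 * t)" by (simp add: exp_minus divide_inverse)
    also have "\<dots> \<le> 1 / (1 + 2 * t)" using t exp_ge_add_one_self[of "2 * t"] by (intro divide_left_mono) auto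
    also have "\<dots> \<le> 1 - t"
    proof -
      have "t * (1 - 2 * t) \<ge> 0" using t by simp
      then have "1 \<le> (1 - t) * (1 + 2 * t)" by (simp add: algebra_simps)
      then show ?thesis using t by (simp add: divide_le_eq)
    qed
    also have "1 - t \<le> F n" using t by (simp add: F_def t_def)
    finally show ?thesis .
  qed
  define c where "c = exp (- ((2 * R + 1) * ln (4 * R) + 2 * R))"
  have part: "c \<le> norm (\<Prod>n<M+k. 1 - z / of_real ((lam n)\<^sup>2))" for k
  proof -
    have "real M * ln (4 * R) \<le> (2 * R + 1) * ln (4 * R)" using M R by (intro mult_right_mono) auto
    then have "c \<le> exp (- (real M * ln (4 * R))) * exp (- (2 * R))"
      unfolding c_def exp_add[symmetric] by simp
    also have "\<dots> \<le> (\<Prod>n<M. F n) * (\<Prod>n=M..<M+k. F n)"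
    proof (rule mult_mono)
      have "exp (- (real M * ln (4 * R))) = exp (ln (1 / (4 * R)) * real M)" using R by (simp add: ln_div)
      also have "\<dots> = (\<Prod>n<M. 1 / (4 * R))" using R by (simp add: exp_of_nat2_mult)
      also have "\<dots> \<le> (\<Prod>n<M. F n)" using F_small R by (intro prod_mono) auto
      finally show "exp (- (real M * ln (4 * R))) \<le> (\<Prod>n<M. F n)" .
      have "(\<Sum>n=M..<M+k. 1 / (real n)\<^sup>2) \<le> 2 / real M - 2 / real (M + k)"
        by (rule sum_inverse_squares_le[OF M(3)])
      also have "\<dots> \<le> 2 / real M" by simp
      also have "\<dots> \<le> 2 / (2 * R)" using M R by (intro divide_left_mono) auto
      finally have "2 * R\<^sup>2 * (\<Sum>n=M..<M+k. 1 / (real n)\<^sup>2) \<le> 2 * R\<^sup>2 * (2 / (2 * R))"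
        by (intro mult_left_mono) auto
      also have "2 * R\<^sup>2 * (2 / (2 * R)) = 2 * R" using R by (simp add: power2_eq_square)
      finally have "exp (- (2 * R)) \<le> exp (\<Sum>n=M..<M+k. - 2 * R\<^sup>2 * (1 / (real n)\<^sup>2))"
        by (simp add: sum_distrib_left sum_negf)
      also have "exp (\<Sum>n=M..<M+k. - 2 * R\<^sup>2 * (1 / (real n)\<^sup>2)) = (\<Prod>n=M..<M+k. exp (- 2 * R\<^sup>2 * (1 / (real n)\<^sup>2)))"
        by (rule exp_sum) simp
      also have "\<dots> \<le> (\<Prod>n=M..<M+k. F n)" using F_tail by (intro prod_mono) auto
      finally show "exp (- (2 * R)) \<le> (\<Prod>n=M..<M+k. F n)" .
    qed (auto intro!: prod_nonneg simp: F_def)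
    also have "\<dots> = (\<Prod>n<M+k. F n)"
      by (simp add: prod.atLeastLessThan_concat[of 0 M "M + k"] lessThan_atLeast0)
    also have "\<dots> \<le> (\<Prod>n<M+k. norm (1 - z / of_real ((lam n)\<^sup>2)))"
      using F_le by (intro prod_mono) (auto simp: F_def)
    finally show ?thesis by (simp add: prod_norm)
  qed
  have "(\<lambda>k. norm (\<Prod>n<k. 1 - z / of_real ((lam n)\<^sup>2))) \<longlonglongrightarrow> norm (wp.f z)"
    by (intro tendsto_norm has_prod_imp_tendsto' wp_has_prod)
  from LIMSEQ_ignore_initial_segment[OF this, of M]
  have "(\<lambda>k. norm (\<Prod>n<M+k. 1 - z / of_real ((lam n)\<^sup>2))) \<longlonglongrightarrow> norm (wp.f z)" by (simp add: add.commute)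
  then show ?thesis using part unfolding c_def[symmetric] by (intro LIMSEQ_le_const) auto
qed

lemma \<Phi>_neg_le: "\<forall>\<^sub>F y in at_top. \<Phi> (- (y\<^sup>2)) \<le> exp (pi * y)"
proof -
  have "1 / (pi * sqrt 2) < 1" using pi_gt3 mult_strict_mono[of 1 pi 1 "sqrt 2"] by (simp add: divide_less_eq)
  then have "\<forall>\<^sub>F y in at_top. y powr (\<nu> + 1/2) * exp (- (pi * y)) * \<Phi> (- (y\<^sup>2)) < 1"
    using \<Phi>_neg_asymptotics by (intro order_tendstoD)
  then show ?thesis using eventually_ge_at_top[of 1]
  proof eventually_elim
    case (elim y)
    have "1 * exp (- (pi * y)) * \<Phi> (- (y\<^sup>2)) \<le> y powr (\<nu> + 1/2) * exp (- (pi * y)) * \<Phi> (- (y\<^sup>2))"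
      using elim nu \<Phi>_neg_pos[of "y\<^sup>2"] by (intro mult_right_mono ge_one_powr_ge_zero) auto
    also have "\<dots> \<le> 1" using elim by simp
    finally have "exp (- (pi * y)) * \<Phi> (- (y\<^sup>2)) \<le> 1" by simp
    then show ?case by (simp add: exp_minus field_simps)
  qed
qed

text \<open>The quotient of \<open>\<Phi>\<close> by the canonical product is \<open>exp g\<close>
  with \<open>g\<close> entire. On circles of radius R^2 the upper bound \<open>exp (pi * R)\<close>
  for \<open>\<Phi>\<close> and the lower bound for the product give Re g = O(R ln R), below every
  multiple of the radius. So \<open>g\<close> is constant, and its value is read off at 0.\<close>

theorem \<Phi>_product:
  fixes z :: complex
  shows "(\<lambda>n. 1 - z / of_real ((lam n)\<^sup>2)) has_prod (\<Phi> z / of_real (b 0))"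
proof -
  obtain h where h: "h holomorphic_on UNIV" "\<And>z. h z \<noteq> 0" "\<And>z. \<Phi> z = h z * wp.f z"
    using quotient_exists by blast
  obtain g where g: "g holomorphic_on UNIV" "\<And>z. h z = exp (g z)"
    using simply_connected_eq_holomorphic_log[of UNIV] h convex_imp_simply_connected[OF convex_UNIV] by auto
  have "g w = g 0" for w :: complex
  proof (rule entire_constant_of_Re_le[OF g(1)])
    fix \<epsilon> r0 :: real assume \<epsilon>: "\<epsilon> > 0"
    define B where "B R = pi * R + ((2 * R + 1) * ln (4 * R) + 2 * R)" for R
    have "((\<lambda>R. B R / R\<^sup>2) \<longlongrightarrow> 0) at_top" unfolding B_def by real_asymp
    then have "\<forall>\<^sub>F R in at_top. B R / R\<^sup>2 < \<epsilon>" using \<epsilon> by (intro order_tendstoD)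
    then have "\<forall>\<^sub>F R in at_top. B R / R\<^sup>2 < \<epsilon> \<and> \<Phi> (- (R\<^sup>2)) \<le> exp (pi * R) \<and> R \<ge> max 1 r0"
      using \<Phi>_neg_le eventually_ge_at_top[of "max 1 r0"] by (intro eventually_conj)
    moreover have "filterlim (\<lambda>N. lam N + 1/2) at_top sequentially"
      by (intro filterlim_tendsto_add_at_top[OF tendsto_const] lam_at_top | subst add.commute)+
    ultimately have "\<forall>\<^sub>F N in sequentially. B (lam N + 1/2) / (lam N + 1/2)\<^sup>2 < \<epsilon> \<and>
        \<Phi> (- ((lam N + 1/2)\<^sup>2)) \<le> exp (pi * (lam N + 1/2)) \<and> lam N + 1/2 \<ge> max 1 r0"
      unfolding filterlim_iff by blast
    then obtain N where N: "B (lam N + 1/2) / (lam N + 1/2)\<^sup>2 < \<epsilon>"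
      "\<Phi> (- ((lam N + 1/2)\<^sup>2)) \<le> exp (pi * (lam N + 1/2))" "lam N + 1/2 \<ge> max 1 r0"
      using eventually_happens'[OF sequentially_bot] by blast
    \<comment> \<open>As consecutive zeros are at least 1 apart, this radius is at least 1/2 away
      from all of them.\<close>
    define R where "R = lam N + 1/2"
    note N = N[folded R_def]
    have sep: "\<bar>lam n - R\<bar> \<ge> 1/2" for n
    proof (cases "n \<le> N")
      case True
      then have "lam n \<le> lam N" using strict_mono_less_eq[OF lam_strict_mono] by blast
      then show ?thesis by (simp add: R_def)
    next
      case False
      then have "lam n \<ge> lam (Suc N)" using strict_mono_less_eq[OF lam_strict_mono, of "Suc N" n] by simp
      then show ?thesis using lam_Suc_ge[of N] by (simp add: R_def)
    qed
    have R1: "R \<ge> 1" "R \<ge> r0" using N by auto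
    have "Re (g z) \<le> \<epsilon> * R\<^sup>2" if z: "norm z = R\<^sup>2" for z
    proof -
      have "exp (Re (g z)) * norm (wp.f z) = norm (\<Phi> z)" by (simp add: h(3) g(2) norm_mult)
      also have "\<dots> \<le> \<Phi> (- norm z)" by (rule norm_\<Phi>_le)
      also have "\<dots> \<le> exp (pi * R)" unfolding z by (rule N(2))
      finally have 1: "exp (Re (g z)) * norm (wp.f z) \<le> exp (pi * R)" .
      have "exp (Re (g z)) * exp (- ((2 * R + 1) * ln (4 * R) + 2 * R)) \<le> exp (Re (g z)) * norm (wp.f z)"
        using R1 z sep by (intro mult_left_mono wp_lower_bound) auto
      also note 1
      finally have "Re (g z) \<le> B R" unfolding exp_add[symmetric] exp_le_cancel_iff B_def by linarith
      also have "\<dots> \<le> \<epsilon> * R\<^sup>2" using N(1) R1 by (simp add: divide_less_eq)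
      finally show ?thesis .
    qed
    moreover have "R\<^sup>2 \<ge> r0" using R1 self_le_power[of R 2] by simp
    ultimately show "\<exists>r\<ge>r0. \<forall>z. norm z = r \<longrightarrow> Re (g z) \<le> \<epsilon> * r" by blast
  qed
  then have "\<Phi> w = h 0 * wp.f w" for w using h(3)[of w] g(2)[of w] g(2)[of 0] by metis
  moreover from this[of 0] have "of_real (b 0) = h (0::complex)"
    using has_prod_unique2[OF wp_has_prod[of 0], of 1] by (simp add: \<Phi>_0)
  ultimately have "wp.f z = \<Phi> z / of_real (b 0)" using h(2)[of 0] by simp
  then show ?thesis using wp_has_prod[of z] by simp
qed

end

section \<open>Zeta functions of perturbed sequences\<close>

text \<open>At \<open>s - 1\<close> this is the factor 1 + exp (- pi i s) of zeta* divided by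
  \<open>s - 1\<close>. Multiplied by \<open>Z s\<close> it represents zeta* without a singularity
  at 1.\<close>

definition exp_quotient :: "complex \<Rightarrow> complex" where
  "exp_quotient z = (if z = 0 then of_real pi * \<i> else (1 - exp (- (of_real pi * \<i> * z))) / z)"

lemma exp_quotient_holomorphic: "exp_quotient holomorphic_on UNIV"
proof -
  define f where "f z = - exp (- (of_real pi * \<i> * z))" for z
  have "deriv f 0 = of_real pi * \<i>"
    unfolding f_def by (rule DERIV_imp_deriv) (auto intro!: derivative_eq_intros)
  moreover have "(\<lambda>z. if z = 0 then deriv f 0 else (f z - f 0) / (z - 0)) holomorphic_on UNIV"
    unfolding f_def by (intro pole_lemma_open holomorphic_intros) auto
  moreover have "exp_quotient = (\<lambda>z. if z = 0 then deriv f 0 else (f z - f 0) / (z - 0))"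
    unfolding calculation(1) by (auto simp: exp_quotient_def f_def fun_eq_iff)
  ultimately show ?thesis by metis
qed

lemma exp_quotient_shift: "z \<noteq> 1 \<Longrightarrow> exp_quotient (z - 1) = (1 + exp (- (of_real pi * \<i> * z))) / (z - 1)"
  by (simp add: exp_quotient_def right_diff_distrib exp_diff exp_minus field_simps)

section \<open>Continuation for one side of a perturbed sequence\<close>

context shifted_naturals
begin

lemma eventually_l_ge_1: "\<forall>\<^sub>F n in sequentially. l n \<ge> 1"
proof (rule eventually_sequentiallyI)
  fix n assume "n \<ge> K"
  then show "1 \<le> l n" using p_mem[of "n - K"] x_ge[of "n - K"] by (simp add: p_def)
qed

text \<open>What is left of \<open>l n powr (- d s) * exp (- s * a n)\<close> after the terms of
  orders 0 and 1 in \<open>1 / l n\<close>. In the application \<open>a n\<close> is the logarithm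
  of the polynomial value relative to \<open>d\<close> times the logarithm of the zero, with leading
  term \<open>v / l n\<close>.\<close>

definition remainder :: "nat \<Rightarrow> (nat \<Rightarrow> complex) \<Rightarrow> complex \<Rightarrow> nat \<Rightarrow> complex \<Rightarrow> complex" where
  "remainder d a v n s = of_real (l n) powr (- (of_nat d * s)) * (exp (- s * a n) - 1 + s * v / of_real (l n))"

context
  fixes d :: nat and a :: "nat \<Rightarrow> complex" and v :: complex and C2 :: real
  assumes d: "d \<ge> 1"
    and a: "\<And>n. norm (a n - v / of_real (l n)) \<le> C2 / (l n)\<^sup>2"
begin

abbreviation domain :: "complex set" where "domain \<equiv> {s. Re s > - (1 / real d)}"

lemma open_domain: "open domain" by (rule open_halfspace_Re_gt)

text \<open>Two errors of order \<open>1 / (l n)\<^sup>2\<close> add up: the second-order part of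
  the exponential, which gives the first summand of \<open>B\<close>, and the deviation of
  \<open>a n\<close> from \<open>v / l n\<close>, which gives the second.\<close>

lemma remainder_bound:
  obtains B where "\<And>s \<sigma> n. norm s \<le> R \<Longrightarrow> Re s \<ge> \<sigma> \<Longrightarrow> l n \<ge> 1 \<Longrightarrow>
      norm (remainder d a v n s) \<le> B * l n powr (- (real d * \<sigma>) - 2)"
proof (cases "R \<ge> 0")
  case False
  show thesis
  proof (rule that)
    fix s :: complex and \<sigma> n assume "norm s \<le> R"
    then show "norm (remainder d a v n s) \<le> 0 * l n powr (- (real d * \<sigma>) - 2)"
      using False norm_ge_zero[of s] by linarith
  qed
next
  case True
  have C2: "C2 \<ge> 0"
  proof -
    have "0 \<le> C2 / (l 0)\<^sup>2" using a[of 0] norm_ge_zero order_trans by blast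
    then show ?thesis using pos[of 0] by (simp add: zero_le_divide_iff)
  qed
  define C3 where "C3 = norm v + C2"
  have C3: "C3 \<ge> 0" using C2 by (simp add: C3_def)
  define B where "B = exp (R * C3) * (R * C3)\<^sup>2 + R * C2"
  show thesis
  proof (rule that)
    fix s :: complex and \<sigma> n assume s: "norm s \<le> R" "Re s \<ge> \<sigma>" and n: "l n \<ge> 1"
    have "norm (a n) \<le> norm (v / of_real (l n)) + C2 / (l n)\<^sup>2"
      using a[of n] norm_triangle_sub[of "a n" "v / of_real (l n)"] by linarith
    also have "\<dots> \<le> norm v / l n + C2 / l n"
      using n C2 self_le_power[of "l n" 2] by (intro add_mono divide_left_mono) (auto simp: norm_divide)
    finally have an: "norm (a n) \<le> C3 / l n" by (simp add: C3_def add_divide_distrib)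
    have sa: "norm (- s * a n) \<le> R * (C3 / l n)"
      unfolding norm_mult using s an True by (intro mult_mono) auto
    also have "\<dots> \<le> R * C3" using n True C3 by (intro mult_left_mono) (auto simp: divide_le_eq mult_le_cancel_left1)
    finally have sa': "norm (- s * a n) \<le> R * C3" .
    define w where "w = - s * a n"
    have "norm (exp w - (\<Sum>k\<le>1. w ^ k / fact k)) \<le> exp \<bar>Re w\<bar> * norm w ^ Suc 1 / fact 1"
      by (rule Taylor_exp)
    also have "\<dots> \<le> exp (R * C3) * (R * (C3 / l n)) ^ 2"
    proof -
      have "exp \<bar>Re w\<bar> \<le> exp (R * C3)"
        using sa' abs_Re_le_cmod[of w] unfolding w_def[symmetric] by simp
      moreover have "norm w ^ 2 \<le> (R * (C3 / l n)) ^ 2"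
        using sa unfolding w_def[symmetric] by (intro power_mono) auto
      ultimately have "exp \<bar>Re w\<bar> * norm w ^ 2 \<le> exp (R * C3) * (R * (C3 / l n)) ^ 2"
        by (intro mult_mono) auto
      then show ?thesis by (simp add: numeral_2_eq_2)
    qed
    finally have 1: "norm (exp w - 1 - w) \<le> exp (R * C3) * (R * (C3 / l n)) ^ 2" by (simp add: diff_diff_eq)
    have 2: "norm (s * (v / of_real (l n) - a n)) \<le> R * (C2 / (l n)\<^sup>2)"
      unfolding norm_mult using s a[of n] True by (intro mult_mono) (auto simp: norm_minus_commute)
    have e: "exp w - 1 + s * v / of_real (l n) = (exp w - 1 - w) + s * (v / of_real (l n) - a n)"
      by (simp add: w_def algebra_simps)
    have "norm (exp w - 1 + s * v / of_real (l n)) \<le> exp (R * C3) * (R * (C3 / l n)) ^ 2 + R * (C2 / (l n)\<^sup>2)"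
      unfolding e by (rule norm_triangle_mono[OF 1 2])
    also have "\<dots> = B / (l n)\<^sup>2" by (simp add: B_def power_mult_distrib power_divide add_divide_distrib)
    finally have "norm (remainder d a v n s) \<le> l n powr (- (real d * Re s)) * (B / (l n)\<^sup>2)"
      unfolding remainder_def norm_mult w_def
      using norm_of_real_powr[OF pos[of n], of "- (of_nat d * s)"] by (intro mult_mono) auto
    also have "\<dots> = B * l n powr (- (real d * Re s) - 2)"
      using n powr_diff[of "l n" "- (real d * Re s)" 2] by (simp add: powr_numeral)
    also have "\<dots> \<le> B * l n powr (- (real d * \<sigma>) - 2)"
      using n s True C2 C3 by (intro mult_left_mono powr_mono) (auto simp: B_def intro!: mult_left_mono add_nonneg_nonneg)
    finally show "norm (remainder d a v n s) \<le> B * l n powr (- (real d * \<sigma>) - 2)" .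
  qed
qed

lemma remainder_locally_bounded:
  assumes "z \<in> domain"
  shows "\<exists>\<delta> M. 0 < \<delta> \<and> summable M \<and>
           (\<forall>\<^sub>F n in sequentially. \<forall>w\<in>ball z \<delta> \<inter> domain. norm (remainder d a v n w) \<le> M n)"
proof -
  define \<sigma> where "\<sigma> = (Re z - 1 / real d) / 2"
  define \<delta> where "\<delta> = (Re z + 1 / real d) / 2"
  define R where "R = norm z + \<delta>"
  have \<delta>: "\<delta> > 0" using assms by (simp add: \<delta>_def)
  have "real d * \<sigma> > real d * (- (1 / real d))"
    using assms d by (intro mult_strict_left_mono) (auto simp: \<sigma>_def)
  then have \<sigma>: "- (real d * \<sigma>) - 2 < -1" using d by simp
  obtain B where B: "\<And>s \<sigma> n. norm s \<le> R \<Longrightarrow> Re s \<ge> \<sigma> \<Longrightarrow> l n \<ge> 1 \<Longrightarrow>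
      norm (remainder d a v n s) \<le> B * l n powr (- (real d * \<sigma>) - 2)" using remainder_bound by blast
  have "\<forall>\<^sub>F n in sequentially. \<forall>w\<in>ball z \<delta> \<inter> domain. norm (remainder d a v n w) \<le> B * l n powr (- (real d * \<sigma>) - 2)"
    using eventually_l_ge_1
  proof eventually_elim
    case (elim n)
    show ?case
    proof
      fix w assume "w \<in> ball z \<delta> \<inter> domain"
      then have w: "norm (z - w) < \<delta>" by (simp add: dist_norm)
      have "norm w \<le> norm z + norm (z - w)" using norm_triangle_ineq4[of z "z - w"] by simp
      then have "norm w \<le> R" using w unfolding R_def by linarith
      moreover have "Re w \<ge> \<sigma>" using w abs_Re_le_cmod[of "z - w"] by (simp add: \<sigma>_def \<delta>_def field_simps)
      ultimately show "norm (remainder d a v n w) \<le> B * l n powr (- (real d * \<sigma>) - 2)" using elim by (rule B)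
    qed
  qed
  moreover have "summable (\<lambda>n. B * l n powr (- (real d * \<sigma>) - 2))"
    by (intro summable_mult l_powr_summable \<sigma>)
  ultimately show ?thesis using \<delta> by blast
qed

lemma remainder_holomorphic: "remainder d a v n holomorphic_on S"
  unfolding remainder_def using pos[of n] by (intro holomorphic_intros) auto

lemmas remainder_sum_holomorphic =
  holomorphic_on_suminf[OF open_domain remainder_holomorphic remainder_locally_bounded]
lemmas remainder_summable =
  summable_of_locally_bounded[OF open_domain remainder_holomorphic remainder_locally_bounded]

lemma remainder_norm_summable:
  assumes "s \<in> domain"
  shows "summable (\<lambda>n. norm (remainder d a v n s))"
proof -
  obtain \<delta> M where "\<delta> > 0" "summable M"
    "\<forall>\<^sub>F n in sequentially. \<forall>w\<in>ball s \<delta> \<inter> domain. norm (remainder d a v n w) \<le> M n"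
    using remainder_locally_bounded[OF assms] by blast
  then have "\<forall>\<^sub>F n in sequentially. norm (norm (remainder d a v n s)) \<le> M n"
    using assms by (auto elim!: eventually_mono)
  then show ?thesis using \<open>summable M\<close> by (rule summable_comparison_test_ev)
qed

lemma zero_in_domain: "0 \<in> domain" using d by simp

text \<open>The bracket in \<open>remainder\<close> vanishes at 0, so the power of
  \<open>l n\<close> does not contribute to the derivative.\<close>

lemma remainder_deriv_sums:
  "(\<lambda>n. - a n + v / of_real (l n)) sums deriv (\<lambda>s. \<Sum>n. remainder d a v n s) 0"
proof -
  have "(remainder d a v n has_field_derivative (- a n + v / of_real (l n))) (at 0)" for n
  proof -
    have "((\<lambda>s. exp (- s * a n) - 1 + s * v / of_real (l n)) has_field_derivative (- a n + v / of_real (l n))) (at 0)"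
      using pos[of n] by (auto intro!: derivative_eq_intros)
    moreover have "((\<lambda>s. complex_of_real (l n) powr (- (of_nat d * s))) has_field_derivative
        of_real (l n) powr (- (of_nat d * 0)) * of_real (ln (l n)) * (- of_nat d)) (at 0)"
      by (intro has_field_derivative_of_real_powr pos) (auto intro!: derivative_eq_intros)
    ultimately show ?thesis
      unfolding remainder_def[abs_def] using pos[of n] by (auto intro!: derivative_eq_intros)
  qed
  then have "deriv (remainder d a v n) 0 = - a n + v / of_real (l n)" for n by (rule DERIV_imp_deriv)
  then show ?thesis
    using deriv_sums_suminf[OF open_domain remainder_holomorphic remainder_locally_bounded zero_in_domain] by simp
qed

lemma perturbed_zeta_sums:
  assumes "Re s > 1 / real d"
  shows "(\<lambda>n. of_real (l n) powr (- (of_nat d * s)) * exp (- s * a n)) sums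
      (Z (of_nat d * s) / (of_nat d * s - 1) - s * v * (Z (of_nat d * s + 1) / (of_nat d * s)) + (\<Sum>n. remainder d a v n s))"
    and "summable (\<lambda>n. norm (of_real (l n) powr (- (of_nat d * s)) * exp (- s * a n)))"
proof -
  have Re: "Re (of_nat d * s) > 1" using assms d by (simp add: divide_less_eq mult.commute)
  have "1 / real d > 0" using d by simp
  then have "Re s > - (1 / real d)" using assms by linarith
  then have dom: "s \<in> domain" by simp
  have split: "of_real (l n) powr (- (of_nat d * s)) * exp (- s * a n) =
      of_real (l n) powr (- (of_nat d * s)) - s * v * of_real (l n) powr (- (of_nat d * s + 1)) + remainder d a v n s" for n
  proof -
    have "complex_of_real (l n) powr (- (of_nat d * s + 1)) = of_real (l n) powr (- (of_nat d * s)) / of_real (l n)"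
      using pos[of n] powr_diff[of "complex_of_real (l n)" "- (of_nat d * s)" 1] by (simp add: powr_to_1)
    then show ?thesis by (simp add: remainder_def algebra_simps)
  qed
  show "(\<lambda>n. of_real (l n) powr (- (of_nat d * s)) * exp (- s * a n)) sums
      (Z (of_nat d * s) / (of_nat d * s - 1) - s * v * (Z (of_nat d * s + 1) / (of_nat d * s)) + (\<Sum>n. remainder d a v n s))"
    unfolding split
    using zeta_sums[of "of_nat d * s + 1"] Re
    by (intro sums_add sums_diff sums_mult zeta_sums summable_sums remainder_summable dom) auto
  have "summable (\<lambda>n. l n powr (- Re (of_nat d * s)) + norm (s * v) * l n powr (- Re (of_nat d * s) - 1) + norm (remainder d a v n s))"
    using Re by (intro summable_add summable_mult l_powr_summable remainder_norm_summable dom) auto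
  then show "summable (\<lambda>n. norm (of_real (l n) powr (- (of_nat d * s)) * exp (- s * a n)))"
  proof (rule summable_comparison_test_ev[rotated], intro always_eventually allI)
    fix n
    have "norm (complex_of_real (l n) powr (- (of_nat d * s)) - s * v * of_real (l n) powr (- (of_nat d * s + 1)) + remainder d a v n s)
      \<le> norm (complex_of_real (l n) powr (- (of_nat d * s))) + norm (s * v * of_real (l n) powr (- (of_nat d * s + 1))) + norm (remainder d a v n s)"
      by (meson norm_triangle_ineq4 norm_triangle_mono order_refl)
    also have "\<dots> = l n powr (- Re (of_nat d * s)) + norm (s * v) * l n powr (- Re (of_nat d * s) - 1) + norm (remainder d a v n s)"
      unfolding norm_mult[of "s * v"] norm_of_real_powr[OF pos] by simp
    finally show "norm (norm (of_real (l n) powr (- (of_nat d * s)) * exp (- s * a n))) \<le> \<dots>"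
      unfolding split by simp
  qed
qed

end

section \<open>Both sides of the sequence together\<close>

context
  fixes d :: nat and a a' :: "nat \<Rightarrow> complex" and v :: complex and C2 :: real
  assumes d: "d \<ge> 1"
    and a: "\<And>n. norm (a n - v / of_real (l n)) \<le> C2 / (l n)\<^sup>2"
    and a': "\<And>n. norm (a' n - (- v) / of_real (l n)) \<le> C2 / (l n)\<^sup>2"
begin

text \<open>The negative side carries the factor e = exp (- pi i d s) and the opposite leading
  coefficient \<open>- v\<close>. Hence the zeta function at \<open>d s\<close> is multiplied by 1 +
  e and the one at \<open>d s + 1\<close> by 1 - e. Each factor vanishes at the pole it meets, and
  \<open>exp_quotient\<close> writes the products in holomorphic form.\<close>

definition paired_zeta :: "complex \<Rightarrow> complex" where
  "paired_zeta s = exp_quotient (of_nat d * s - 1) * Z (of_nat d * s)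
     - s * v * (exp_quotient (of_nat d * s) * Z (of_nat d * s + 1))
     + (\<Sum>n. remainder d a v n s) + exp (- (of_real pi * \<i> * (of_nat d * s))) * (\<Sum>n. remainder d a' (- v) n s)"

lemma domain_scaled: "Re s > - (1 / real d) \<Longrightarrow> Re (of_nat d * s) > -1"
  using d by (simp add: field_simps)

lemma paired_zeta_holomorphic: "paired_zeta holomorphic_on {s. Re s > - (1 / real d)}"
  unfolding paired_zeta_def
  using domain_scaled d
  by (intro holomorphic_intros remainder_sum_holomorphic[OF d a] remainder_sum_holomorphic[OF d a']
        holomorphic_on_compose_gen[OF _ exp_quotient_holomorphic, unfolded o_def]
        holomorphic_on_compose_gen[OF _ Z_holomorphic, unfolded o_def]) (force simp: field_simps)+

lemma paired_zeta_eq: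
  assumes s: "Re s > 1 / real d"
  shows "paired_zeta s =
    (\<Sum>n. of_real (l n) powr (- (of_nat d * s)) * exp (- s * a n)) +
    exp (- (of_real pi * \<i> * (of_nat d * s))) * (\<Sum>n. of_real (l n) powr (- (of_nat d * s)) * exp (- s * a' n))"
proof -
  define z where "z = of_nat d * s"
  have "Re z > 1" using s d by (simp add: z_def divide_less_eq mult.commute)
  then have z: "z \<noteq> 1" "z \<noteq> 0" by auto
  define e where "e = exp (- (of_real pi * \<i> * z))"
  have 1: "exp_quotient (z - 1) = (1 + e) / (z - 1)" using exp_quotient_shift[OF z(1)] by (simp add: e_def)
  have 2: "exp_quotient z = (1 - e) / z" using z by (simp add: exp_quotient_def e_def)
  show ?thesis
    unfolding paired_zeta_def sums_unique[OF perturbed_zeta_sums(1)[OF d a s], symmetric]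
      sums_unique[OF perturbed_zeta_sums(1)[OF d a' s], symmetric]
    unfolding z_def[symmetric] 1 2 e_def[symmetric]
    by (simp add: add_divide_distrib diff_divide_distrib distrib_left distrib_right left_diff_distrib right_diff_distrib mult_ac)
qed

text \<open>The first term is \<open>d\<close> times the derivative of zeta* at 0, namely
  \<open>- pi i \<zeta>(0) + 2 \<zeta>'(0)\<close> with \<open>\<zeta>(0) = 1/2 - \<beta>\<close>.
  The second is \<open>v\<close> times the value pi i of zeta* at 1. In the remainders the
  corrections \<open>v / l n\<close> and \<open>- v / l n\<close> cancel, leaving the sum of
  \<open>a n + a' n\<close>.\<close>

lemma paired_zeta_deriv_0:
  shows "summable (\<lambda>n. a n + a' n)"
    and "deriv paired_zeta 0 = of_nat d * (of_real pi * \<i> * of_real (\<beta> - 1/2) + of_real (2 * zeta_deriv_0))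
           - v * (of_real pi * \<i>) - (\<Sum>n. a n + a' n)"
proof -
  define S1 where "S1 = deriv (\<lambda>s. \<Sum>n. remainder d a v n s) 0"
  define S2 where "S2 = deriv (\<lambda>s. \<Sum>n. remainder d a' (- v) n s) 0"
  have "(\<lambda>n. - a n + v / of_real (l n) + (- a' n + (- v) / of_real (l n))) sums (S1 + S2)"
    unfolding S1_def S2_def by (intro sums_add remainder_deriv_sums[OF d a] remainder_deriv_sums[OF d a'])
  from sums_minus[OF this] have S: "(\<lambda>n. a n + a' n) sums (- (S1 + S2))" by (simp add: algebra_simps)
  then show "summable (\<lambda>n. a n + a' n)" by (rule sums_summable)
  have r1: "((\<lambda>s. \<Sum>n. remainder d a v n s) has_field_derivative S1) (at 0)"
    unfolding S1_def using d by (intro holomorphic_derivI[OF remainder_sum_holomorphic[OF d a]] open_halfspace_Re_gt) auto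
  have r2: "((\<lambda>s. \<Sum>n. remainder d a' (- v) n s) has_field_derivative S2) (at 0)"
    unfolding S2_def using d by (intro holomorphic_derivI[OF remainder_sum_holomorphic[OF d a']] open_halfspace_Re_gt) auto
  have r0: "(\<Sum>n. remainder d a' (- v) n 0) = 0" by (simp add: remainder_def)
  define T where "T z = exp_quotient (z - 1) * Z z" for z
  have T: "(T has_field_derivative (of_real pi * \<i> * of_real (\<beta> - 1/2) + of_real (2 * zeta_deriv_0))) (at 0)"
  proof -
    have "((\<lambda>z. (1 + exp (- (of_real pi * \<i> * z))) / (z - 1) * Z z) has_field_derivative
        (of_real pi * \<i> * of_real (\<beta> - 1/2) + of_real (2 * zeta_deriv_0))) (at 0)"
      by (rule derivative_eq_intros deriv_Z_0 refl | simp)+ (simp add: Z_0 algebra_simps)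
    then show ?thesis
    proof (rule has_field_derivative_transform_within_open[of _ _ _ "- {1}"])
      fix z assume "z \<in> - {1::complex}"
      then show "(1 + exp (- (of_real pi * \<i> * z))) / (z - 1) * Z z = T z"
        using exp_quotient_shift[of z] by (simp add: T_def)
    qed auto
  qed
  have T': "((\<lambda>s. T (of_nat d * s)) has_field_derivative
      (of_real pi * \<i> * of_real (\<beta> - 1/2) + of_real (2 * zeta_deriv_0)) * of_nat d) (at 0)"
    by (rule DERIV_chain2[where f = T]) (use T in \<open>auto intro!: derivative_eq_intros\<close>)
  define U where "U s = exp_quotient (of_nat d * s) * Z (of_nat d * s + 1)" for s
  have "U holomorphic_on {s. Re s > - (1 / real d)}"
    unfolding U_def using domain_scaled
    by (intro holomorphic_intros holomorphic_on_compose_gen[OF _ exp_quotient_holomorphic, unfolded o_def]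
        holomorphic_on_compose_gen[OF _ Z_holomorphic, unfolded o_def]) force+
  then obtain U' where U: "(U has_field_derivative U') (at 0)"
    using holomorphic_derivI[OF _ open_halfspace_Re_gt, of U "- (1 / real d)" 0] d by auto
  have U0: "U 0 = of_real pi * \<i>" by (simp add: U_def exp_quotient_def Z_1)
  have e: "((\<lambda>s. exp (- (of_real pi * \<i> * (of_nat d * s)))) has_field_derivative - (of_real pi * \<i> * of_nat d)) (at 0)"
    by (auto intro!: derivative_eq_intros)
  have "(paired_zeta has_field_derivative (of_real pi * \<i> * of_real (\<beta> - 1/2) + of_real (2 * zeta_deriv_0)) * of_nat d
      - v * (of_real pi * \<i>) + S1 + S2) (at 0)"
    unfolding paired_zeta_def[abs_def] T_def[symmetric] U_def[symmetric]
    by (rule derivative_eq_intros T' U r1 r2 e refl)+ (simp add: r0 U0)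
  from DERIV_imp_deriv[OF this] show "deriv paired_zeta 0 = of_nat d * (of_real pi * \<i> * of_real (\<beta> - 1/2) + of_real (2 * zeta_deriv_0))
           - v * (of_real pi * \<i>) - (\<Sum>n. a n + a' n)"
    using S by (simp add: sums_iff mult.commute)
qed

end
end

section \<open>The zeta function of the Bessel zeros\<close>

lemma tendsto_cmult_ln_imp_zero:
  fixes c :: real
  assumes "((\<lambda>y. c * ln y + k) \<longlongrightarrow> L) at_top"
  shows "c = 0" "L = k"
proof -
  have "((\<lambda>y::real. inverse (ln y)) \<longlongrightarrow> 0) at_top" by real_asymp
  from tendsto_mult[OF assms this] have "((\<lambda>y. (c * ln y + k) * inverse (ln y)) \<longlongrightarrow> 0) at_top" by simp
  moreover have "((\<lambda>y::real. (c * ln y + k) * inverse (ln y)) \<longlongrightarrow> c) at_top" by real_asymp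
  ultimately show "c = 0" by (intro tendsto_unique[OF trivial_limit_at_top_linorder])
  then have "((\<lambda>y::real. k) \<longlongrightarrow> L) at_top" using assms by simp
  then show "L = k" using tendsto_unique[OF trivial_limit_at_top_linorder _ tendsto_const] by metis
qed

section \<open>The constants for the Bessel zeros and the link to the given definitions\<close>

context bessel
begin

lemma ln_product_sums:
  assumes y: "y > 0"
  shows "(\<lambda>n. ln (1 + y\<^sup>2 / (lam n)\<^sup>2)) sums ln (\<Phi> (- (y\<^sup>2)) / b 0)"
proof -
  have "(\<lambda>N. \<Prod>n<N. 1 - complex_of_real (- (y\<^sup>2)) / of_real ((lam n)\<^sup>2)) \<longlonglongrightarrow> \<Phi> (complex_of_real (- (y\<^sup>2))) / of_real (b 0)"
    by (intro has_prod_imp_tendsto' \<Phi>_product)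
  moreover have "1 - complex_of_real (- (y\<^sup>2)) / of_real ((lam n)\<^sup>2) = of_real (1 + y\<^sup>2 / (lam n)\<^sup>2)" for n
    by simp
  ultimately have "(\<lambda>N. complex_of_real (\<Prod>n<N. 1 + y\<^sup>2 / (lam n)\<^sup>2)) \<longlonglongrightarrow> of_real (\<Phi> (- (y\<^sup>2)) / b 0)"
    by (simp only: \<Phi>_of_real of_real_prod of_real_divide)
  then have "(\<lambda>N. \<Prod>n<N. 1 + y\<^sup>2 / (lam n)\<^sup>2) \<longlonglongrightarrow> \<Phi> (- (y\<^sup>2)) / b 0" by (simp only: tendsto_of_real_iff)
  moreover have "\<Phi> (- (y\<^sup>2)) / b 0 \<noteq> 0" using \<Phi>_neg_pos[of "y\<^sup>2"] b_0_pos by simp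
  ultimately have "(\<lambda>N. ln (\<Prod>n<N. 1 + y\<^sup>2 / (lam n)\<^sup>2)) \<longlonglongrightarrow> ln (\<Phi> (- (y\<^sup>2)) / b 0)"
    by (rule tendsto_ln)
  moreover have "ln (\<Prod>n<N. 1 + y\<^sup>2 / (lam n)\<^sup>2) = (\<Sum>n<N. ln (1 + y\<^sup>2 / (lam n)\<^sup>2))" for N
  proof -
    have "1 + y\<^sup>2 / (lam n)\<^sup>2 > 0" for n by (simp add: add_pos_nonneg)
    then show ?thesis by (intro ln_prod) (auto simp: less_imp_neq[symmetric])
  qed
  ultimately show ?thesis by (simp add: sums_def)
qed

text \<open>The asymptotic constants are read off by comparing the growth of the canonical product
  along the imaginary axis, which involves \<open>\<zeta>(0)\<close> and \<open>\<zeta>'(0)\<close>, with that of the Bessel function.\<close>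

lemma lam_shifted_naturals:
  obtains C where "shifted_naturals lam (\<nu>/2 + 3/4) C"
    and "exp (- 2 * shifted_naturals.zeta_deriv_0 lam (\<nu>/2 + 3/4) C) = pi * sqrt 2 * b 0"
proof -
  obtain \<beta> C where bC: "\<And>k. \<bar>lam k - (real k + \<beta>)\<bar> \<le> C / (real k + 1)"
    using lam_asymptotics by blast
  interpret sn: shifted_naturals lam \<beta> C by unfold_locales (rule lam_pos, rule bC)
  have "1 / (pi * sqrt 2) \<noteq> 0" by simp
  from tendsto_ln[OF \<Phi>_neg_asymptotics this]
  have 1: "((\<lambda>y. ln (y powr (\<nu> + 1/2) * exp (- (pi * y)) * \<Phi> (- (y\<^sup>2)))) \<longlongrightarrow> ln (1 / (pi * sqrt 2))) at_top" .
  have "((\<lambda>y. ((\<nu> + 1/2) + (1 - 2 * \<beta>)) * ln y + ln (b 0)) \<longlongrightarrow> ln (1 / (pi * sqrt 2)) - 2 * sn.zeta_deriv_0) at_top"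
  proof (rule Lim_transform_eventually[OF tendsto_diff[OF 1 sn.log_sum_asymptotics]])
    show "\<forall>\<^sub>F y in at_top. ln (y powr (\<nu> + 1/2) * exp (- (pi * y)) * \<Phi> (- (y\<^sup>2))) -
        ((\<Sum>k. ln (1 + y\<^sup>2 / (lam k)\<^sup>2)) - pi * y - (1 - 2 * \<beta>) * ln y)
        = ((\<nu> + 1/2) + (1 - 2 * \<beta>)) * ln y + ln (b 0)"
      using eventually_gt_at_top[of 0]
    proof eventually_elim
      case (elim y)
      have P: "\<Phi> (- (y\<^sup>2)) > 0" using \<Phi>_neg_pos[of "y\<^sup>2"] by simp
      have "ln (y powr (\<nu> + 1/2) * exp (- (pi * y)) * \<Phi> (- (y\<^sup>2))) = (\<nu> + 1/2) * ln y - pi * y + ln (\<Phi> (- (y\<^sup>2)))"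
        using elim P by (simp add: ln_mult ln_powr)
      moreover have "(\<Sum>k. ln (1 + y\<^sup>2 / (lam k)\<^sup>2)) = ln (\<Phi> (- (y\<^sup>2))) - ln (b 0)"
        using sums_unique[OF ln_product_sums[OF elim]] P b_0_pos by (simp add: ln_div)
      ultimately show ?case by (simp add: algebra_simps)
    qed
  qed
  \<comment> \<open>A finite limit forces the coefficient of \<open>ln y\<close> to vanish, which
    fixes \<beta>; what remains is the equation for \<open>\<zeta>'(0)\<close>.\<close>
  from tendsto_cmult_ln_imp_zero[OF this]
  have \<beta>: "\<beta> = \<nu>/2 + 3/4" and z: "ln (1 / (pi * sqrt 2)) - 2 * sn.zeta_deriv_0 = ln (b 0)" by simp_all
  have "- 2 * sn.zeta_deriv_0 = ln (b 0) + ln (pi * sqrt 2)" using z by (simp add: ln_div)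
  then have "exp (- 2 * sn.zeta_deriv_0) = b 0 * (pi * sqrt 2)" using b_0_pos by (simp add: exp_add)
  then show thesis using that sn.shifted_naturals_axioms unfolding \<beta> by (simp add: mult_ac)
qed

lemma bessel_J_entire_eq: "bessel_J_entire \<nu> w = \<Phi> (w\<^sup>2)"
proof -
  have "Gamma (complex_of_real (real n + \<nu> + 1)) = of_real (Gamma (real n + \<nu> + 1))" for n
    by (rule Gamma_complex_of_real)
  then have "(-1) ^ n / (fact n * Gamma (of_real (real n + \<nu> + 1))) * of_real ((pi / 2) powr (2 * real n + \<nu>)) * w ^ (2 * n)
      = of_real (b n) * (w\<^sup>2) ^ n" for n
    by (simp add: b_def power_mult)
  then show ?thesis unfolding bessel_J_entire_def \<Phi>_def powser_def by simp
qed

lemma bessel_J_eq: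
  assumes t: "t > 0"
  shows "bessel_J \<nu> (of_real (pi * t)) = of_real (t powr \<nu> * \<Phi> (t\<^sup>2))"
proof -
  have "(-1) ^ n / (fact n * Gamma (of_real (real n + \<nu> + 1))) * (complex_of_real (pi * t) / 2) powr of_real (2 * real n + \<nu>)
      = of_real (t powr \<nu>) * (of_real (b n) * of_real (t\<^sup>2) ^ n)" for n
  proof -
    have "(complex_of_real (pi * t) / 2) powr of_real (2 * real n + \<nu>) = (of_real (pi / 2 * t)) powr of_real (2 * real n + \<nu>)"
      by simp
    also have "\<dots> = of_real ((pi / 2 * t) powr (2 * real n + \<nu>))"
      using t by (intro powr_of_real) auto
    also have "(pi / 2 * t) powr (2 * real n + \<nu>) = (pi / 2) powr (2 * real n + \<nu>) * (t powr \<nu> * (t\<^sup>2) ^ n)"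
    proof -
      have "t powr (2 * real n) = (t\<^sup>2) ^ n"
        using powr_realpow[OF t, of "2 * n"] by (simp add: power_mult)
      then have "t powr (2 * real n + \<nu>) = t powr \<nu> * (t\<^sup>2) ^ n" by (simp add: powr_add)
      moreover have "(pi / 2 * t) powr (2 * real n + \<nu>) = (pi / 2) powr (2 * real n + \<nu>) * t powr (2 * real n + \<nu>)"
        by (rule powr_mult)
      ultimately show ?thesis by simp
    qed
    finally have e: "(complex_of_real (pi * t) / 2) powr of_real (2 * real n + \<nu>) =
        of_real ((pi / 2) powr (2 * real n + \<nu>) * (t powr \<nu> * (t\<^sup>2) ^ n))" .
    show ?thesis unfolding e Gamma_complex_of_real by (simp add: b_def)
  qed
  then have "bessel_J \<nu> (of_real (pi * t)) = (\<Sum>n. of_real (t powr \<nu>) * (of_real (b n) * of_real (t\<^sup>2) ^ n))"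
    unfolding bessel_J_def by simp
  also have "\<dots> = of_real (t powr \<nu>) * \<Phi> (complex_of_real (t\<^sup>2))"
    using sums_mult[OF powser_sums[OF entire_b], of "of_real (t powr \<nu>)" "complex_of_real (t\<^sup>2)"]
    unfolding \<Phi>_def by (simp add: sums_iff)
  finally show ?thesis unfolding \<Phi>_of_real by simp
qed

lemma bessel_zeros_eq: "bessel_zeros \<nu> = (\<lambda>k. pi * lam k) ` UNIV"
proof -
  have "x \<in> bessel_zeros \<nu> \<longleftrightarrow> x / pi \<in> zeros" for x
  proof (cases "x > 0")
    case True
    then show ?thesis
      using bessel_J_eq[of "x / pi"] u_zero_iff[of "x / pi"] by (auto simp: bessel_zeros_def zeros_def)
  qed (simp add: bessel_zeros_def zeros_def zero_less_divide_iff)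
  then have "bessel_zeros \<nu> = {x. x / pi \<in> range lam}" by (auto simp: lam_range)
  also have "\<dots> = (\<lambda>k. pi * lam k) ` UNIV" by (auto simp: field_simps image_iff)
  finally show ?thesis .
qed

text \<open>The number of zeros up to \<open>pi * lam m\<close> is \<open>Suc m\<close>, so the
  count identifies the zero. The enumeration \<open>lam\<close> starts at 0, the zeros of the
  statement at 1.\<close>

lemma bessel_pos_zero_Suc: "bessel_pos_zero \<nu> (Suc k) = pi * lam k"
proof -
  have card: "card {y \<in> bessel_zeros \<nu>. y \<le> pi * lam m} = Suc m" for m
  proof -
    have "{y \<in> bessel_zeros \<nu>. y \<le> pi * lam m} = (\<lambda>k. pi * lam k) ` {..m}"
      unfolding bessel_zeros_eq using strict_mono_less_eq[OF lam_strict_mono] by auto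
    moreover have "inj_on (\<lambda>k. pi * lam k) {..m}"
      using strict_mono_eq[OF lam_strict_mono] by (auto simp: inj_on_def)
    ultimately show ?thesis by (simp add: card_image)
  qed
  show ?thesis
    unfolding bessel_pos_zero_def
  proof (rule the_equality)
    show "pi * lam k \<in> bessel_zeros \<nu> \<and> card {y \<in> bessel_zeros \<nu>. y \<le> pi * lam k} = Suc k"
      unfolding card by (simp add: bessel_zeros_eq)
    fix x assume x: "x \<in> bessel_zeros \<nu> \<and> card {y \<in> bessel_zeros \<nu>. y \<le> x} = Suc k"
    then obtain m where m: "x = pi * lam m" unfolding bessel_zeros_eq by blast
    then show "x = pi * lam k" using x card[of m] by simp
  qed
qed

lemma bessel_lambda_pos: "bessel_lambda \<nu> (int k + 1) = lam k"
  using bessel_pos_zero_Suc[of k] by (simp add: bessel_lambda_def bessel_zero_def nat_add_distrib)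

lemma bessel_lambda_neg: "bessel_lambda \<nu> (- int k - 1) = - lam k"
  using bessel_pos_zero_Suc[of k] by (simp add: bessel_lambda_def bessel_zero_def nat_add_distrib)

end

section \<open>Sums over nonzero integers\<close>

lemma bij_betw_positive: "bij_betw (\<lambda>k. int k + 1) UNIV {k. 0 < k}"
  by (rule bij_betw_byWitness[where f' = "\<lambda>k. nat (k - 1)"]) auto

lemma bij_betw_negative: "bij_betw (\<lambda>k. - int k - 1) UNIV {k. k < 0}"
  by (rule bij_betw_byWitness[where f' = "\<lambda>k. nat (- k - 1)"]) auto

lemma has_sum_nonzero_int:
  fixes f :: "int \<Rightarrow> complex"
  assumes "summable (\<lambda>k. norm (f (int k + 1)))" "summable (\<lambda>k. norm (f (- int k - 1)))"
  shows "(\<lambda>k. norm (f k)) summable_on {k. k \<noteq> 0}"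
    and "infsum f {k. k \<noteq> 0} = (\<Sum>k. f (int k + 1)) + (\<Sum>k. f (- int k - 1))"
proof -
  have U: "{k::int. k \<noteq> 0} = {k. 0 < k} \<union> {k. k < 0}" by auto
  have "(\<lambda>k. norm (f k)) summable_on {k. 0 < k}" "(\<lambda>k. norm (f k)) summable_on {k. k < 0}"
    using assms norm_summable_imp_summable_on[of "\<lambda>k. norm (f (int k + 1))"]
      norm_summable_imp_summable_on[of "\<lambda>k. norm (f (- int k - 1))"]
    by (simp_all add: summable_on_reindex_bij_betw[OF bij_betw_positive, of "\<lambda>k. norm (f k)"]
        summable_on_reindex_bij_betw[OF bij_betw_negative, of "\<lambda>k. norm (f k)"])
  then show "(\<lambda>k. norm (f k)) summable_on {k. k \<noteq> 0}"
    unfolding U by (rule summable_on_Un_disjoint) auto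
  have "(f has_sum (\<Sum>k. f (int k + 1))) {k. 0 < k}"
    using norm_summable_imp_has_sum[OF assms(1) summable_sums[OF summable_norm_cancel[OF assms(1)]]]
    unfolding has_sum_reindex_bij_betw[OF bij_betw_positive, of f] .
  moreover have "(f has_sum (\<Sum>k. f (- int k - 1))) {k. k < 0}"
    using norm_summable_imp_has_sum[OF assms(2) summable_sums[OF summable_norm_cancel[OF assms(2)]]]
    unfolding has_sum_reindex_bij_betw[OF bij_betw_negative, of f] .
  ultimately have "(f has_sum ((\<Sum>k. f (int k + 1)) + (\<Sum>k. f (- int k - 1)))) {k. k \<noteq> 0}"
    unfolding U by (rule has_sum_Un_disjoint) auto
  then show "infsum f {k. k \<noteq> 0} = (\<Sum>k. f (int k + 1)) + (\<Sum>k. f (- int k - 1))"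
    by (rule infsumI)
qed

section \<open>The Bessel zeta function and its finite part at 1\<close>

context bessel
begin

lemma bessel_zeta_eq:
  assumes "shifted_naturals lam \<beta> C" and s: "Re s > -1"
  shows "bessel_zeta \<nu> s = shifted_naturals.Z lam \<beta> C s / (s - 1)"
  unfolding bessel_zeta_def
proof (rule zeta_function_eq)
  interpret sn: shifted_naturals lam \<beta> C by fact
  let ?P = "\<lambda>k s. complex_of_real (bessel_lambda \<nu> k) powr (- s)"
  let ?g = "\<lambda>s. sn.Z s / (s - 1)"
  show "s \<in> {s. Re s > -1}" using s by simp
  have Zan: "sn.Z analytic_on {s. Re s > -1}"
    using sn.Z_holomorphic open_halfspace_Re_gt[of "-1"] by (simp add: analytic_on_open)
  have "?g nicely_meromorphic_on {s. Re s > -1}"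
    unfolding nicely_meromorphic_on_def
  proof safe
    show "?g meromorphic_on {s. Re s > -1}"
      by (intro meromorphic_intros analytic_on_imp_meromorphic_on Zan)
    fix z :: complex assume z: "-1 < Re z" and nt: "\<not> ?g \<midarrow>z\<rightarrow> ?g z"
    have cont: "isCont sn.Z z"
      using analytic_at_imp_isCont[OF analytic_on_subset[OF Zan]] z by simp
    \<comment> \<open>Inside this block the name denotes the equation \<open>z = 1\<close>. At this
      point division by zero gives the value 0 that the normalization prescribes at a pole.\<close>
    have zeta_deriv_0: "z = 1"
    proof (rule ccontr)
      assume "z \<noteq> 1"
      then have "isCont ?g z" using cont by (intro continuous_intros) auto
      then show False using nt by (simp add: isCont_def)
    qed
    then show "?g z = 0" by simp
    have "filterlim ?g at_infinity (at 1)"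
      using cont sn.Z_1 unfolding zeta_deriv_0 isCont_def
      by (intro filterlim_divide_at_infinity[of _ 1] tendsto_eq_intros filterlim_atI)
         (auto simp: eventually_at_filter)
    then show "is_pole ?g z" by (simp add: is_pole_def zeta_deriv_0)
  qed
  moreover have "(\<lambda>k. norm (?P k s)) summable_on {k. 0 < k} \<and> ?g s = (\<Sum>\<^sub>\<infinity>k\<in>{k. 0 < k}. ?P k s)" if s: "Re s > 1" for s
  proof -
    have n: "summable (\<lambda>k. norm (?P (int k + 1) s))"
      unfolding bessel_lambda_pos norm_of_real_powr[OF lam_pos] using s by (intro sn.l_powr_summable) simp
    have "(\<lambda>k. ?P (int k + 1) s) sums ?g s" unfolding bessel_lambda_pos using s by (rule sn.zeta_sums)
    from norm_summable_imp_has_sum[OF n this]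
    have "((\<lambda>k. ?P k s) has_sum ?g s) {k. 0 < k}"
      unfolding has_sum_reindex_bij_betw[OF bij_betw_positive, of "\<lambda>k. ?P k s"] .
    moreover have "(\<lambda>k. norm (?P k s)) summable_on {k. 0 < k}"
      using norm_summable_imp_summable_on[of "\<lambda>k. norm (?P (int k + 1) s)"] n
      by (simp add: summable_on_reindex_bij_betw[OF bij_betw_positive, of "\<lambda>k. norm (?P k s)"])
    ultimately show ?thesis by (simp add: infsumI)
  qed
  ultimately show "zeta_continuation {k. 0 < k} ?P {s. Re s > -1} ?g"
    unfolding zeta_continuation_def
    by (intro conjI open_halfspace_Re_gt convex_halfspace_Re_gt exI[of _ 1]) auto
qed

text \<open>The simple pole of the zeta function at 1 has residue 1 and meets the simple zero of 1 +
  exp (- pi i s), whose derivative there is pi i. The Laurent expansion is therefore a Taylor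
  expansion, and its constant term is the value.\<close>

lemma finite_part_bessel_zeta_star: "finite_part (bessel_zeta_star \<nu>) 1 = of_real pi * \<i>"
proof -
  obtain C where C: "shifted_naturals lam (\<nu>/2 + 3/4) C" using lam_shifted_naturals by blast
  interpret sn: shifted_naturals lam "\<nu>/2 + 3/4" C by fact
  define G where "G s = exp_quotient (s - 1) * sn.Z s" for s
  have "G holomorphic_on {s. Re s > -1}"
    unfolding G_def
    by (intro holomorphic_intros sn.Z_holomorphic holomorphic_on_compose_gen[OF _ exp_quotient_holomorphic, unfolded o_def]) auto
  then have "G analytic_on {1}"
    unfolding analytic_at by (intro exI[of _ "{s. Re s > -1}"]) (auto intro: open_halfspace_Re_gt)
  then have F: "(\<lambda>w. G (1 + w)) has_fps_expansion fps_expansion G 1"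
    by (rule analytic_at_imp_has_fps_expansion)
  have "\<forall>\<^sub>F s in at 1. s \<in> {s. Re s > -1} - {1}"
    by (intro eventually_at_in_open open_halfspace_Re_gt) simp
  then have "\<forall>\<^sub>F s in at 1. bessel_zeta_star \<nu> s = G s"
  proof eventually_elim
    case (elim s)
    then show ?case using bessel_zeta_eq[OF C, of s] exp_quotient_shift[of s]
      by (simp add: bessel_zeta_star_def G_def)
  qed
  then have "(\<lambda>w. bessel_zeta_star \<nu> (1 + w)) has_laurent_expansion fps_to_fls (fps_expansion G 1)"
    using has_laurent_expansion_fps[OF F] has_laurent_expansion_cong'[OF _ refl refl] by blast
  then have "laurent_expansion (bessel_zeta_star \<nu>) 1 = fps_to_fls (fps_expansion G 1)"
    by (rule laurent_expansion_eqI)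
  then have "finite_part (bessel_zeta_star \<nu>) 1 = fps_nth (fps_expansion G 1) 0"
    by (simp add: finite_part_def)
  also have "\<dots> = G 1" using has_fps_expansion_imp_0_eq_fps_nth_0[OF F] by simp
  finally show ?thesis by (simp add: G_def exp_quotient_def sn.Z_1)
qed

end

section \<open>Zeta regularized products over the Bessel zeros\<close>

lemma rel_mset_imp_image_mset_eq:
  assumes "rel_mset R A B" "\<And>a b. a \<in># A \<Longrightarrow> R a b \<Longrightarrow> f a = g b"
  shows "image_mset f A = image_mset g B"
  using assms by (induction rule: rel_mset_induct) auto

lemma prod_mset_exp: "(\<Prod>l\<in>#L. exp (c * l)) = exp (c * sum_mset L)" for c :: complex
  by (induction L) (auto simp: exp_add distrib_left)

lemma norm_sum_mset_le:
  fixes f :: "'a \<Rightarrow> complex"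
  assumes "\<And>w. w \<in># \<Omega> \<Longrightarrow> norm (f w) \<le> g w"
  shows "norm (\<Sum>w\<in>#\<Omega>. f w) \<le> (\<Sum>w\<in>#\<Omega>. g w)"
  using assms by (induction \<Omega>) (auto intro: norm_triangle_mono)

lemma tendsto_prod_prod_mset:
  fixes f :: "'a \<Rightarrow> nat \<Rightarrow> complex"
  assumes "\<And>w. (\<lambda>N. \<Prod>n<N. f w n) \<longlonglongrightarrow> F w"
  shows "(\<lambda>N. \<Prod>n<N. \<Prod>w\<in>#\<Omega>. f w n) \<longlonglongrightarrow> (\<Prod>w\<in>#\<Omega>. F w)"
  by (induction \<Omega>) (auto simp: prod.distrib intro!: tendsto_intros assms)

lemma eventually_le_imp_bound:
  fixes f :: "nat \<Rightarrow> complex" and l :: "nat \<Rightarrow> real"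
  assumes "\<And>n. l n > 0" "\<forall>\<^sub>F n in sequentially. norm (f n) \<le> Q / (l n)\<^sup>2" "Q \<ge> 0"
  obtains C where "C \<ge> 0" "\<And>n. norm (f n) \<le> C / (l n)\<^sup>2"
proof -
  obtain N where N: "\<And>n. n \<ge> N \<Longrightarrow> norm (f n) \<le> Q / (l n)\<^sup>2"
    using assms(2) by (auto simp: eventually_sequentially)
  define E where "E = (\<Sum>n<N. norm (f n) * (l n)\<^sup>2)"
  have E: "E \<ge> 0" unfolding E_def by (intro sum_nonneg) auto
  have "norm (f n) \<le> (Q + E) / (l n)\<^sup>2" for n
  proof (cases "n < N")
    case True
    then have "norm (f n) * (l n)\<^sup>2 \<le> E" unfolding E_def by (intro member_le_sum) auto
    then show ?thesis using assms(1)[of n] assms(3) by (simp add: le_divide_eq)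
  next
    case False
    then have "norm (f n) \<le> Q / (l n)\<^sup>2" using N by simp
    also have "\<dots> \<le> (Q + E) / (l n)\<^sup>2" using E by (intro divide_right_mono) auto
    finally show ?thesis .
  qed
  then show thesis using that[of "Q + E"] E assms(3) by simp
qed

section \<open>Logarithms of polynomial values at the zeros\<close>

context bessel
begin

context
  fixes \<Omega> L :: "_" and P :: "int \<Rightarrow> complex \<Rightarrow> complex"
  assumes \<Omega>: "\<Omega> \<noteq> {#}"
    and L: "\<And>k. k \<noteq> 0 \<Longrightarrow> rel_mset (factor_log \<nu> k) \<Omega> (L k)"
    and P: "\<And>k s. k \<noteq> 0 \<Longrightarrow> P k s = (\<Prod>l\<in>#L k. exp (- s * l))"
begin

lemma power_eq: "k \<noteq> 0 \<Longrightarrow> P k s = exp (- s * sum_mset (L k))"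
  using P[of k s] prod_mset_exp[of "- s" "L k"] by simp

lemma exp_sum_logs:
  assumes "k \<noteq> 0"
  shows "exp (sum_mset (L k)) = (\<Prod>w\<in>#\<Omega>. of_real (bessel_lambda \<nu> k) - w)"
proof -
  have "image_mset (\<lambda>w. of_real (bessel_lambda \<nu> k) - w) \<Omega> = image_mset exp (L k)"
    by (rule rel_mset_imp_image_mset_eq[OF L[OF assms]]) (simp add: factor_log_def)
  then show ?thesis using prod_mset_exp[of 1 "L k"] by simp
qed

text \<open>Once the zero is at least twice as large as every root, the branch of each logarithm is
  prescribed, and \<open>Ln (1 - w / \<lambda>)\<close> may be replaced by
  \<open>- w / \<lambda>\<close>. The factor 2 bounds 1 / (1 - |w / \<lambda>|).\<close>

lemma sum_logs_bound:
  assumes k: "k \<noteq> 0" and big: "\<And>w. w \<in># \<Omega> \<Longrightarrow> 2 * norm w \<le> \<bar>bessel_lambda \<nu> k\<bar>" and nz: "bessel_lambda \<nu> k \<noteq> 0"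
  shows "norm (sum_mset (L k) - of_nat (size \<Omega>) * log_bessel_lambda \<nu> k + sum_mset \<Omega> / of_real (bessel_lambda \<nu> k))
    \<le> (\<Sum>w\<in>#\<Omega>. 2 * (norm w)\<^sup>2) / (bessel_lambda \<nu> k)\<^sup>2"
proof -
  define r where "r = bessel_lambda \<nu> k"
  define f where "f w = Ln (1 - w / of_real r)" for w :: complex
  have "image_mset (\<lambda>w. log_bessel_lambda \<nu> k + f w) \<Omega> = image_mset (\<lambda>l. l) (L k)"
  proof (rule rel_mset_imp_image_mset_eq[OF L[OF k]])
    fix w l assume "w \<in># \<Omega>" "factor_log \<nu> k w l"
    moreover have "norm w < \<bar>bessel_lambda \<nu> k\<bar>"
      using big[OF \<open>w \<in># \<Omega>\<close>] nz norm_ge_zero[of w] by linarith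
    ultimately show "log_bessel_lambda \<nu> k + f w = l" by (simp add: factor_log_def f_def r_def)
  qed
  then have Lk: "sum_mset (L k) = (\<Sum>w\<in>#\<Omega>. log_bessel_lambda \<nu> k + f w)" by simp
  have gen: "(\<Sum>w\<in>#M. c + f w) - of_nat (size M) * c + sum_mset M / of_real r = (\<Sum>w\<in>#M. f w + w / of_real r)" for c and M :: "complex multiset"
    by (induction M) (auto simp: algebra_simps add_divide_distrib)
  from gen[of "log_bessel_lambda \<nu> k" \<Omega>]
  have "sum_mset (L k) - of_nat (size \<Omega>) * log_bessel_lambda \<nu> k + sum_mset \<Omega> / of_real r = (\<Sum>w\<in>#\<Omega>. f w + w / of_real r)"
    unfolding Lk by simp
  also have "norm \<dots> \<le> (\<Sum>w\<in>#\<Omega>. 2 * (norm w)\<^sup>2 / r\<^sup>2)"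
  proof (rule norm_sum_mset_le)
    fix w assume w: "w \<in># \<Omega>"
    have small: "norm (- (w / of_real r)) \<le> 1/2"
      using big[OF w] nz by (simp add: norm_divide r_def divide_le_eq)
    then have "norm (Ln (1 + - (w / of_real r)) - (- (w / of_real r))) \<le> (norm (- (w / of_real r)))\<^sup>2 / (1 - norm (- (w / of_real r)))"
      by (intro Ln_approx_linear) auto
    also have "\<dots> \<le> (norm (- (w / of_real r)))\<^sup>2 / (1/2)" using small by (intro divide_left_mono) auto
    finally show "norm (f w + w / of_real r) \<le> 2 * (norm w)\<^sup>2 / r\<^sup>2"
      by (simp add: f_def norm_divide power_divide mult.commute)
  qed
  also have "(\<Sum>w\<in>#M. 2 * (norm w)\<^sup>2 / r\<^sup>2) = (\<Sum>w\<in>#M. 2 * (norm w)\<^sup>2) / r\<^sup>2" for M :: "complex multiset"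
    by (induction M) (auto simp: add_divide_distrib)
  finally show ?thesis by (simp add: r_def)
qed

lemma eventually_large: "\<forall>\<^sub>F n in sequentially. \<forall>w\<in>#\<Omega>. 2 * norm w \<le> lam n"
  using lam_at_top by (auto simp: eventually_ball_finite filterlim_at_top)

lemma log_lambda_pos: "log_bessel_lambda \<nu> (int n + 1) = of_real (ln (lam n))"
  by (simp add: log_bessel_lambda_def bessel_lambda_pos)

lemma log_lambda_neg: "log_bessel_lambda \<nu> (- int n - 1) = of_real (ln (lam n)) + of_real pi * \<i>"
  using bessel_lambda_pos[of n] by (simp add: log_bessel_lambda_def add.commute)

text \<open>The logarithms at \<open>k = n + 1\<close> and \<open>k = - n - 1\<close>, relative to those of \<open>\<lambda>\<^sub>k\<close>.\<close>

definition logs_pos :: "nat \<Rightarrow> complex" where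
  "logs_pos n = sum_mset (L (int n + 1)) - of_nat (size \<Omega>) * of_real (ln (lam n))"
definition logs_neg :: "nat \<Rightarrow> complex" where
  "logs_neg n = sum_mset (L (- int n - 1)) - of_nat (size \<Omega>) * (of_real (ln (lam n)) + of_real pi * \<i>)"

text \<open>The finitely many indices with a free choice of branch only enlarge the constant. On the
  negative side the zero is \<open>- lam n\<close>, which reverses the sign of the leading
  coefficient.\<close>

lemma logs_bounds:
  obtains C where "\<And>n. norm (logs_pos n - (- sum_mset \<Omega>) / of_real (lam n)) \<le> C / (lam n)\<^sup>2"
    and "\<And>n. norm (logs_neg n - (- (- sum_mset \<Omega>)) / of_real (lam n)) \<le> C / (lam n)\<^sup>2"
proof -
  define Q where "Q = (\<Sum>w\<in>#\<Omega>. 2 * (norm w)\<^sup>2)"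
  have Q: "Q \<ge> 0" unfolding Q_def by (induction \<Omega>) auto
  have 1: "\<forall>\<^sub>F n in sequentially. norm (logs_pos n - (- sum_mset \<Omega>) / of_real (lam n)) \<le> Q / (lam n)\<^sup>2"
    using eventually_large
  proof eventually_elim
    case (elim n)
    then show ?case
      using sum_logs_bound[of "int n + 1"] lam_pos[of n]
      by (simp add: bessel_lambda_pos log_lambda_pos logs_pos_def Q_def)
  qed
  have 2: "\<forall>\<^sub>F n in sequentially. norm (logs_neg n - (- (- sum_mset \<Omega>)) / of_real (lam n)) \<le> Q / (lam n)\<^sup>2"
    using eventually_large
  proof eventually_elim
    case (elim n)
    then show ?case
      using sum_logs_bound[of "- int n - 1"] lam_pos[of n]
      by (simp add: bessel_lambda_neg log_lambda_neg logs_neg_def Q_def)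
  qed
  obtain C1 where C1: "C1 \<ge> 0" "\<And>n. norm (logs_pos n - (- sum_mset \<Omega>) / of_real (lam n)) \<le> C1 / (lam n)\<^sup>2"
    using eventually_le_imp_bound[OF lam_pos 1 Q] by blast
  obtain C2 where C2: "C2 \<ge> 0" "\<And>n. norm (logs_neg n - (- (- sum_mset \<Omega>)) / of_real (lam n)) \<le> C2 / (lam n)\<^sup>2"
    using eventually_le_imp_bound[OF lam_pos 2 Q] by blast
  have le: "C1 / (lam n)\<^sup>2 \<le> (C1 + C2) / (lam n)\<^sup>2" "C2 / (lam n)\<^sup>2 \<le> (C1 + C2) / (lam n)\<^sup>2" for n
    using C1 C2 by (auto intro!: divide_right_mono)
  show thesis
    by (rule that[of "C1 + C2"]) (rule order.trans[OF C1(2) le(1)], rule order.trans[OF C2(2) le(2)])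
qed

lemma powr_lam: "complex_of_real (lam n) powr z = exp (z * of_real (ln (lam n)))"
  using lam_pos[of n] by (simp add: powr_def Ln_of_real)

lemma power_pos_eq: "P (int n + 1) s = of_real (lam n) powr (- (of_nat (size \<Omega>) * s)) * exp (- s * logs_pos n)"
proof -
  have "P (int n + 1) s = exp (- s * sum_mset (L (int n + 1)))" by (rule power_eq) simp
  then show ?thesis unfolding powr_lam exp_add[symmetric] logs_pos_def by (simp add: algebra_simps)
qed

lemma power_neg_eq: "P (- int n - 1) s = exp (- (of_real pi * \<i> * (of_nat (size \<Omega>) * s))) *
    (of_real (lam n) powr (- (of_nat (size \<Omega>) * s)) * exp (- s * logs_neg n))"
proof -
  have "P (- int n - 1) s = exp (- s * sum_mset (L (- int n - 1)))" by (rule power_eq) simp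
  then show ?thesis unfolding powr_lam exp_add[symmetric] logs_neg_def by (simp add: algebra_simps)
qed

text \<open>Exponentiating removes the dependence on the branches, and the factors 1 - w / \<lambda>
  and 1 + w / \<lambda> of the two sides combine into a factor of the canonical product at
  \<open>w\<^sup>2\<close>.\<close>

lemma exp_logs: "exp (logs_pos n + logs_neg n) = (\<Prod>w\<in>#\<Omega>. 1 - w\<^sup>2 / of_real ((lam n)\<^sup>2))"
proof -
  define r where "r = complex_of_real (lam n)"
  have r: "r \<noteq> 0" using lam_pos[of n] by (simp add: r_def)
  have e1: "exp (complex_of_real (ln (lam n))) = r"
    using lam_pos[of n] by (simp add: r_def exp_of_real)
  moreover have "exp (complex_of_real (ln (lam n)) + of_real pi * \<i>) = - r"
    unfolding exp_add e1 by simp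
  ultimately have e: "exp (complex_of_real (ln (lam n))) = r" "exp (complex_of_real (ln (lam n)) + of_real pi * \<i>) = - r" .
  have "exp (logs_pos n) = (\<Prod>w\<in>#\<Omega>. r - w) / r ^ size \<Omega>"
    unfolding logs_pos_def exp_diff exp_of_nat_mult e using exp_sum_logs[of "int n + 1"]
    by (simp add: bessel_lambda_pos r_def)
  moreover have "exp (logs_neg n) = (\<Prod>w\<in>#\<Omega>. - r - w) / (- r) ^ size \<Omega>"
    unfolding logs_neg_def exp_diff exp_of_nat_mult e using exp_sum_logs[of "- int n - 1"]
    by (simp add: bessel_lambda_neg r_def)
  moreover have "(\<Prod>w\<in>#M. r - w) / r ^ size M * ((\<Prod>w\<in>#M. - r - w) / (- r) ^ size M) = (\<Prod>w\<in>#M. 1 - w\<^sup>2 / r\<^sup>2)" for M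
  proof (induction M)
    case (add w M)
    have e: "(r - w) / r * ((- r - w) / (- r)) = 1 - w\<^sup>2 / r\<^sup>2"
      using r by (simp add: field_simps power2_eq_square)
    have "x * A / (c * X) * (y * B / (c' * Y)) = x / c * (y / c') * (A / X * (B / Y))"
      for x A c X y B c' Y :: complex by (simp add: ac_simps)
    from this[of "r - w" _ r _ "- r - w" _ "- r", unfolded e] show ?case
      by (simp only: image_mset_add_mset prod_mset.add_mset size_add_mset power_Suc add.IH)
  qed simp
  ultimately show ?thesis by (simp add: exp_add r_def)
qed

text \<open>The derivative of \<open>paired_zeta\<close> at 0 is linear in the number of roots, in
  their sum and in the sum of the logarithms. Its exponential therefore splits into one factor per
  root, and the last part is evaluated by \<open>\<Phi>_product\<close>.\<close>

lemma poly_powers_product: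
  shows "zeta_regularizable {k. k \<noteq> 0} P"
    and "zeta_regularized_product {k. k \<noteq> 0} P =
      (\<Prod>w\<in>#\<Omega>. of_real (sqrt 2 * pi) * bessel_J_entire \<nu> w *
         exp (- (of_real pi * \<i> / 2) * of_real (\<nu> + 1/2) - w * finite_part (bessel_zeta_star \<nu>) 1))"
proof -
  define d where "d = size \<Omega>"
  define W where "W = sum_mset \<Omega>"
  have d: "d \<ge> 1" using \<Omega> by (cases \<Omega>) (auto simp: d_def)
  obtain C where C: "shifted_naturals lam (\<nu>/2 + 3/4) C"
    and zeta_deriv_0: "exp (- 2 * shifted_naturals.zeta_deriv_0 lam (\<nu>/2 + 3/4) C) = pi * sqrt 2 * b 0"
    using lam_shifted_naturals by blast
  interpret sn: shifted_naturals lam "\<nu>/2 + 3/4" C by fact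
  obtain C2 where a: "\<And>n. norm (logs_pos n - (- W) / of_real (lam n)) \<le> C2 / (lam n)\<^sup>2"
    and a': "\<And>n. norm (logs_neg n - (- (- W)) / of_real (lam n)) \<le> C2 / (lam n)\<^sup>2"
    using logs_bounds unfolding W_def by blast
  define S where "S = {s. Re s > - (1 / real d)}"
  define g where "g = sn.paired_zeta d logs_pos logs_neg (- W)"
  have S: "open S" "convex S" "0 \<in> S"
    using d by (auto simp: S_def open_halfspace_Re_gt convex_halfspace_Re_gt)
  have hol: "g holomorphic_on S" unfolding g_def S_def by (rule sn.paired_zeta_holomorphic[OF d a a'])
  have an: "g analytic_on S" using hol S by (simp add: analytic_on_open)
  have "(\<lambda>k. norm (P k s)) summable_on {k. k \<noteq> 0} \<and> g s = infsum (\<lambda>k. P k s) {k. k \<noteq> 0}" if s: "Re s > 1 / real d" for s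
  proof -
    have n1: "summable (\<lambda>n. norm (P (int n + 1) s))"
      unfolding power_pos_eq d_def[symmetric] by (rule sn.perturbed_zeta_sums(2)[OF d a s])
    have q: "summable (\<lambda>n. norm (of_real (lam n) powr (- (of_nat d * s)) * exp (- s * logs_neg n)))"
      by (rule sn.perturbed_zeta_sums(2)[OF d a' s])
    have n2: "summable (\<lambda>n. norm (P (- int n - 1) s))"
      unfolding power_neg_eq d_def[symmetric] norm_mult[of "exp (- (of_real pi * \<i> * (of_nat d * s)))"]
      by (rule summable_mult[OF q])
    have "g s = (\<Sum>n. P (int n + 1) s) + (\<Sum>n. P (- int n - 1) s)"
      unfolding g_def sn.paired_zeta_eq[OF d a a' s] power_pos_eq power_neg_eq d_def[symmetric]
      by (simp only: suminf_mult[OF summable_norm_cancel[OF q]])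
    then show ?thesis using has_sum_nonzero_int[of "\<lambda>k. P k s", OF n1 n2] by simp
  qed
  moreover have "s \<in> S" if "Re s > 1 / real d" for s
  proof -
    have "1 / real d > 0" using d by simp
    then have "Re s > - (1 / real d)" using that by linarith
    then show ?thesis by (simp add: S_def)
  qed
  ultimately have cont: "zeta_continuation {k. k \<noteq> 0} P S g"
    unfolding zeta_continuation_def
    using S analytic_on_imp_nicely_meromorphic_on[OF an] by blast
  show "zeta_regularizable {k. k \<noteq> 0} P"
    unfolding zeta_regularizable_def using cont S an analytic_on_subset[OF an, of "{0}"] by blast
  \<comment> \<open>The power with exponent \<open>size M\<close> is distributed over the roots. The
    \<open>b 0\<close> from \<open>exp (- 2 \<zeta>'(0))\<close> cancels the denominator that the
    product formula contributes for each root.\<close>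
  have collect: "(e * of_real (pi * sqrt 2 * b 0)) ^ size M * exp (- sum_mset M * (of_real pi * \<i>)) * (\<Prod>w\<in>#M. \<Phi> (w\<^sup>2) / of_real (b 0))
     = (\<Prod>w\<in>#M. of_real (sqrt 2 * pi) * \<Phi> (w\<^sup>2) * (e * exp (- (w * (of_real pi * \<i>)))))" for e :: complex and M
  proof (induction M)
    case (add w M)
    have E: "exp (- sum_mset (add_mset w M) * (of_real pi * \<i>)) = exp (- (w * (of_real pi * \<i>))) * exp (- sum_mset M * (of_real pi * \<i>))"
      unfolding exp_add[symmetric] by (simp add: algebra_simps)
    have "K ^ Suc k * (x * y) * (F / B * R) = c * F * (e * x) * (K ^ k * y * R)"
      if "K = e * (c * B)" "B \<noteq> 0" for K B F R c x y :: complex and k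
      using that(2) by (simp add: that(1) ac_simps)
    moreover have "e * of_real (pi * sqrt 2 * b 0) = e * (of_real (sqrt 2 * pi) * of_real (b 0))" by simp
    moreover have "complex_of_real (b 0) \<noteq> 0" using b_0_pos by simp
    ultimately show ?case
      by (simp only: image_mset_add_mset prod_mset.add_mset size_add_mset E add.IH[symmetric])
  qed simp
  have "\<forall>\<^sub>F s in nhds 0. zeta_function {k. k \<noteq> 0} P s = g s"
    using eventually_nhds_in_open[OF S(1,3)] by eventually_elim (rule zeta_function_eq[OF cont])
  then have "deriv (zeta_function {k. k \<noteq> 0} P) 0 = deriv g 0" by (rule deriv_cong_ev) simp
  also have "\<dots> = of_nat d * (of_real pi * \<i> * of_real (\<nu>/2 + 3/4 - 1/2) + of_real (2 * sn.zeta_deriv_0)) - (- W) * (of_real pi * \<i>)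
      - (\<Sum>n. logs_pos n + logs_neg n)"
    unfolding g_def by (rule sn.paired_zeta_deriv_0(2)[OF d a a'])
  finally have D: "deriv (zeta_function {k. k \<noteq> 0} P) 0 = \<dots>" .
  have half: "complex_of_real (\<nu>/2 + 3/4 - 1/2) = of_real (\<nu> + 1/2) / 2" by (simp add: field_simps)
  have rearrange: "- (e * (p * (x / 2) + of_real (2 * z)) - (- V) * p - \<sigma>) = e * (- (p / 2) * x + of_real (- 2 * z)) + (- V * p) + \<sigma>"
    for e p x V \<sigma> :: complex and z :: real by (simp add: algebra_simps)
  have "- deriv (zeta_function {k. k \<noteq> 0} P) 0 =
      of_nat d * (- (of_real pi * \<i> / 2) * of_real (\<nu> + 1/2) + of_real (- 2 * sn.zeta_deriv_0)) + (- W * (of_real pi * \<i>))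
      + (\<Sum>n. logs_pos n + logs_neg n)"
    unfolding D half by (rule rearrange)
  then have "zeta_regularized_product {k. k \<noteq> 0} P =
      (exp (- (of_real pi * \<i> / 2) * of_real (\<nu> + 1/2)) * exp (of_real (- 2 * sn.zeta_deriv_0))) ^ d * exp (- W * (of_real pi * \<i>))
      * exp (\<Sum>n. logs_pos n + logs_neg n)"
    unfolding zeta_regularized_product_def by (simp only: exp_add exp_of_nat_mult)
  also have "exp (complex_of_real (- 2 * sn.zeta_deriv_0)) = of_real (pi * sqrt 2 * b 0)" unfolding exp_of_real zeta_deriv_0 ..
  \<comment> \<open>Both sides are limits of the same partial products, one through continuity of
    \<open>exp\<close>, the other as a finite product of canonical products.\<close>
  also have "exp (\<Sum>n. logs_pos n + logs_neg n) = (\<Prod>w\<in>#\<Omega>. \<Phi> (w\<^sup>2) / of_real (b 0))"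
  proof (rule LIMSEQ_unique)
    have "(\<lambda>N. \<Sum>n<N. logs_pos n + logs_neg n) \<longlonglongrightarrow> (\<Sum>n. logs_pos n + logs_neg n)"
      by (rule summable_LIMSEQ[OF sn.paired_zeta_deriv_0(1)[OF d a a']])
    from tendsto_exp[OF this]
    show "(\<lambda>N. \<Prod>n<N. \<Prod>w\<in>#\<Omega>. 1 - w\<^sup>2 / of_real ((lam n)\<^sup>2)) \<longlonglongrightarrow> exp (\<Sum>n. logs_pos n + logs_neg n)"
      by (simp only: exp_sum finite_lessThan exp_logs)
    show "(\<lambda>N. \<Prod>n<N. \<Prod>w\<in>#\<Omega>. 1 - w\<^sup>2 / of_real ((lam n)\<^sup>2)) \<longlonglongrightarrow> (\<Prod>w\<in>#\<Omega>. \<Phi> (w\<^sup>2) / of_real (b 0))"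
      by (intro tendsto_prod_prod_mset has_prod_imp_tendsto' \<Phi>_product)
  qed
  also have "(exp (- (of_real pi * \<i> / 2) * of_real (\<nu> + 1/2)) * of_real (pi * sqrt 2 * b 0)) ^ d * exp (- W * (of_real pi * \<i>))
      * (\<Prod>w\<in>#\<Omega>. \<Phi> (w\<^sup>2) / of_real (b 0)) = (\<Prod>w\<in>#\<Omega>. of_real (sqrt 2 * pi) * \<Phi> (w\<^sup>2) *
        (exp (- (of_real pi * \<i> / 2) * of_real (\<nu> + 1/2)) * exp (- (w * (of_real pi * \<i>)))))"
    unfolding d_def W_def by (rule collect)
  finally show "zeta_regularized_product {k. k \<noteq> 0} P =
      (\<Prod>w\<in>#\<Omega>. of_real (sqrt 2 * pi) * bessel_J_entire \<nu> w *
         exp (- (of_real pi * \<i> / 2) * of_real (\<nu> + 1/2) - w * finite_part (bessel_zeta_star \<nu>) 1))"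
    by (simp only: bessel_J_entire_eq finite_part_bessel_zeta_star diff_conv_add_uminus exp_add)
qed

end
end

section \<open>The theorem for several polynomials\<close>

lemma prod_mset_image_sum:
  fixes M :: "'i \<Rightarrow> 'a multiset" and f :: "'a \<Rightarrow> 'b::comm_monoid_mult"
  assumes "finite J"
  shows "(\<Prod>w\<in>#(\<Sum>j\<in>J. M j). f w) = (\<Prod>j\<in>J. \<Prod>w\<in>#M j. f w)"
  using assms by (induction J rule: finite_induct) simp_all

text \<open>Every regularized product here equals the product, over the roots of its polynomial, of
  a factor depending on the root alone and not on the chosen branches. The equality follows because
  the roots of a product are the multiset sum of the roots of its factors, even if \<open>P\<close>
  and the \<open>Q j\<close> use different branches.\<close>

theorem corollary3p9:
  fixes \<nu> :: real and n :: nat and \<phi> :: "nat \<Rightarrow> complex poly"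
    and P :: "int \<Rightarrow> complex \<Rightarrow> complex" and Q :: "nat \<Rightarrow> int \<Rightarrow> complex \<Rightarrow> complex"
  assumes "\<nu> \<ge> 1/2" and "n \<ge> 1"
    and "\<forall>j\<in>{1..n}. lead_coeff (\<phi> j) = 1 \<and> degree (\<phi> j) > 0"
    and "\<forall>j\<in>{1..n}. \<forall>k. k \<noteq> 0 \<longrightarrow> poly (\<phi> j) (of_real (bessel_zero \<nu> k / pi)) \<noteq> 0"
    and "poly_powers \<nu> (\<Prod>j=1..n. \<phi> j) P"
    and "\<forall>j\<in>{1..n}. poly_powers \<nu> (\<phi> j) (Q j)"
  shows "zeta_regularizable {k. k \<noteq> 0} P \<and>
         (\<forall>j\<in>{1..n}. zeta_regularizable {k. k \<noteq> 0} (Q j)) \<and>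
         zeta_regularized_product {k. k \<noteq> 0} P
           = (\<Prod>j=1..n. zeta_regularized_product {k. k \<noteq> 0} (Q j)) \<and>
         (\<Prod>j=1..n. zeta_regularized_product {k. k \<noteq> 0} (Q j))
           = (\<Prod>w\<in>#(\<Sum>j=1..n. proots (\<phi> j)).
                of_real (sqrt 2 * pi) * bessel_J_entire \<nu> w *
                exp (- (of_real pi * \<i> / 2) * of_real (\<nu> + 1/2)
                     - w * finite_part (bessel_zeta_star \<nu>) 1))"
proof -
  interpret bessel \<nu> by unfold_locales (fact assms(1))
  define F where "F w = of_real (sqrt 2 * pi) * bessel_J_entire \<nu> w *
      exp (- (of_real pi * \<i> / 2) * of_real (\<nu> + 1/2) - w * finite_part (bessel_zeta_star \<nu>) 1)" for w
  have main: "zeta_regularizable {k. k \<noteq> 0} R \<and> zeta_regularized_product {k. k \<noteq> 0} R = (\<Prod>w\<in>#proots p. F w)"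
    if "poly_powers \<nu> p R" "proots p \<noteq> {#}" for p R
  proof -
    have "\<forall>k. \<exists>L. k \<noteq> 0 \<longrightarrow> rel_mset (factor_log \<nu> k) (proots p) L \<and> (\<forall>s. R k s = (\<Prod>l\<in>#L. exp (- s * l)))"
      using that(1) unfolding poly_powers_def by simp
    from choice[OF this] obtain L where "\<forall>k. k \<noteq> 0 \<longrightarrow>
        rel_mset (factor_log \<nu> k) (proots p) (L k) \<and> (\<forall>s. R k s = (\<Prod>l\<in>#L k. exp (- s * l)))"
      by (rule exE)
    then have L: "rel_mset (factor_log \<nu> k) (proots p) (L k)" "R k s = (\<Prod>l\<in>#L k. exp (- s * l))"
      if "k \<noteq> 0" for k s
      using that by simp_all
    from poly_powers_product[OF that(2) L] show ?thesis unfolding F_def by simp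
  qed
  have roots: "proots (\<phi> j) \<noteq> {#}" if "j \<in> {1..n}" for j
    using bspec[OF assms(3) that] size_proots_complex[of "\<phi> j"] by auto
  have "\<phi> j \<noteq> 0" if "j \<in> {1..n}" for j using bspec[OF assms(3) that] by auto
  then have sum: "proots (\<Prod>j=1..n. \<phi> j) = (\<Sum>j=1..n. proots (\<phi> j))" by (intro proots_prod) auto
  have "(\<Sum>j=1..n. proots (\<phi> j)) = proots (\<phi> 1) + (\<Sum>j\<in>{1..n} - {1}. proots (\<phi> j))"
    using assms(2) by (intro sum.remove) auto
  then have ne: "proots (\<Prod>j=1..n. \<phi> j) \<noteq> {#}" using roots[of 1] assms(2) unfolding sum by simp
  have Q: "(\<Prod>j=1..n. zeta_regularized_product {k. k \<noteq> 0} (Q j)) = (\<Prod>w\<in>#(\<Sum>j=1..n. proots (\<phi> j)). F w)"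
    unfolding prod_mset_image_sum[OF finite_atLeastAtMost]
  proof (rule prod.cong[OF refl])
    fix j assume j: "j \<in> {1..n}"
    show "zeta_regularized_product {k. k \<noteq> 0} (Q j) = (\<Prod>w\<in>#proots (\<phi> j). F w)"
      using main[OF _ roots[OF j]] assms(6) j by simp
  qed
  have P: "zeta_regularizable {k. k \<noteq> 0} P"
    "zeta_regularized_product {k. k \<noteq> 0} P = (\<Prod>w\<in>#(\<Sum>j=1..n. proots (\<phi> j)). F w)"
    using main[OF assms(5) ne] unfolding sum by simp_all
  have "zeta_regularizable {k. k \<noteq> 0} (Q j)" if "j \<in> {1..n}" for j
    using main[OF _ roots[OF that]] assms(6) that by simp
  then show ?thesis unfolding F_def[symmetric] using P Q by simp
qed

end
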